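(* Let $H$ be the minimal Schr\"odinger operator in $L^2(\mathbb{R}^3)$ associated with distinct points $x_1,\dots,x_m\in\mathbb{R}^3$, let $\Pi=\{\mathbb{C}^m,\Gamma_0,\Gamma_1\}$ be the boundary triplet for $H^*$ described in the context, and let $$E_0=\Bigl(\tfrac{e^{-|x_k-x_j|}}{|x_k-x_j|-\delta_{kj}}\Bigr)_{j,k=1}^m,\qquad E_1=\bigl(e^{-|x_k-x_j|}\bigr)_{k,j=1}^m .$$ Then the set of self-adjoint extensions $\widetilde H$ of $H$ is parameterized as $$\widetilde H=H_\Theta=H^*\upharpoonright\Bigl\{f=\sum_{j=1}^m\bigl(\xi_{0j}\tfrac{e^{-r_j}}{r_j}+\xi_{1j}e^{-r_j}\bigr)+f_H\in\operatorname{dom}(H^* ):\ \{\Gamma_0f,\Gamma_1f\}\in\Theta\Bigr\},$$ where $\Theta$ runs through the set of all self-adjoint linear relations in $\mathbb{C}^m$. Moreover, the multivalued part $\Theta_\infty$ and operator part $\Theta_{\rm op}$ of $\Theta$ are given by $$\Theta_\infty=\bigl\{\{0,E_1\xi_1''\}:\ \xi_1''\perp E_1\xi_0 \text{ for all } \xi_0\in\mathcal H_{\rm op}\bigr\},$$ $$\Theta_{\rm op}=\bigl\{\{4\pi\xi_0,\,E_0\xi_0+E_1\xi_1'\}:\ \xi_0\in\mathcal H_{\rm op},\ \xi_1'=E_1^{-1}(4\pi B\xi_0-E_0\xi_0)\bigr\},$$ where $B=B^*$ is a linear operator in $\mathcal H_{\rm op}$. In particular, $\widetilde H=H_\Theta$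 is disjoint with $H_0=H^*\upharpoonright\ker(\Gamma_0)$ if and only if $\operatorname{dom}(\Theta)=\mathbb{C}^m$; in this case $\Theta=\Theta_{\rm op}$ is the graph of $B$.
   Context: Let $m\in\mathbb{N}$, $x_1,\dots,x_m\in\mathbb{R}^3$ distinct, $r_j=r_j(x)=|x-x_j|$, $\delta_{kj}$ the Kronecker symbol. $H=-\Delta$ in $L^2(\mathbb{R}^3)$ with $\operatorname{dom}(H)=\{f\in W^{2,2}(\mathbb{R}^3):f(x_j)=0,\ j=1,\dots,m\}$ is closed and symmetric with deficiency indices $(m,m)$, and $$\operatorname{dom}(H^* )=\Bigl\{f=\sum_{j=1}^m\bigl(\xi_{0j}\tfrac{e^{-r_j}}{r_j}+\xi_{1j}e^{-r_j}\bigr)+f_H:\ \xi_0=\{\xi_{0j}\},\xi_1=\{\xi_{1j}\}\in\mathbb{C}^m,\ f_H\in\operatorname{dom}(H)\Bigr\}.$$ For $f\in\operatorname{dom}(H^* )$: $\Gamma_0f=4\pi\{\lim_{x\to x_j}f(x)|x-x_j|\}_{j=1}^m=4\pi\{\xi_{0j}\}_{j=1}^m$, $\Gamma_1f=\{\lim_{x\to x_j}(f(x)-\tfrac{\xi_{0j}}{|x-x_j|})\}_{j=1}^m$. A boundary triplet satisfies $(H^*f,g)-(f,H^*g)=(\Gamma_1f,\Gamma_0g)-(\Gamma_0f,\Gamma_1g)$ on $\operatorname{dom}(H^* )$, with $(\Gamma_0,\Gamma_1)^\top$ surjective onto $\mathbb{C}^m\oplus\mathbb{C}^m$. A linear relation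 $\Theta$ in $\mathbb{C}^m$ is a linear subspace of $\mathbb{C}^m\oplus\mathbb{C}^m$; $\Theta^*=\{\{k,k'\}:(h',k)=(h,k')\ \forall\{h,h'\}\in\Theta\}$; $\Theta$ is self-adjoint if $\Theta=\Theta^*$. $\operatorname{dom}(\Theta)=\{h:\{h,h'\}\in\Theta \text{ for some } h'\}$, $\operatorname{mul}(\Theta)=\{h':\{0,h'\}\in\Theta\}$. For self-adjoint $\Theta$, $\mathcal H_{\rm op}=\overline{\operatorname{dom}(\Theta)}$ and $\mathcal H_\infty=\operatorname{mul}(\Theta)=\mathcal H_{\rm op}^\perp$, and $\Theta=\Theta_{\rm op}\oplus\Theta_\infty$, where $\Theta_{\rm op}$ is (the graph of) a self-adjoint operator in $\mathcal H_{\rm op}$ and $\Theta_\infty=\{\{0,f'\}:f'\in\operatorname{mul}(\Theta)\}$. Two extensions $\widetilde A_1,\widetilde A_2$ of $H$ contained in $H^*$ are disjoint if $\operatorname{dom}(\widetilde A_1)\cap\operatorname{dom}(\widetilde A_2)=\operatorname{dom}(H)$. *)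

theory Defs
  imports "HOL-Analysis.Analysis"
begin

section \<open>The Hilbert space of square-integrable functions on three-space\<close>

text \<open>
  Elements of the Hilbert space are handled through Borel representatives; two representatives
  are identified when they agree almost everywhere.
\<close>

type_synonym fn3 = "real^3 \<Rightarrow> complex"

definition L2 :: "fn3 set" where
  "L2 = {f. f \<in> borel_measurable lborel \<and> integrable lborel (\<lambda>y. (norm (f y))\<^sup>2)}"

definition ae_eq :: "fn3 \<Rightarrow> fn3 \<Rightarrow> bool" where
  "ae_eq f g \<longleftrightarrow> (AE y in lborel. f y = g y)"

definition L2_inner :: "fn3 \<Rightarrow> fn3 \<Rightarrow> complex" where
  "L2_inner f g = (LINT y|lborel. f y * cnj (g y))"

text \<open>
  An operator is given by its graph, a set of pairs of representatives that does not depend on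
  the choice of representatives. Thus equality of graphs is equality of operators.
\<close>

definition L2_operator :: "(fn3 \<times> fn3) set \<Rightarrow> bool" where
  "L2_operator A \<longleftrightarrow>
     A \<subseteq> L2 \<times> L2 \<and>
     (\<forall>f g f' g'. (f, g) \<in> A \<and> f' \<in> L2 \<and> g' \<in> L2 \<and> ae_eq f f' \<and> ae_eq g g' \<longrightarrow> (f', g') \<in> A) \<and>
     (\<lambda>_. 0, \<lambda>_. 0) \<in> A \<and>
     (\<forall>f g f' g'. (f, g) \<in> A \<and> (f', g') \<in> A \<longrightarrow> (\<lambda>y. f y + f' y, \<lambda>y. g y + g' y) \<in> A) \<and>
     (\<forall>c f g. (f, g) \<in> A \<longrightarrow> (\<lambda>y. c * f y, \<lambda>y. c * g y) \<in> A) \<and>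
     (\<forall>f g f' g'. (f, g) \<in> A \<and> (f', g') \<in> A \<and> ae_eq f f' \<longrightarrow> ae_eq g g')"

definition L2_dense :: "fn3 set \<Rightarrow> bool" where
  "L2_dense D \<longleftrightarrow> (\<forall>f\<in>L2. \<forall>e>0. \<exists>g\<in>D. (LINT y|lborel. (norm (f y - g y))\<^sup>2) < e)"

definition L2_adjoint :: "(fn3 \<times> fn3) set \<Rightarrow> (fn3 \<times> fn3) set" where
  "L2_adjoint A = {(g, g') \<in> L2 \<times> L2. \<forall>(f, f')\<in>A. L2_inner f' g = L2_inner f g'}"

definition L2_self_adjoint :: "(fn3 \<times> fn3) set \<Rightarrow> bool" where
  "L2_self_adjoint A \<longleftrightarrow> L2_operator A \<and> L2_dense (Domain A) \<and> L2_adjoint A = A"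


section \<open>Weak derivatives and the Sobolev spaces\<close>

definition pdiff :: "3 \<Rightarrow> (real^3 \<Rightarrow> real) \<Rightarrow> real^3 \<Rightarrow> real" where
  "pdiff i \<phi> y = frechet_derivative \<phi> (at y) (axis i 1)"

text \<open>A list of coordinate directions plays the role of a multi-index.\<close>

definition pdiffs :: "3 list \<Rightarrow> (real^3 \<Rightarrow> real) \<Rightarrow> real^3 \<Rightarrow> real" where
  "pdiffs is \<phi> = foldr pdiff is \<phi>"

definition test_function :: "(real^3 \<Rightarrow> real) \<Rightarrow> bool" where
  "test_function \<phi> \<longleftrightarrow>
     (\<forall>is. pdiffs is \<phi> differentiable_on UNIV) \<and> compact (closure {y. \<phi> y \<noteq> 0})"

definition weak_deriv :: "3 list \<Rightarrow> fn3 \<Rightarrow> fn3 \<Rightarrow> bool" where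
  "weak_deriv is f g \<longleftrightarrow>
     (\<forall>\<phi>. test_function \<phi> \<longrightarrow>
        (LINT y|lborel. f y * of_real (pdiffs is \<phi> y)) =
        (- 1) ^ length is * (LINT y|lborel. g y * of_real (\<phi> y)))"

definition sobolev_W2 :: "nat \<Rightarrow> fn3 set" where
  "sobolev_W2 k = {f \<in> L2. \<forall>is. length is \<le> k \<longrightarrow> (\<exists>g\<in>L2. weak_deriv is f g)}"

definition is_laplacian :: "fn3 \<Rightarrow> fn3 \<Rightarrow> bool" where
  "is_laplacian f g \<longleftrightarrow>
     (\<exists>d. (\<forall>i. d i \<in> L2 \<and> weak_deriv [i, i] f (d i)) \<and> ae_eq g (\<lambda>y. \<Sum>i\<in>UNIV. d i y))"


section \<open>The minimal operator, its adjoint and the boundary maps\<close>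

text \<open>
  By the Sobolev embedding every element of the second-order space has a (unique) continuous
  representative; point values refer to it.
\<close>

definition dom_H :: "('m::finite \<Rightarrow> real^3) \<Rightarrow> fn3 set" where
  "dom_H x = {f \<in> sobolev_W2 2.
     \<exists>g. continuous_on UNIV g \<and> ae_eq f g \<and> (\<forall>j. g (x j) = 0)}"

definition H_min :: "('m::finite \<Rightarrow> real^3) \<Rightarrow> (fn3 \<times> fn3) set" where
  "H_min x = {(f, g). f \<in> dom_H x \<and> g \<in> L2 \<and> is_laplacian f (\<lambda>y. - g y)}"

definition H_max :: "('m::finite \<Rightarrow> real^3) \<Rightarrow> (fn3 \<times> fn3) set" where
  "H_max x = L2_adjoint (H_min x)"

text \<open>
  The limits defining the boundary maps refer to the representative that is continuous away
  from the points; its values off the points are uniquely determined.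
\<close>

definition cont_rep :: "('m::finite \<Rightarrow> real^3) \<Rightarrow> fn3 \<Rightarrow> fn3" where
  "cont_rep x f = (SOME g. continuous_on (- range x) g \<and> ae_eq f g)"

definition sing_coeff :: "('m::finite \<Rightarrow> real^3) \<Rightarrow> fn3 \<Rightarrow> 'm \<Rightarrow> complex" where
  "sing_coeff x f j = Lim (at (x j)) (\<lambda>y. cont_rep x f y * of_real (norm (y - x j)))"

definition Gamma0 :: "('m::finite \<Rightarrow> real^3) \<Rightarrow> fn3 \<Rightarrow> complex^'m" where
  "Gamma0 x f = (\<chi> j. 4 * of_real pi * sing_coeff x f j)"

definition Gamma1 :: "('m::finite \<Rightarrow> real^3) \<Rightarrow> fn3 \<Rightarrow> complex^'m" where
  "Gamma1 x f = (\<chi> j. Lim (at (x j))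
     (\<lambda>y. cont_rep x f y - sing_coeff x f j / of_real (norm (y - x j))))"

definition H_ext ::
  "('m::finite \<Rightarrow> real^3) \<Rightarrow> ((complex^'m) \<times> (complex^'m)) set \<Rightarrow> (fn3 \<times> fn3) set" where
  "H_ext x \<Theta> = {(f, g) \<in> H_max x.
     (\<exists>(\<xi>0 :: complex^'m) (\<xi>1 :: complex^'m) fH. fH \<in> dom_H x \<and>
        ae_eq f (\<lambda>y. (\<Sum>j\<in>UNIV. \<xi>0 $ j * of_real (exp (- norm (y - x j)) / norm (y - x j))
                             + \<xi>1 $ j * of_real (exp (- norm (y - x j)))) + fH y)) \<and>
     (Gamma0 x f, Gamma1 x f) \<in> \<Theta>}"

definition H_zero :: "('m::finite \<Rightarrow> real^3) \<Rightarrow> (fn3 \<times> fn3) set" where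
  "H_zero x = {(f, g) \<in> H_max x. Gamma0 x f = 0}"

definition disjoint_ext ::
  "('m::finite \<Rightarrow> real^3) \<Rightarrow> (fn3 \<times> fn3) set \<Rightarrow> (fn3 \<times> fn3) set \<Rightarrow> bool" where
  "disjoint_ext x A1 A2 \<longleftrightarrow> Domain A1 \<inter> Domain A2 = Domain (H_min x)"


section \<open>Linear relations in a finite-dimensional complex space\<close>

text \<open>The class inner product on complex vectors is only the real part of this one.\<close>

definition cinner :: "complex^('m::finite) \<Rightarrow> complex^'m \<Rightarrow> complex" where
  "cinner h k = (\<Sum>j\<in>UNIV. h $ j * cnj (k $ j))"

definition linear_relation :: "((complex^('m::finite)) \<times> (complex^'m)) set \<Rightarrow> bool" where
  "linear_relation \<Theta> \<longleftrightarrow>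
     (0, 0) \<in> \<Theta> \<and>
     (\<forall>h h' k k'. (h, h') \<in> \<Theta> \<and> (k, k') \<in> \<Theta> \<longrightarrow> (h + k, h' + k') \<in> \<Theta>) \<and>
     (\<forall>c h h'. (h, h') \<in> \<Theta> \<longrightarrow> (c *s h, c *s h') \<in> \<Theta>)"

text \<open>The adjoint of a relation in the subspace \<open>K\<close>, taken within \<open>K\<close>.\<close>

definition rel_adjoint_in ::
  "(complex^('m::finite)) set \<Rightarrow> ((complex^'m) \<times> (complex^'m)) set \<Rightarrow> ((complex^'m) \<times> (complex^'m)) set" where
  "rel_adjoint_in K \<Theta> = {(k, k') \<in> K \<times> K. \<forall>(h, h')\<in>\<Theta>. cinner h' k = cinner h k'}"

definition self_adjoint_relation :: "((complex^('m::finite)) \<times> (complex^'m)) set \<Rightarrow> bool" where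
  "self_adjoint_relation \<Theta> \<longleftrightarrow> linear_relation \<Theta> \<and> rel_adjoint_in UNIV \<Theta> = \<Theta>"

definition rel_mul :: "((complex^('m::finite)) \<times> (complex^'m)) set \<Rightarrow> (complex^'m) set" where
  "rel_mul \<Theta> = {h'. (0, h') \<in> \<Theta>}"

definition H_op :: "((complex^('m::finite)) \<times> (complex^'m)) set \<Rightarrow> (complex^'m) set" where
  "H_op \<Theta> = closure (Domain \<Theta>)"

definition rel_inf_part ::
  "((complex^('m::finite)) \<times> (complex^'m)) set \<Rightarrow> ((complex^'m) \<times> (complex^'m)) set" where
  "rel_inf_part \<Theta> = {(0, h') | h'. h' \<in> rel_mul \<Theta>}"

definition rel_op_part ::
  "((complex^('m::finite)) \<times> (complex^'m)) set \<Rightarrow> ((complex^'m) \<times> (complex^'m)) set" where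
  "rel_op_part \<Theta> = \<Theta> \<inter> (H_op \<Theta> \<times> H_op \<Theta>)"

definition linear_operator_in ::
  "(complex^('m::finite)) set \<Rightarrow> (complex^'m \<Rightarrow> complex^'m) \<Rightarrow> bool" where
  "linear_operator_in K B \<longleftrightarrow>
     (\<forall>h\<in>K. B h \<in> K) \<and> (\<forall>h\<in>K. \<forall>k\<in>K. B (h + k) = B h + B k) \<and> (\<forall>c. \<forall>h\<in>K. B (c *s h) = c *s B h)"

definition graph_in ::
  "(complex^('m::finite)) set \<Rightarrow> (complex^'m \<Rightarrow> complex^'m) \<Rightarrow> ((complex^'m) \<times> (complex^'m)) set" where
  "graph_in K B = {(h, B h) | h. h \<in> K}"

definition self_adjoint_operator_in ::
  "(complex^('m::finite)) set \<Rightarrow> (complex^'m \<Rightarrow> complex^'m) \<Rightarrow> bool" where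
  "self_adjoint_operator_in K B \<longleftrightarrow>
     linear_operator_in K B \<and> rel_adjoint_in K (graph_in K B) = graph_in K B"


section \<open>The matrices of the point configuration\<close>

definition E0 :: "('m::finite \<Rightarrow> real^3) \<Rightarrow> complex^'m^'m" where
  "E0 x = (\<chi> j k. of_real (exp (- norm (x k - x j)) /
                            (norm (x k - x j) - (if k = j then 1 else 0))))"

definition E1 :: "('m::finite \<Rightarrow> real^3) \<Rightarrow> complex^'m^'m" where
  "E1 x = (\<chi> k j. of_real (exp (- norm (x k - x j))))"

end

theory Submission
  imports Defs "HOL-Probability.Probability" "HOL-Real_Asymp.Real_Asymp"
begin

text \<open>
  Everything is expressed through the resolvent \<open>R\<close> of the free Laplacian at \<open>-1\<close>, the convolution
  with the Yukawa potential \<open>G y = exp (- norm y) / (4 * pi * norm y)\<close>. Writing \<open>G\<close> as the integral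
  of \<open>exp (- t)\<close> times the heat kernel over \<open>t > 0\<close> avoids spherical coordinates: it shows that \<open>G\<close>
  has integral \<open>1\<close>, that the convolution of \<open>G\<close> with itself is \<open>exp (- norm y) / (8 * pi)\<close>, and that
  \<open>R\<close> inverts \<open>1 - laplacian\<close> on test functions. By translation invariance and the symmetry of
  \<open>R\<close>, the Sobolev space of order two is the range of \<open>R\<close> on \<open>L2\<close>, and \<open>R h\<close> is always continuous
  with \<open>R h p\<close> equal to the pairing of \<open>h\<close> with \<open>G\<close> centred at \<open>p\<close>.

  Hence \<open>(f, g)\<close> lies in \<open>H_min\<close> iff \<open>f = R (f + g)\<close> and \<open>f + g\<close> is orthogonal to the potentials \<open>G\<^sub>j\<close>
  centred at the points. These are finitely many conditions, so \<open>(f, g)\<close> lies in the adjoint iff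
  \<open>f = R (f + g) + (\<Sum>j. c\<^sub>j * G\<^sub>j)\<close>; then \<open>Gamma0 f = c\<close>, and \<open>Gamma1 f\<close> is the vector of the values
  \<open>R (f + g) (x j)\<close> plus a real symmetric matrix applied to \<open>c\<close>. Green's identity is the symmetry of
  \<open>R\<close>, and the boundary maps are onto because \<open>E1\<close> is, up to a factor, the Gram matrix of the
  independent functions \<open>G\<^sub>j\<close>. The parametrization is then linear algebra.
\<close>

section \<open>The heat kernel and the Yukawa potential\<close>

text \<open>The spectral point -1 is dictated by the functions in the domain of the adjoint:
  \<open>e^(-r) / r\<close> is \<open>4 * pi * G\<close>, and \<open>e^(-r)\<close> is
  \<open>8 * pi\<close> times \<open>R\<close> applied to \<open>G\<close>. Hence \<open>E1\<close>
  collects, up to \<open>8 * pi\<close>, the values of the \<open>R G_j\<close> at the points, and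
  \<open>E0\<close>, up to \<open>4 * pi\<close>, those of the regular parts of the
  \<open>G_j\<close>; its diagonal \<open>-1\<close> is the limit of
  \<open>(e^(-r) - 1) / r\<close>. The definitions involve weak derivatives, representatives and a
  choice operator. The gain of \<open>R\<close> is that it produces functions defined and continuous
  at every point, so that point values and limits become pairings in \<open>L2\<close>.
  Self-adjointness also asks for a dense domain. Points are null sets, so test functions vanishing
  at the points remain dense. For the converse, a self-adjoint extension \<open>A\<close> lies
  between \<open>H_min\<close> and \<open>H_max\<close>; its set of boundary values is the relation
  sought, because \<open>H_min\<close> is the joint kernel of the boundary maps. Their surjectivity
  makes this relation unique and self-adjoint.\<close>

lemma nn_integral_lborel_shift:
  fixes f :: "'a::euclidean_space \<Rightarrow> ennreal"
  assumes [measurable]: "f \<in> borel_measurable borel"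
  shows "(\<integral>\<^sup>+ y. f (c + y) \<partial>lborel) = (\<integral>\<^sup>+ y. f y \<partial>lborel)"
proof -
  have "(\<integral>\<^sup>+ y. f y \<partial>lborel) = (\<integral>\<^sup>+ y. f y \<partial>distr lborel borel ((+) c))"
    by (simp add: lborel_distr_plus)
  also have "\<dots> = (\<integral>\<^sup>+ y. f (c + y) \<partial>lborel)"
    by (rule nn_integral_distr) auto
  finally show ?thesis by simp
qed

text \<open>One-sided limits replace end values, because the antiderivatives used below contain
  \<open>r / (2 * sqrt t)\<close>, whose value at \<open>0\<close> is a junk value. For a
  nonnegative integrand, integrability comes along with the value.\<close>

lemma nn_integral_FTC_0_top:
  fixes f F :: "real \<Rightarrow> real"
  assumes F: "\<And>t. 0 < t \<Longrightarrow> (F has_real_derivative f t) (at t)"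
    and c: "\<And>t. 0 < t \<Longrightarrow> isCont f t" and nn: "\<And>t. 0 < t \<Longrightarrow> 0 \<le> f t"
    and A: "(F \<longlongrightarrow> A) (at_right 0)" and B: "(F \<longlongrightarrow> B) at_top"
  shows "(\<integral>\<^sup>+ t. ennreal (f t) * indicator {0<..} t \<partial>lborel) = ennreal (B - A)"
proof -
  have e: "einterval 0 \<infinity> = {0<..}"
    by (auto simp: einterval_def zero_ereal_def)
  have 1: "set_integrable lborel (einterval 0 \<infinity>) f" "(LBINT x=0..\<infinity>. f x) = B - A"
    by (rule interval_integral_FTC_nonneg[where F=F];
        use assms in \<open>simp add: zero_ereal_def ereal_tendsto_simps\<close>)+
  have "(\<integral>\<^sup>+ t. ennreal (f t) * indicator {0<..} t \<partial>lborel) = (\<integral>\<^sup>+ t. ennreal (indicator {0<..} t * f t) \<partial>lborel)"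
    by (intro nn_integral_cong) (auto split: split_indicator)
  also have "\<dots> = ennreal (LINT t|lborel. indicator {0<..} t * f t)"
    using 1(1) nn by (intro nn_integral_eq_integral)
       (auto simp: set_integrable_def e split: split_indicator)
  also have "(LINT t|lborel. indicator {0<..} t * f t) = B - A"
    using 1(2) by (simp add: interval_lebesgue_integral_def set_lebesgue_integral_def e)
  finally show ?thesis .
qed

section \<open>The error function, up to a factor\<close>

definition gauss_prim :: "real \<Rightarrow> real" where
  "gauss_prim x = (LBINT u=0..x. exp (- u\<^sup>2))"

lemma gauss_prim_deriv: "(gauss_prim has_real_derivative exp (- x\<^sup>2)) (at x)"
proof -
  \<comment> \<open>An interval with the base point \<open>0\<close> and the point \<open>x\<close>
    both in its interior, so that the derivative within it is the full derivative at
    \<open>x\<close>.\<close>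
  let ?a = "- \<bar>x\<bar> - 1" and ?b = "\<bar>x\<bar> + 1"
  have "((\<lambda>u. LBINT y=ereal 0..u. exp (- y\<^sup>2)) has_vector_derivative exp (- x\<^sup>2)) (at x within {?a..?b})"
    by (rule interval_integral_FTC2) (auto intro!: continuous_intros)
  moreover have "at x within {?a..?b} = at x"
    by (rule at_within_interior) auto
  ultimately show ?thesis
    by (simp add: has_real_derivative_iff_has_vector_derivative gauss_prim_def[abs_def] zero_ereal_def)
qed

lemmas gauss_prim_deriv' [derivative_intros] = DERIV_chain2[OF gauss_prim_deriv]

lemma gauss_prim_0 [simp]: "gauss_prim 0 = 0"
  by (simp add: gauss_prim_def zero_ereal_def[symmetric])

lemma gauss_prim_minus: "gauss_prim (- x) = - gauss_prim x"
proof -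
  have "((\<lambda>x. gauss_prim (- x) + gauss_prim x) has_real_derivative 0) (at y)" for y
    by (rule derivative_eq_intros refl | simp)+
  hence "gauss_prim (- x) + gauss_prim x = gauss_prim (- 0) + gauss_prim 0"
    by (intro DERIV_isconst_all[of "\<lambda>x. gauss_prim (- x) + gauss_prim x"]) blast
  thus ?thesis by simp
qed

lemma gauss_prim_at_top: "(gauss_prim \<longlongrightarrow> sqrt pi / 2) at_top"
proof -
  have 1: "set_integrable lborel {0..} (\<lambda>x::real. exp (- x\<^sup>2))"
    and 2: "(LINT x:{0..}|lborel. exp (- x\<^sup>2)) = sqrt pi / 2"
    using gaussian_moment_0
    by (auto simp: set_integrable_def set_lebesgue_integral_def has_bochner_integral_iff)
  have "((\<lambda>b. LINT x:{0..b}|lborel. exp (- x\<^sup>2)) \<longlongrightarrow> (LINT x:{0..}|lborel. exp (- x\<^sup>2::real))) at_top"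
    by (rule tendsto_set_lebesgue_integral_at_top[OF _ 1]) auto
  moreover have "eventually (\<lambda>b. (LINT x:{0..b}|lborel. exp (- x\<^sup>2)) = gauss_prim b) at_top"
    using eventually_ge_at_top[of 0]
    by eventually_elim (simp add: gauss_prim_def interval_integral_Icc[of 0, simplified] zero_ereal_def interval_integral_Icc)
  ultimately show ?thesis unfolding 2 by (rule Lim_transform_eventually)
qed

lemma gauss_prim_at_bot: "(gauss_prim \<longlongrightarrow> - (sqrt pi / 2)) at_bot"
proof -
  have "((\<lambda>x. - gauss_prim (- x)) \<longlongrightarrow> - (sqrt pi / 2)) at_bot"
    by (intro tendsto_minus filterlim_compose[OF gauss_prim_at_top] filterlim_uminus_at_top_at_bot)
  thus ?thesis by (simp add: gauss_prim_minus)
qed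

text \<open>The kernel of \<open>exp (t * laplacian)\<close> in dimension three: a centred Gaussian
  with variance \<open>2 * t\<close> in each coordinate.\<close>

definition heat :: "real \<Rightarrow> real^3 \<Rightarrow> real" where
  "heat t y = exp (- (norm y)\<^sup>2 / (4 * t)) / (sqrt (4 * pi * t)) ^ 3"

text \<open>The value at the origin is the junk value \<open>0\<close>.\<close>

definition yukawa :: "real^3 \<Rightarrow> real" where
  "yukawa y = exp (- norm y) / (4 * pi * norm y)"

lemma heat_measurable [measurable]:
  assumes "f \<in> borel_measurable M" "g \<in> borel_measurable M"
  shows "(\<lambda>z. heat (f z) (g z)) \<in> borel_measurable M"
  unfolding heat_def using assms by measurable

lemma yukawa_measurable [measurable]: "yukawa \<in> borel_measurable borel"
  unfolding yukawa_def[abs_def] by measurable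

lemma heat_nonneg [simp]: "0 \<le> t \<Longrightarrow> 0 \<le> heat t y"
  by (simp add: heat_def)

lemma yukawa_nonneg [simp]: "0 \<le> yukawa y"
  by (simp add: yukawa_def)

lemma heat_minus [simp]: "heat t (- y) = heat t y" by (simp add: heat_def)
lemma yukawa_minus [simp]: "yukawa (- y) = yukawa y" by (simp add: yukawa_def)

lemma yukawa_commute: "yukawa (y - z) = yukawa (z - y)"
  by (metis minus_diff_eq yukawa_minus)

lemma heat_eq_prod_normal_density:
  assumes "0 < t"
  shows "heat t y = (\<Prod>b\<in>Basis. normal_density 0 (sqrt (2 * t)) (y \<bullet> b))"
proof -
  have "(\<Sum>b\<in>Basis. (y \<bullet> b)\<^sup>2) = (norm y)\<^sup>2"
    unfolding power2_norm_eq_inner euclidean_inner[of y y] by (simp add: power2_eq_square)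
  hence "(\<Prod>b\<in>(Basis::(real^3) set). exp (- (y \<bullet> b)\<^sup>2 / (4 * t))) = exp (- (norm y)\<^sup>2 / (4 * t))"
    by (simp add: exp_sum[symmetric] sum_divide_distrib[symmetric] sum_negf)
  thus ?thesis using assms
    by (simp add: normal_density_def heat_def prod.distrib prod_dividef power_divide mult.assoc)
qed

lemma nn_integral_heat:
  assumes "0 < t" shows "(\<integral>\<^sup>+ y. ennreal (heat t (y - c)) \<partial>lborel) = 1"
proof -
  have "(\<integral>\<^sup>+ y. ennreal (heat t (y - c)) \<partial>lborel) = (\<integral>\<^sup>+ y. ennreal (heat t y) \<partial>lborel)"
    using nn_integral_lborel_shift[of "\<lambda>y. ennreal (heat t y)" "- c"] by simp
  also have "\<dots> = (\<integral>\<^sup>+ y. (\<Prod>b\<in>(Basis::(real^3) set). ennreal (normal_density 0 (sqrt (2 * t)) (y \<bullet> b))) \<partial>lborel)"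
    using assms by (simp add: heat_eq_prod_normal_density prod_ennreal)
  also have "\<dots> = (\<Prod>b\<in>(Basis::(real^3) set). (\<integral>\<^sup>+x. ennreal (normal_density 0 (sqrt (2 * t)) x) \<partial>lborel))"
    by (rule nn_integral_lborel_prod) auto
  also have "(\<integral>\<^sup>+x. ennreal (normal_density 0 (sqrt (2 * t)) x) \<partial>lborel) = 1"
    using assms by (subst nn_integral_eq_integral) auto
  finally show ?thesis by simp
qed

text \<open>Completing the square in \<open>y\<close>: the product of two Gaussians is a Gaussian in
  \<open>y\<close> times a factor free of \<open>y\<close>. Integrating out \<open>y\<close> leaves
  that factor, which is the semigroup law \<open>nn_integral_heat_heat\<close>.\<close>

lemma heat_mult_heat:
  assumes "0 < s" "0 < t"
  shows "heat s y * heat t (y - p) = heat (s + t) p * heat (s * t / (s + t)) (y - (s / (s + t)) *\<^sub>R p)"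
proof -
  have A: "(norm y)\<^sup>2 / (4 * s) + (norm (y - p))\<^sup>2 / (4 * t) =
    (norm p)\<^sup>2 / (4 * (s + t)) + (norm (y - (s / (s + t)) *\<^sub>R p))\<^sup>2 / (4 * (s * t / (s + t)))"
    using assms
    by (simp add: power2_norm_eq_inner inner_diff_left inner_diff_right inner_commute[of p y] divide_simps)
       (simp add: algebra_simps)
  have "sqrt (4 * pi * s) * sqrt (4 * pi * t) = sqrt (4 * pi * (s + t)) * sqrt (4 * pi * (s * t / (s + t)))"
    unfolding real_sqrt_mult[symmetric] using assms by (simp add: field_simps)
  hence B: "sqrt (4 * pi * s) ^ 3 * sqrt (4 * pi * t) ^ 3 = sqrt (4 * pi * (s + t)) ^ 3 * sqrt (4 * pi * (s * t / (s + t))) ^ 3"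
    by (metis power_mult_distrib)
  show ?thesis
    unfolding heat_def times_divide_times_eq B exp_add[symmetric]
    using A by simp
qed

lemma nn_integral_heat_heat:
  assumes "0 < s" "0 < t"
  shows "(\<integral>\<^sup>+ y. ennreal (heat s y * heat t (y - p)) \<partial>lborel) = ennreal (heat (s + t) p)"
  using assms by (simp add: heat_mult_heat ennreal_mult' nn_integral_cmult nn_integral_heat)

lemma exp_minus_heat:
  assumes "0 < t"
  shows "exp (- t) * heat t p = exp (- t - (norm p)\<^sup>2 / (4 * t)) / (8 * (pi * sqrt pi) * (t * sqrt t))"
proof -
  have "sqrt (4 * pi * t) ^ 3 = 8 * (pi * sqrt pi) * (t * sqrt t)"
    using assms by (simp add: real_sqrt_mult power3_eq_cube algebra_simps)
  thus ?thesis by (simp add: heat_def exp_add[symmetric])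
qed

text \<open>With \<open>a = r / (2 * sqrt t)\<close> and \<open>b = sqrt t\<close> we have \<open>2 * a * b = r\<close>, so the functions
  \<open>exp (- r) * gauss_prim (a - b)\<close> and \<open>exp r * gauss_prim (a + b)\<close> have derivatives
  with the same exponential factor \<open>exp (- t - r\<^sup>2 / (4 * t))\<close>; their sum and difference are
  antiderivatives for the two time integrals of the heat kernel.\<close>

lemma exp_gauss_shift:
  assumes "0 < t"
  shows "exp (- r) * exp (- (r / (2 * sqrt t) - sqrt t)\<^sup>2) = exp (- t - r\<^sup>2 / (4 * t))"
    and "exp r * exp (- (r / (2 * sqrt t) + sqrt t)\<^sup>2) = exp (- t - r\<^sup>2 / (4 * t))"
proof -
  define s where "s = sqrt t"
  have s: "0 < s" "t = s\<^sup>2" using assms by (auto simp: s_def)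
  have "- r + - (r / (2 * s) - s)\<^sup>2 = - t - r\<^sup>2 / (4 * t)" "r + - (r / (2 * s) + s)\<^sup>2 = - t - r\<^sup>2 / (4 * t)"
    unfolding s(2) using s(1) by (simp_all add: field_simps power2_eq_square)
  thus "exp (- r) * exp (- (r / (2 * sqrt t) - sqrt t)\<^sup>2) = exp (- t - r\<^sup>2 / (4 * t))"
    "exp r * exp (- (r / (2 * sqrt t) + sqrt t)\<^sup>2) = exp (- t - r\<^sup>2 / (4 * t))"
    unfolding exp_add[symmetric] s_def by simp_all
qed

lemma gauss_prim_shift_deriv:
  assumes "0 < t"
  shows "((\<lambda>t. exp (- r) * gauss_prim (r / (2 * sqrt t) - sqrt t)) has_real_derivative
     exp (- t - r\<^sup>2 / (4 * t)) * (- r / (4 * (t * sqrt t)) - 1 / (2 * sqrt t))) (at t)" (is ?A)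
    and "((\<lambda>t. exp r * gauss_prim (r / (2 * sqrt t) + sqrt t)) has_real_derivative
     exp (- t - r\<^sup>2 / (4 * t)) * (- r / (4 * (t * sqrt t)) + 1 / (2 * sqrt t))) (at t)" (is ?B)
proof -
  have 1: "((\<lambda>t. r / (2 * sqrt t)) has_real_derivative - r / (4 * (t * sqrt t))) (at t)"
    using assms by (auto intro!: derivative_eq_intros simp: divide_simps)
  have 2: "(sqrt has_real_derivative 1 / (2 * sqrt t)) (at t)"
    using assms by (auto intro!: derivative_eq_intros simp: divide_simps)
  show ?A
    using DERIV_cmult[OF DERIV_chain2[OF gauss_prim_deriv DERIV_diff[OF 1 2]], of "exp (- r)"]
    by (simp only: mult.assoc[symmetric] exp_gauss_shift(1)[OF assms])
  show ?B
    using DERIV_cmult[OF DERIV_chain2[OF gauss_prim_deriv DERIV_add[OF 1 2]], of "exp r"]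
    by (simp only: mult.assoc[symmetric] exp_gauss_shift(2)[OF assms])
qed

lemma gauss_prim_shift_lim:
  shows "0 < r \<Longrightarrow> ((\<lambda>t. gauss_prim (r / (2 * sqrt t) - sqrt t)) \<longlongrightarrow> sqrt pi / 2) (at_right 0)"
    and "0 < r \<Longrightarrow> ((\<lambda>t. gauss_prim (r / (2 * sqrt t) + sqrt t)) \<longlongrightarrow> sqrt pi / 2) (at_right 0)"
    and "((\<lambda>t. gauss_prim (r / (2 * sqrt t) - sqrt t)) \<longlongrightarrow> - (sqrt pi / 2)) at_top"
    and "((\<lambda>t. gauss_prim (r / (2 * sqrt t) + sqrt t)) \<longlongrightarrow> sqrt pi / 2) at_top"
proof -
  show "((\<lambda>t. gauss_prim (r / (2 * sqrt t) - sqrt t)) \<longlongrightarrow> sqrt pi / 2) (at_right 0)" if "0 < r"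
    by (rule filterlim_compose[OF gauss_prim_at_top]) (use that in real_asymp)
  show "((\<lambda>t. gauss_prim (r / (2 * sqrt t) + sqrt t)) \<longlongrightarrow> sqrt pi / 2) (at_right 0)" if "0 < r"
    by (rule filterlim_compose[OF gauss_prim_at_top]) (use that in real_asymp)
  show "((\<lambda>t. gauss_prim (r / (2 * sqrt t) - sqrt t)) \<longlongrightarrow> - (sqrt pi / 2)) at_top"
    by (rule filterlim_compose[OF gauss_prim_at_bot]) real_asymp
  show "((\<lambda>t. gauss_prim (r / (2 * sqrt t) + sqrt t)) \<longlongrightarrow> sqrt pi / 2) at_top"
    by (rule filterlim_compose[OF gauss_prim_at_top]) real_asymp
qed

text \<open>At \<open>p = 0\<close> the integrand is of order \<open>1 / (t * sqrt t)\<close> near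
  \<open>0\<close> and the integral is infinite, whereas \<open>yukawa 0 = 0\<close>; hence the
  hypothesis.\<close>

lemma yukawa_eq_heat_integral:
  assumes "p \<noteq> 0"
  shows "(\<integral>\<^sup>+ t. ennreal (exp (- t) * heat t p) * indicator {0<..} t \<partial>lborel) = ennreal (yukawa p)"
proof -
  define r where "r = norm p"
  have r: "0 < r" using assms by (simp add: r_def)
  \<comment> \<open>Adding the two functions of \<open>gauss_prim_shift_deriv\<close> cancels the
    terms \<open>1 / (2 * sqrt t)\<close>; what survives is proportional to
    \<open>1 / (t * sqrt t)\<close>, the power in \<open>exp_minus_heat\<close>.\<close>
  define F where "F t = - (1 / (4 * (pi * sqrt pi) * r)) * (exp (- r) * gauss_prim (r / (2 * sqrt t) - sqrt t)
     + exp r * gauss_prim (r / (2 * sqrt t) + sqrt t))" for t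
  have "(\<integral>\<^sup>+ t. ennreal (exp (- t) * heat t p) * indicator {0<..} t \<partial>lborel) =
    ennreal (- (1 / (4 * (pi * sqrt pi) * r)) * (exp (- r) * - (sqrt pi / 2) + exp r * (sqrt pi / 2)) -
      - (1 / (4 * (pi * sqrt pi) * r)) * (exp (- r) * (sqrt pi / 2) + exp r * (sqrt pi / 2)))"
  proof (rule nn_integral_FTC_0_top[where F=F])
    show "(F has_real_derivative exp (- t) * heat t p) (at t)" if "0 < t" for t
      unfolding F_def exp_minus_heat[OF that] r_def[symmetric]
      by (rule DERIV_cong[OF DERIV_cmult[OF DERIV_add[OF gauss_prim_shift_deriv[OF that]]]])
         (use that r in \<open>simp add: field_simps\<close>)
    show "isCont (\<lambda>t. exp (- t) * heat t p) t" if "0 < t" for t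
      unfolding heat_def using that by (auto intro!: continuous_intros)
    show "(F \<longlongrightarrow> - (1 / (4 * (pi * sqrt pi) * r)) * (exp (- r) * (sqrt pi / 2) + exp r * (sqrt pi / 2))) (at_right 0)"
      "(F \<longlongrightarrow> - (1 / (4 * (pi * sqrt pi) * r)) * (exp (- r) * - (sqrt pi / 2) + exp r * (sqrt pi / 2))) at_top"
      unfolding F_def using r by (intro tendsto_intros gauss_prim_shift_lim; simp)+
  qed simp
  also have "\<dots> = ennreal (yukawa p)"
    unfolding yukawa_def r_def[symmetric] using r by (intro arg_cong[of _ _ ennreal]) (simp add: field_simps)
  finally show ?thesis .
qed

lemma heat_integral_time_weighted:
  "(\<integral>\<^sup>+ t. ennreal (t * (exp (- t) * heat t p)) * indicator {0<..} t \<partial>lborel) = ennreal (exp (- norm p) / (8 * pi))"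
proof -
  define r where "r = norm p"
  have r: "0 \<le> r" by (simp add: r_def)
  define K where "K = - (1 / (8 * (pi * sqrt pi)))"
  define F where "F t = K * (exp (- r) * gauss_prim (r / (2 * sqrt t) - sqrt t)
     - exp r * gauss_prim (r / (2 * sqrt t) + sqrt t))" for t
  have "(\<integral>\<^sup>+ t. ennreal (t * (exp (- t) * heat t p)) * indicator {0<..} t \<partial>lborel) =
    ennreal (K * (exp (- r) * - (sqrt pi / 2) - exp r * (sqrt pi / 2)) -
      K * (exp (- r) * (sqrt pi / 2) - exp r * (sqrt pi / 2)))"
  proof (rule nn_integral_FTC_0_top[where F=F])
    show "(F has_real_derivative t * (exp (- t) * heat t p)) (at t)" if "0 < t" for t
      unfolding F_def exp_minus_heat[OF that] r_def[symmetric]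
      by (rule DERIV_cong[OF DERIV_cmult[OF DERIV_diff[OF gauss_prim_shift_deriv[OF that]]]])
         (use that in \<open>simp add: field_simps K_def\<close>)
    show "isCont (\<lambda>t. t * (exp (- t) * heat t p)) t" if "0 < t" for t
      unfolding heat_def using that by (auto intro!: continuous_intros)
    show "(F \<longlongrightarrow> K * (exp (- r) * - (sqrt pi / 2) - exp r * (sqrt pi / 2))) at_top"
      unfolding F_def by (intro tendsto_intros gauss_prim_shift_lim)
    show "(F \<longlongrightarrow> K * (exp (- r) * (sqrt pi / 2) - exp r * (sqrt pi / 2))) (at_right 0)"
    \<comment> \<open>For \<open>r = 0\<close> the arguments of \<open>gauss_prim\<close> tend to
      \<open>0\<close> instead of infinity; the asserted limit is then \<open>0\<close>, because its
      two terms cancel.\<close>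
    proof (cases "r = 0")
      case True
      have "((\<lambda>t. K * (exp (- 0) * gauss_prim (- sqrt t) - exp 0 * gauss_prim (sqrt t))) \<longlongrightarrow>
          K * (exp (- 0) * gauss_prim (- sqrt 0) - exp 0 * gauss_prim (sqrt 0))) (at_right 0)"
        by (intro tendsto_intros isCont_tendsto_compose[OF DERIV_isCont[OF gauss_prim_deriv]])
      thus ?thesis unfolding F_def[abs_def] True by simp
    next
      case False
      with r show ?thesis unfolding F_def by (intro tendsto_intros gauss_prim_shift_lim) auto
    qed
  qed simp
  also have "\<dots> = ennreal (exp (- norm p) / (8 * pi))"
    unfolding r_def[symmetric] K_def by (intro arg_cong[of _ _ ennreal]) (simp add: field_simps)
  finally show ?thesis .
qed

section \<open>Integrals against the Yukawa potential\<close>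

lemma nn_integral_yukawa_eq:
  assumes [measurable]: "f \<in> borel_measurable borel"
  shows "(\<integral>\<^sup>+ y. ennreal (yukawa y) * f y \<partial>lborel) =
    (\<integral>\<^sup>+ t. (\<integral>\<^sup>+ y. ennreal (exp (- t) * heat t y) * f y \<partial>lborel) * indicator {0<..} t \<partial>lborel)"
proof -
  have "(\<integral>\<^sup>+ y. ennreal (yukawa y) * f y \<partial>lborel) =
    (\<integral>\<^sup>+ y. (\<integral>\<^sup>+ t. ennreal (exp (- t) * heat t y) * indicator {0<..} t * f y \<partial>lborel) \<partial>lborel)"
    \<comment> \<open>The origin is discarded as a null set, since the time integral is infinite
      there.\<close>
    by (intro nn_integral_cong_AE, use AE_lborel_singleton[of 0] in eventually_elim)
       (simp add: nn_integral_multc yukawa_eq_heat_integral)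
  also have "\<dots> = (\<integral>\<^sup>+ t. (\<integral>\<^sup>+ y. ennreal (exp (- t) * heat t y) * indicator {0<..} t * f y \<partial>lborel) \<partial>lborel)"
    by (rule lborel_pair.Fubini') measurable
  also have "\<dots> = (\<integral>\<^sup>+ t. (\<integral>\<^sup>+ y. ennreal (exp (- t) * heat t y) * f y \<partial>lborel) * indicator {0<..} t \<partial>lborel)"
    by (intro nn_integral_cong) (auto split: split_indicator)
  finally show ?thesis .
qed

lemma nn_integral_exp_minus: "(\<integral>\<^sup>+ t. ennreal (exp (- t)) * indicator {0<..} t \<partial>lborel) = 1"
proof -
  have "(\<integral>\<^sup>+ t. ennreal (exp (- t)) * indicator {0<..} t \<partial>lborel) = ennreal (0 - (- exp (- 0)))"
  proof (rule nn_integral_FTC_0_top[where F="\<lambda>t. - exp (- t)"])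
    show "((\<lambda>t::real. - exp (- t)) \<longlongrightarrow> - exp (- 0)) (at_right 0)"
      by (intro tendsto_intros)
    show "((\<lambda>t::real. - exp (- t)) \<longlongrightarrow> 0) at_top"
      by real_asymp
  qed (auto intro!: derivative_eq_intros continuous_intros)
  thus ?thesis by simp
qed

lemma nn_integral_yukawa: "(\<integral>\<^sup>+ y. ennreal (yukawa y) \<partial>lborel) = 1"
proof -
  have "(\<integral>\<^sup>+ y. ennreal (exp (- t) * heat t y) \<partial>lborel) = ennreal (exp (- t))" if "0 < t" for t
    using nn_integral_heat[OF that, of 0] that by (simp add: ennreal_mult nn_integral_cmult)
  hence "(\<integral>\<^sup>+ y. ennreal (yukawa y) \<partial>lborel) = (\<integral>\<^sup>+ t. ennreal (exp (- t)) * indicator {0<..} t \<partial>lborel)"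
    using nn_integral_yukawa_eq[of "\<lambda>_. 1"] by (auto intro!: nn_integral_cong split: split_indicator)
  thus ?thesis by (simp add: nn_integral_exp_minus)
qed

text \<open>Both factors are exponential mixtures of heat kernels. The semigroup law merges them
  into \<open>heat (s + t)\<close>, and for fixed \<open>\<tau> = s + t\<close> the time
  \<open>s\<close> ranges over an interval of length \<open>\<tau>\<close>; this length is the
  weight in \<open>heat_integral_time_weighted\<close>.\<close>

lemma nn_integral_yukawa_yukawa:
  "(\<integral>\<^sup>+ y. ennreal (yukawa (y - p) * yukawa (y - q)) \<partial>lborel) = ennreal (exp (- norm (p - q)) / (8 * pi))"
proof -
  define d where "d = q - p"
  have "(\<integral>\<^sup>+ y. ennreal (yukawa (y - p) * yukawa (y - q)) \<partial>lborel) =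
    (\<integral>\<^sup>+ y. ennreal (yukawa y * yukawa (y - d)) \<partial>lborel)"
    using nn_integral_lborel_shift[of "\<lambda>y. ennreal (yukawa y * yukawa (y - d))" "- p"]
    by (simp add: d_def)
  also have "\<dots> = (\<integral>\<^sup>+ y. ennreal (yukawa y) * ennreal (yukawa (y - d)) \<partial>lborel)"
    by (simp add: ennreal_mult)
  also have "\<dots> = (\<integral>\<^sup>+ s. (\<integral>\<^sup>+ y. ennreal (exp (- s) * heat s y) * ennreal (yukawa (y - d)) \<partial>lborel) * indicator {0<..} s \<partial>lborel)"
    by (rule nn_integral_yukawa_eq) measurable
  also have "\<dots> = (\<integral>\<^sup>+ s. (\<integral>\<^sup>+ t. ennreal (exp (- (s + t)) * heat (s + t) d) * indicator {0<..} t \<partial>lborel) * indicator {0<..} s \<partial>lborel)"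
  proof (intro nn_integral_cong)
    fix s :: real
    show "(\<integral>\<^sup>+ y. ennreal (exp (- s) * heat s y) * ennreal (yukawa (y - d)) \<partial>lborel) * indicator {0<..} s =
       (\<integral>\<^sup>+ t. ennreal (exp (- (s + t)) * heat (s + t) d) * indicator {0<..} t \<partial>lborel) * indicator {0<..} s"
    proof (cases "0 < s")
      case True
      have "(\<integral>\<^sup>+ y. ennreal (exp (- s) * heat s y) * ennreal (yukawa (y - d)) \<partial>lborel) =
        (\<integral>\<^sup>+ y. ennreal (yukawa y) * ennreal (exp (- s) * heat s (d + y)) \<partial>lborel)"
        using nn_integral_lborel_shift[of "\<lambda>y. ennreal (exp (- s) * heat s y) * ennreal (yukawa (y - d))" d]
        by (simp add: mult.commute)
      also have "\<dots> = (\<integral>\<^sup>+ t. (\<integral>\<^sup>+ y. ennreal (exp (- t) * heat t y) * ennreal (exp (- s) * heat s (d + y)) \<partial>lborel) * indicator {0<..} t \<partial>lborel)"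
        by (rule nn_integral_yukawa_eq) measurable
      also have "\<dots> = (\<integral>\<^sup>+ t. ennreal (exp (- (s + t)) * heat (s + t) d) * indicator {0<..} t \<partial>lborel)"
      proof (intro nn_integral_cong)
        fix t :: real
        show "(\<integral>\<^sup>+ y. ennreal (exp (- t) * heat t y) * ennreal (exp (- s) * heat s (d + y)) \<partial>lborel) * indicator {0<..} t =
          ennreal (exp (- (s + t)) * heat (s + t) d) * indicator {0<..} t"
        proof (cases "0 < t")
          case t: True
          have "ennreal (exp (- t) * heat t y) * ennreal (exp (- s) * heat s (d + y)) =
             ennreal (exp (- (s + t))) * ennreal (heat t y * heat s (y - (- d)))" for y
          proof -
            have e: "exp (- (s + t)) = exp (- t) * exp (- s)" by (simp add: exp_add[symmetric])
            have "exp (- t) * heat t y * (exp (- s) * heat s (d + y)) =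
              exp (- (s + t)) * (heat t y * heat s (y - (- d)))"
              unfolding e by (simp add: add.commute)
            thus ?thesis using True t by (simp only: ennreal_mult[symmetric] heat_nonneg exp_ge_zero mult_nonneg_nonneg less_imp_le)
          qed
          thus ?thesis
            using nn_integral_heat_heat[OF t True, of "- d"] True t
            by (simp add: nn_integral_cmult ennreal_mult add.commute)
        qed simp
      qed
      finally show ?thesis by simp
    qed simp
  qed
  also have "\<dots> = (\<integral>\<^sup>+ s. (\<integral>\<^sup>+ \<tau>. ennreal (exp (- \<tau>) * heat \<tau> d) * indicator {s<..} \<tau> * indicator {0<..} s \<partial>lborel) \<partial>lborel)"
  proof (intro nn_integral_cong)
    fix s :: real
    show "(\<integral>\<^sup>+ t. ennreal (exp (- (s + t)) * heat (s + t) d) * indicator {0<..} t \<partial>lborel) * indicator {0<..} s =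
      (\<integral>\<^sup>+ \<tau>. ennreal (exp (- \<tau>) * heat \<tau> d) * indicator {s<..} \<tau> * indicator {0<..} s \<partial>lborel)"
      using nn_integral_lborel_shift[of "\<lambda>\<tau>. ennreal (exp (- \<tau>) * heat \<tau> d) * indicator {s<..} \<tau>" s]
      by (simp add: nn_integral_multc indicator_def)
  qed
  also have "\<dots> = (\<integral>\<^sup>+ \<tau>. (\<integral>\<^sup>+ s. ennreal (exp (- \<tau>) * heat \<tau> d) * indicator {s<..} \<tau> * indicator {0<..} s \<partial>lborel) \<partial>lborel)"
  proof (rule lborel_pair.Fubini')
    show "(\<lambda>(\<tau>, s). ennreal (exp (- \<tau>) * heat \<tau> d) * indicator {s<..} \<tau> * indicator {0<..} s) \<in> borel_measurable (lborel \<Otimes>\<^sub>M lborel)"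
      unfolding case_prod_beta indicator_def greaterThan_iff by measurable
  qed
  also have "\<dots> = (\<integral>\<^sup>+ \<tau>. ennreal (\<tau> * (exp (- \<tau>) * heat \<tau> d)) * indicator {0<..} \<tau> \<partial>lborel)"
  proof (intro nn_integral_cong)
    fix \<tau> :: real
    have "(\<integral>\<^sup>+ s. ennreal (exp (- \<tau>) * heat \<tau> d) * indicator {s<..} \<tau> * indicator {0<..} s \<partial>lborel) =
      (\<integral>\<^sup>+ s. ennreal (exp (- \<tau>) * heat \<tau> d) * indicator {0<..<\<tau>} s \<partial>lborel)"
      by (intro nn_integral_cong) (auto simp: indicator_def)
    also have "\<dots> = ennreal (\<tau> * (exp (- \<tau>) * heat \<tau> d)) * indicator {0<..} \<tau>"
    proof (cases "0 < \<tau>")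
      case True
      thus ?thesis using ennreal_mult[of "exp (- \<tau>) * heat \<tau> d" \<tau>]
        by (simp add: nn_integral_cmult_indicator mult.commute[of \<tau>])
    qed simp
    finally show "(\<integral>\<^sup>+ s. ennreal (exp (- \<tau>) * heat \<tau> d) * indicator {s<..} \<tau> * indicator {0<..} s \<partial>lborel) =
      ennreal (\<tau> * (exp (- \<tau>) * heat \<tau> d)) * indicator {0<..} \<tau>" .
  qed
  also have "\<dots> = ennreal (exp (- norm (p - q)) / (8 * pi))"
    unfolding heat_integral_time_weighted d_def by (simp only: norm_minus_commute)
  finally show ?thesis .
qed

section \<open>Square-integrable functions\<close>

lemma integral_lborel_shift:
  fixes f :: "'a::euclidean_space \<Rightarrow> 'b::{banach, second_countable_topology}"
  assumes "f \<in> borel_measurable borel"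
  shows "(LINT y|lborel. f (y + c)) = (LINT y|lborel. f y)"
proof -
  have "(LINT y|lborel. f y) = (LINT y|distr lborel borel ((+) c). f y)"
    by (simp add: lborel_distr_plus)
  also have "\<dots> = (LINT y|lborel. f (c + y))"
    using assms by (intro integral_distr) auto
  finally show ?thesis by (simp add: add.commute)
qed

lemma integral_lborel_reflect:
  fixes f :: "'a::euclidean_space \<Rightarrow> 'b::{banach, second_countable_topology}"
  assumes "f \<in> borel_measurable borel"
  shows "(LINT y|lborel. f (- y)) = (LINT y|lborel. f y)"
proof -
  have "(LINT y|lborel. f y) = (LINT y|density (distr lborel borel (\<lambda>x. 0 + (-1) *\<^sub>R x)) (\<lambda>_. \<bar>-1::real\<bar> ^ DIM('a)). f y)"
    by (subst lborel_affine[of "-1" 0]) auto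
  also have "\<dots> = (LINT y|distr lborel borel (\<lambda>x. - x). f y)"
    by (simp add: density_1)
  also have "\<dots> = (LINT y|lborel. f (- y))"
    using assms by (intro integral_distr) auto
  finally show ?thesis by simp
qed

text \<open>Squared norms avoid roots. The triangle inequality appears as
  \<open>L2_sq_add_le\<close>, whose factors \<open>2\<close> are harmless because only limits and
  boundedness are at stake.\<close>

definition L2_sq :: "fn3 \<Rightarrow> real" where
  "L2_sq f = (LINT y|lborel. (norm (f y))\<^sup>2)"

lemma L2_sq_nonneg [simp]: "0 \<le> L2_sq f"
  by (simp add: L2_sq_def)

lemma L2_measurable [measurable_dest]: "f \<in> L2 \<Longrightarrow> f \<in> borel_measurable borel"
  by (simp add: L2_def)

lemma L2_integrable: "f \<in> L2 \<Longrightarrow> integrable lborel (\<lambda>y. (norm (f y))\<^sup>2)"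
  by (simp add: L2_def)

lemma nn_integral_L2: "f \<in> L2 \<Longrightarrow> (\<integral>\<^sup>+ y. ennreal ((norm (f y))\<^sup>2) \<partial>lborel) = ennreal (L2_sq f)"
  unfolding L2_sq_def by (rule nn_integral_eq_integral) (auto simp: L2_def)

lemma L2_bound:
  assumes [measurable]: "f \<in> borel_measurable borel"
    and le: "(\<integral>\<^sup>+ y. ennreal ((norm (f y))\<^sup>2) \<partial>lborel) \<le> ennreal C" and C: "0 \<le> C"
  shows "f \<in> L2" "L2_sq f \<le> C"
proof -
  have "integrable lborel (\<lambda>y. (norm (f y))\<^sup>2)"
    by (rule integrableI_nonneg) (use le in \<open>auto simp: less_top[symmetric] top_unique\<close>)
  thus f: "f \<in> L2" by (simp add: L2_def)
  show "L2_sq f \<le> C" using le C nn_integral_L2[OF f] by simp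
qed

lemma L2_dominated:
  assumes "g \<in> borel_measurable borel" "f \<in> L2" "AE y in lborel. norm (g y) \<le> norm (f y)"
  shows "g \<in> L2"
proof -
  have "integrable lborel (\<lambda>y. (norm (g y))\<^sup>2)"
    by (rule Bochner_Integration.integrable_bound[OF L2_integrable[OF assms(2)]])
       (use assms(1,3) in \<open>auto elim!: eventually_mono simp: power_mono\<close>)
  thus ?thesis using assms(1) by (simp add: L2_def)
qed

lemma norm_add_sq_le: "(norm (a + b))\<^sup>2 \<le> 2 * (norm a)\<^sup>2 + 2 * (norm (b::'a::real_normed_vector))\<^sup>2"
proof -
  have "(norm (a + b))\<^sup>2 \<le> (norm a + norm b)\<^sup>2"
    by (simp add: norm_triangle_ineq power_mono)
  also have "\<dots> \<le> 2 * (norm a)\<^sup>2 + 2 * (norm b)\<^sup>2"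
    using sum_squares_bound[of "norm a" "norm b"] by (simp add: power2_sum)
  finally show ?thesis .
qed

lemma L2_add [intro]: assumes "f \<in> L2" "g \<in> L2" shows "(\<lambda>y. f y + g y) \<in> L2"
proof -
  have [measurable]: "f \<in> borel_measurable borel" "g \<in> borel_measurable borel"
    using assms by (auto intro: L2_measurable)
  have "integrable lborel (\<lambda>y. (norm (f y + g y))\<^sup>2)"
    by (rule Bochner_Integration.integrable_bound[of _ "\<lambda>y. 2 * (norm (f y))\<^sup>2 + 2 * (norm (g y))\<^sup>2"])
       (use assms in \<open>auto simp: L2_def norm_add_sq_le\<close>)
  thus ?thesis by (simp add: L2_def)
qed

lemma L2_sq_add_le: assumes "f \<in> L2" "g \<in> L2"
  shows "L2_sq (\<lambda>y. f y + g y) \<le> 2 * L2_sq f + 2 * L2_sq g"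
proof -
  have "L2_sq (\<lambda>y. f y + g y) \<le> (LINT y|lborel. 2 * (norm (f y))\<^sup>2 + 2 * (norm (g y))\<^sup>2)"
    unfolding L2_sq_def using assms
    by (intro integral_mono L2_integrable L2_add) (auto simp: L2_def norm_add_sq_le)
  also have "\<dots> = 2 * L2_sq f + 2 * L2_sq g"
    unfolding L2_sq_def using assms by (simp add: L2_integrable)
  finally show ?thesis .
qed

lemma L2_zero [simp, intro]: "(\<lambda>_. 0) \<in> L2"
  by (simp add: L2_def)

lemma L2_sq_zero [simp]: "L2_sq (\<lambda>_. 0) = 0"
  by (simp add: L2_sq_def)

lemma L2_scale [intro]: assumes "f \<in> L2" shows "(\<lambda>y. c * f y) \<in> L2"
  using assms by (auto simp: L2_def norm_mult power_mult_distrib)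

lemma L2_sq_scale: "L2_sq (\<lambda>y. c * f y) = (norm c)\<^sup>2 * L2_sq f"
  by (simp add: L2_sq_def norm_mult power_mult_distrib)

lemma L2_uminus [intro]: "f \<in> L2 \<Longrightarrow> (\<lambda>y. - f y) \<in> L2"
  using L2_scale[of f "-1"] by simp

lemma L2_diff [intro]: "f \<in> L2 \<Longrightarrow> g \<in> L2 \<Longrightarrow> (\<lambda>y. f y - g y) \<in> L2"
  using L2_add[OF _ L2_uminus, of f g] by simp

lemma L2_sq_uminus [simp]: "L2_sq (\<lambda>y. - f y) = L2_sq f"
  by (simp add: L2_sq_def)

lemma L2_sq_minus_commute: "L2_sq (\<lambda>y. f y - g y) = L2_sq (\<lambda>y. g y - f y)"
  by (simp add: L2_sq_def norm_minus_commute)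

lemma L2_sq_diff_le: assumes "f \<in> L2" "g \<in> L2"
  shows "L2_sq (\<lambda>y. f y - g y) \<le> 2 * L2_sq f + 2 * L2_sq g"
  using L2_sq_add_le[OF assms(1) L2_uminus[OF assms(2)]] by simp

lemma L2_sum [intro]: "(\<And>i. i \<in> I \<Longrightarrow> f i \<in> L2) \<Longrightarrow> (\<lambda>y. \<Sum>i\<in>I. f i y) \<in> L2"
  by (induction I rule: infinite_finite_induct) auto

lemma measurable_cnj [measurable]: "f \<in> borel_measurable M \<Longrightarrow> (\<lambda>y. cnj (f y)) \<in> borel_measurable M"
  by (rule borel_measurable_continuous_on[OF continuous_on_cnj[OF continuous_on_id]])

lemma L2_cnj [intro]: "f \<in> L2 \<Longrightarrow> (\<lambda>y. cnj (f y)) \<in> L2"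
  by (auto simp: L2_def)

lemma L2_shift: assumes "f \<in> L2" shows "(\<lambda>y. f (y + z)) \<in> L2" "L2_sq (\<lambda>y. f (y + z)) = L2_sq f"
proof -
  have [measurable]: "f \<in> borel_measurable borel" using assms by (rule L2_measurable)
  have "(\<integral>\<^sup>+ y. ennreal ((norm (f (y + z)))\<^sup>2) \<partial>lborel) = (\<integral>\<^sup>+ y. ennreal ((norm (f y))\<^sup>2) \<partial>lborel)"
    using nn_integral_lborel_shift[of "\<lambda>y. ennreal ((norm (f y))\<^sup>2)" z] by (simp add: add.commute)
  thus "(\<lambda>y. f (y + z)) \<in> L2"
    by (intro L2_bound(1)[of _ "L2_sq f"]) (auto simp: nn_integral_L2[OF assms])
  show "L2_sq (\<lambda>y. f (y + z)) = L2_sq f"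
    unfolding L2_sq_def using integral_lborel_shift[of "\<lambda>y. (norm (f y))\<^sup>2" z] by simp
qed

section \<open>Equality almost everywhere\<close>

lemma ae_eq_refl [simp, intro]: "ae_eq f f" by (simp add: ae_eq_def)
lemma ae_eq_sym: "ae_eq f g \<Longrightarrow> ae_eq g f" unfolding ae_eq_def by (auto elim: eventually_mono)
lemma ae_eq_trans: "ae_eq f g \<Longrightarrow> ae_eq g h \<Longrightarrow> ae_eq f h"
  unfolding ae_eq_def by (auto elim: eventually_elim2 eventually_mono)
lemma ae_eq_add: "ae_eq f f' \<Longrightarrow> ae_eq g g' \<Longrightarrow> ae_eq (\<lambda>y. f y + g y) (\<lambda>y. f' y + g' y)"
  unfolding ae_eq_def by (auto elim: eventually_elim2 eventually_mono)
lemma ae_eq_scale: "ae_eq f f' \<Longrightarrow> ae_eq (\<lambda>y. c * f y) (\<lambda>y. c * f' y)"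
  unfolding ae_eq_def by (auto elim: eventually_elim2 eventually_mono)

lemma integral_ae_eq:
  assumes "ae_eq f f'" "f \<in> L2" "f' \<in> L2" "g \<in> L2"
  shows "(LINT y|lborel. f y * g y) = (LINT y|lborel. f' y * g y)"
  using assms by (intro integral_cong_AE) (auto simp: ae_eq_def L2_def elim: eventually_mono)

section \<open>Pairings and the Cauchy-Schwarz inequality\<close>

lemma L2_mult_integrable: assumes "f \<in> L2" "g \<in> L2" shows "integrable lborel (\<lambda>y. f y * g y)"
proof (rule Bochner_Integration.integrable_bound)
  show "integrable lborel (\<lambda>y. (norm (f y))\<^sup>2 + (norm (g y))\<^sup>2)"
    using assms by (intro Bochner_Integration.integrable_add L2_integrable)
  show "AE y in lborel. norm (f y * g y) \<le> norm ((norm (f y))\<^sup>2 + (norm (g y))\<^sup>2)"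
  proof (intro AE_I2)
    fix y
    have "2 * (norm (f y) * norm (g y)) \<le> (norm (f y))\<^sup>2 + (norm (g y))\<^sup>2"
      using sum_squares_bound[of "norm (f y)" "norm (g y)"] by simp
    moreover have "0 \<le> norm (f y) * norm (g y)" by simp
    ultimately have "norm (f y) * norm (g y) \<le> (norm (f y))\<^sup>2 + (norm (g y))\<^sup>2" by linarith
    thus "norm (f y * g y) \<le> norm ((norm (f y))\<^sup>2 + (norm (g y))\<^sup>2)"
      by (simp add: norm_mult)
  qed
qed (use assms in \<open>auto simp: L2_def\<close>)

lemma L2_abs_integrable: assumes "f \<in> L2" "g \<in> L2" shows "integrable lborel (\<lambda>y. norm (f y) * norm (g y))"
  using integrable_norm[OF L2_mult_integrable[OF assms]] by (simp add: norm_mult)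

lemma L2_cauchy_schwarz_norm:
  assumes "f \<in> L2" "g \<in> L2"
  shows "(LINT y|lborel. norm (f y) * norm (g y))\<^sup>2 \<le> L2_sq f * L2_sq g"
proof -
  define I where "I = (LINT y|lborel. norm (f y) * norm (g y))"
  \<comment> \<open>This quadratic in \<open>t\<close> is the integral of a square; its value at the
    minimum \<open>I / L2_sq g\<close> gives the inequality.\<close>
  have q: "0 \<le> L2_sq f - 2 * t * I + t\<^sup>2 * L2_sq g" for t
  proof -
    have "0 \<le> (LINT y|lborel. (norm (f y) - t * norm (g y))\<^sup>2)" by simp
    also have "\<dots> = (LINT y|lborel. (norm (f y))\<^sup>2 - 2 * t * (norm (f y) * norm (g y)) + t\<^sup>2 * (norm (g y))\<^sup>2)"
      by (intro Bochner_Integration.integral_cong) (auto simp: power2_eq_square algebra_simps)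
    also have "\<dots> = L2_sq f - 2 * t * I + t\<^sup>2 * L2_sq g"
      unfolding I_def L2_sq_def using assms by (simp add: L2_integrable L2_abs_integrable)
    finally show ?thesis .
  qed
  have "I\<^sup>2 \<le> L2_sq f * L2_sq g"
  proof (cases "L2_sq g = 0")
    case True
    have "I = 0"
    proof (rule ccontr)
      assume "I \<noteq> 0"
      \<comment> \<open>Without its leading coefficient the quadratic is affine in \<open>t\<close>;
        at this argument it equals \<open>-1\<close>.\<close>
      thus False using q[of "(L2_sq f + 1) / (2 * I)"] True by (simp add: field_simps)
    qed
    thus ?thesis by simp
  next
    case False
    hence B: "0 < L2_sq g" using L2_sq_nonneg[of g] by linarith
    have "0 \<le> L2_sq f - 2 * (I / L2_sq g) * I + (I / L2_sq g)\<^sup>2 * L2_sq g" by (rule q)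
    also have "\<dots> = L2_sq f - I\<^sup>2 / L2_sq g"
      using B by (simp add: field_simps power2_eq_square)
    finally show ?thesis using B by (simp add: field_simps)
  qed
  thus ?thesis by (simp add: I_def)
qed

lemma L2_cauchy_schwarz:
  assumes "f \<in> L2" "g \<in> L2"
  shows "(norm (LINT y|lborel. f y * g y))\<^sup>2 \<le> L2_sq f * L2_sq g"
proof -
  have "norm (LINT y|lborel. f y * g y) \<le> (LINT y|lborel. norm (f y) * norm (g y))"
    using integral_norm_bound[of lborel "\<lambda>y. f y * g y"] by (simp add: norm_mult)
  hence "(norm (LINT y|lborel. f y * g y))\<^sup>2 \<le> (LINT y|lborel. norm (f y) * norm (g y))\<^sup>2"
    by (intro power_mono) auto
  thus ?thesis using L2_cauchy_schwarz_norm[OF assms] by linarith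
qed

lemma L2_sq_eq_0D: assumes "f \<in> L2" "L2_sq f = 0" shows "ae_eq f (\<lambda>_. 0)"
  using assms integral_nonneg_eq_0_iff_AE[OF L2_integrable[OF assms(1)]]
  by (simp add: L2_sq_def ae_eq_def)

section \<open>Convergence and completeness\<close>

lemma L2_tendsto_integral:
  assumes "\<And>n. f n \<in> L2" "g \<in> L2" "h \<in> L2" "(\<lambda>n. L2_sq (\<lambda>y. f n y - g y)) \<longlonglongrightarrow> 0"
  shows "(\<lambda>n. LINT y|lborel. f n y * h y) \<longlonglongrightarrow> (LINT y|lborel. g y * h y)"
proof -
  have "(\<lambda>n. (norm ((LINT y|lborel. f n y * h y) - (LINT y|lborel. g y * h y)))\<^sup>2) \<longlonglongrightarrow> 0"
  proof (rule tendsto_sandwich[OF _ _ tendsto_const])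
    show "\<forall>\<^sub>F n in sequentially. 0 \<le> (norm ((LINT y|lborel. f n y * h y) - (LINT y|lborel. g y * h y)))\<^sup>2"
      by simp
    show "\<forall>\<^sub>F n in sequentially. (norm ((LINT y|lborel. f n y * h y) - (LINT y|lborel. g y * h y)))\<^sup>2
       \<le> L2_sq (\<lambda>y. f n y - g y) * L2_sq h"
    proof (intro always_eventually allI)
      fix n
      have "(LINT y|lborel. f n y * h y) - (LINT y|lborel. g y * h y) = (LINT y|lborel. (f n y - g y) * h y)"
        using assms by (simp add: left_diff_distrib L2_mult_integrable)
      thus "(norm ((LINT y|lborel. f n y * h y) - (LINT y|lborel. g y * h y)))\<^sup>2
         \<le> L2_sq (\<lambda>y. f n y - g y) * L2_sq h"
        using L2_cauchy_schwarz[OF L2_diff[OF assms(1,2)] assms(3)] by simp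
    qed
    show "(\<lambda>n. L2_sq (\<lambda>y. f n y - g y) * L2_sq h) \<longlonglongrightarrow> 0"
      using tendsto_mult_right[OF assms(4), of "L2_sq h"] by simp
  qed
  hence "(\<lambda>n. sqrt ((norm ((LINT y|lborel. f n y * h y) - (LINT y|lborel. g y * h y)))\<^sup>2)) \<longlonglongrightarrow> sqrt 0"
    by (rule tendsto_real_sqrt)
  hence "(\<lambda>n. norm ((LINT y|lborel. f n y * h y) - (LINT y|lborel. g y * h y))) \<longlonglongrightarrow> 0"
    by simp
  thus ?thesis by (simp only: tendsto_norm_zero_iff LIM_zero_iff)
qed

lemma L2_dominated_convergence:
  assumes f: "\<And>n. f n \<in> borel_measurable borel" and F: "F \<in> L2"
    and le: "\<And>n y. norm (f n y) \<le> norm (F y)"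
    and lim: "\<And>y. (\<lambda>n. f n y) \<longlonglongrightarrow> g y" and g: "g \<in> borel_measurable borel"
  shows "(\<lambda>n. L2_sq (\<lambda>y. f n y - g y)) \<longlonglongrightarrow> 0"
proof -
  note [measurable] = f g L2_measurable[OF F]
  have gle: "norm (g y) \<le> norm (F y)" for y
    by (rule LIMSEQ_le_const2[OF tendsto_norm[OF lim]]) (use le in auto)
  have "(\<lambda>n. LINT y|lborel. (norm (f n y - g y))\<^sup>2) \<longlonglongrightarrow> (LINT y::real^3|lborel. (0::real))"
  proof (rule integral_dominated_convergence[where w="\<lambda>y. 4 * (norm (F y))\<^sup>2"])
    show "integrable lborel (\<lambda>y. 4 * (norm (F y))\<^sup>2)"
      using L2_integrable[OF F] by simp
    show "AE y in lborel. (\<lambda>n. (norm (f n y - g y))\<^sup>2) \<longlonglongrightarrow> 0"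
    proof (intro AE_I2)
      fix y
      have "(\<lambda>n. (norm (f n y - g y))\<^sup>2) \<longlonglongrightarrow> (norm (g y - g y))\<^sup>2"
        by (intro tendsto_intros lim)
      thus "(\<lambda>n. (norm (f n y - g y))\<^sup>2) \<longlonglongrightarrow> 0" by simp
    qed
    show "AE y in lborel. norm ((norm (f n y - g y))\<^sup>2) \<le> 4 * (norm (F y))\<^sup>2" for n
    proof (intro AE_I2)
      fix y
      have "norm (f n y - g y) \<le> 2 * norm (F y)"
        using norm_triangle_ineq4[of "f n y" "g y"] le[of n y] gle[of y] by linarith
      hence "(norm (f n y - g y))\<^sup>2 \<le> (2 * norm (F y))\<^sup>2" by (intro power_mono) auto
      thus "norm ((norm (f n y - g y))\<^sup>2) \<le> 4 * (norm (F y))\<^sup>2" by (simp add: power_mult_distrib)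
    qed
  qed measurable
  thus ?thesis by (simp add: L2_sq_def)
qed

text \<open>\<open>norm (d k)\<close> is the product of \<open>sqrt (1/2) ^ k\<close> and
  \<open>sqrt 2 ^ k * norm (d k)\<close>, hence at most the sum of their squares: a geometric term
  plus the given one.\<close>

lemma summable_if_pow2_weighted_squares:
  fixes d :: "nat \<Rightarrow> complex"
  assumes "summable (\<lambda>k. 2 ^ k * (norm (d k))\<^sup>2)"
  shows "summable d"
proof (rule summable_norm_cancel, rule summable_comparison_test')
  let ?a = "\<lambda>k. (1 / 2) ^ k + 2 ^ k * (norm (d k))\<^sup>2 :: real"
  show "summable ?a" using assms by (intro summable_add summable_geometric) auto
  fix k :: nat assume "0 \<le> k"
  have "2 * ((sqrt (1/2)) ^ k * (sqrt 2 ^ k * norm (d k))) \<le> ((sqrt (1/2)) ^ k)\<^sup>2 + (sqrt 2 ^ k * norm (d k))\<^sup>2"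
    using sum_squares_bound[of "sqrt (1/2) ^ k" "sqrt 2 ^ k * norm (d k)"] by (simp add: mult.assoc)
  moreover have "sqrt (1/2) ^ k * (sqrt 2 ^ k * norm (d k)) = norm (d k)"
    unfolding mult.assoc[symmetric] power_mult_distrib[symmetric] real_sqrt_mult[symmetric] by simp
  moreover have "((sqrt (1/2)) ^ k)\<^sup>2 = (1 / 2) ^ k" "(sqrt 2 ^ k * norm (d k))\<^sup>2 = 2 ^ k * (norm (d k))\<^sup>2"
    by (simp_all add: power_mult_distrib power_mult[symmetric] mult.commute[of k] power_mult power_divide)
  ultimately have "norm (d k) \<le> ?a k"
    using norm_ge_zero[of "d k"] by linarith
  thus "norm (norm (d k)) \<le> ?a k" by simp
qed

text \<open>Increments bounded by \<open>(1 / 4) ^ k\<close> tolerate the weight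
  \<open>2 ^ k\<close>: the weighted squares have a finite total integral, so their sum is finite
  almost everywhere, and there the telescoping series converges.\<close>

lemma L2_fast_Cauchy_converges_AE:
  assumes f: "\<And>k. f k \<in> L2" and le: "\<And>k. L2_sq (\<lambda>y. f (Suc k) y - f k y) \<le> (1 / 4) ^ k"
  shows "AE y in lborel. convergent (\<lambda>k. f k y)"
proof -
  note [measurable] = L2_measurable[OF f]
  define d where "d k y = f (Suc k) y - f k y" for k y
  have d: "d k \<in> L2" for k unfolding d_def by (intro L2_diff f)
  have [measurable]: "d k \<in> borel_measurable borel" for k using d by (rule L2_measurable)
  have "(\<integral>\<^sup>+ y. (\<Sum>k. ennreal (2 ^ k * (norm (d k y))\<^sup>2)) \<partial>lborel) =
      (\<Sum>k. (\<integral>\<^sup>+ y. ennreal (2 ^ k * (norm (d k y))\<^sup>2) \<partial>lborel))"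
    by (rule nn_integral_suminf) measurable
  also have "\<dots> = (\<Sum>k. ennreal (2 ^ k * L2_sq (d k)))"
    by (intro suminf_cong) (simp add: ennreal_mult nn_integral_cmult nn_integral_L2[OF d])
  also have "\<dots> \<le> (\<Sum>k. ennreal ((1 / 2) ^ k))"
  proof (intro suminf_le ennreal_leI)
    fix k
    have "2 ^ k * L2_sq (d k) \<le> 2 ^ k * (1 / 4) ^ k"
      using le[of k] by (intro mult_left_mono) (simp_all add: d_def[abs_def])
    also have "\<dots> = (1 / 2) ^ k" by (simp add: power_mult_distrib[symmetric])
    finally show "2 ^ k * L2_sq (d k) \<le> (1 / 2) ^ k" .
  qed auto
  also have "\<dots> = ennreal (\<Sum>k. (1 / 2) ^ k)"
    by (intro suminf_ennreal_eq summable_sums summable_geometric) auto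
  also have "\<dots> < \<infinity>" by simp
  finally have "AE y in lborel. (\<Sum>k. ennreal (2 ^ k * (norm (d k y))\<^sup>2)) \<noteq> \<infinity>"
    by (intro nn_integral_PInf_AE) auto
  thus ?thesis
  proof eventually_elim
    fix y assume "(\<Sum>k. ennreal (2 ^ k * (norm (d k y))\<^sup>2)) \<noteq> \<infinity>"
    hence "summable (\<lambda>k. 2 ^ k * (norm (d k y))\<^sup>2)"
      by (intro summable_suminf_not_top) auto
    hence "summable (\<lambda>k. d k y)" by (rule summable_if_pow2_weighted_squares)
    hence "convergent (\<lambda>n. \<Sum>k<n. d k y)" by (simp add: summable_iff_convergent)
    moreover have "(\<Sum>k<n. d k y) = f n y - f 0 y" for n
      unfolding d_def by (rule sum_lessThan_telescope)
    ultimately have "convergent (\<lambda>n. (f n y - f 0 y) + f 0 y)"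
      by (intro convergent_add convergent_const) simp
    thus "convergent (\<lambda>k. f k y)" by simp
  qed
qed

text \<open>Riesz-Fischer: a rapidly convergent subsequence has a limit almost everywhere, and
  Fatou's lemma carries the Cauchy bound over to the distance from that limit.\<close>

lemma L2_complete:
  assumes f: "\<And>k. f k \<in> L2"
    and C: "\<And>e. 0 < e \<Longrightarrow> \<exists>N. \<forall>m\<ge>N. \<forall>n\<ge>N. L2_sq (\<lambda>y. f m y - f n y) \<le> e"
  shows "\<exists>g\<in>L2. (\<lambda>n. L2_sq (\<lambda>y. f n y - g y)) \<longlonglongrightarrow> 0"
proof -
  note [measurable] = L2_measurable[OF f]
  have "\<exists>N. \<forall>m\<ge>N. \<forall>n\<ge>N. L2_sq (\<lambda>y. f m y - f n y) \<le> (1 / 4) ^ k" for k :: nat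
    by (rule C) simp
  then obtain N where N: "\<And>k m n. N k \<le> m \<Longrightarrow> N k \<le> n \<Longrightarrow> L2_sq (\<lambda>y. f m y - f n y) \<le> (1 / 4) ^ k"
    by metis
  \<comment> \<open>The sum secures \<open>N k \<le> r k\<close>, the summand \<open>k\<close>
    secures strict growth; thus \<open>r k\<close> and \<open>r (Suc k)\<close> both lie beyond
    \<open>N k\<close>.\<close>
  define r where "r k = (\<Sum>i\<le>k. N i) + k" for k
  have rN: "N k \<le> r k" and rSuc: "r k < r (Suc k)" for k
    by (auto simp: r_def intro!: trans_le_add1 member_le_sum[of k])
  have rN': "N k \<le> r (Suc k)" for k using rN[of k] rSuc[of k] by linarith
  have rk: "k \<le> r k" for k by (simp add: r_def)
  have conv: "AE y in lborel. convergent (\<lambda>k. f (r k) y)"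
    by (rule L2_fast_Cauchy_converges_AE) (use f N rN rN' in auto)
  define g where "g y = lim (\<lambda>k. f (r k) y)" for y
  have [measurable]: "g \<in> borel_measurable borel"
    unfolding g_def[abs_def] by (rule borel_measurable_lim_metric) measurable
  have lim: "AE y in lborel. (\<lambda>k. f (r k) y) \<longlonglongrightarrow> g y"
    using conv unfolding g_def by eventually_elim (simp add: convergent_LIMSEQ_iff)
  \<comment> \<open>One estimate for two purposes: with \<open>e = 1\<close> it shows that the limit
    lies in \<open>L2\<close>, with small \<open>e\<close> that the sequence converges to
    it.\<close>
  have close: "(\<lambda>y. f n y - g y) \<in> L2 \<and> L2_sq (\<lambda>y. f n y - g y) \<le> e"
    if e: "0 < e" and n: "\<forall>m\<ge>M. \<forall>n\<ge>M. L2_sq (\<lambda>y. f m y - f n y) \<le> e" "M \<le> n" for e M n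
  proof -
    have "(\<integral>\<^sup>+ y. ennreal ((norm (f n y - g y))\<^sup>2) \<partial>lborel) =
      (\<integral>\<^sup>+ y. liminf (\<lambda>k. ennreal ((norm (f n y - f (r k) y))\<^sup>2)) \<partial>lborel)"
    proof (rule nn_integral_cong_AE, use lim in eventually_elim)
      fix y assume "(\<lambda>k. f (r k) y) \<longlonglongrightarrow> g y"
      hence "(\<lambda>k. ennreal ((norm (f n y - f (r k) y))\<^sup>2)) \<longlonglongrightarrow> ennreal ((norm (f n y - g y))\<^sup>2)"
        by (intro tendsto_intros)
      from lim_imp_Liminf[OF _ this]
      show "ennreal ((norm (f n y - g y))\<^sup>2) = liminf (\<lambda>k. ennreal ((norm (f n y - f (r k) y))\<^sup>2))"
        by simp
    qed
    also have "\<dots> \<le> liminf (\<lambda>k. (\<integral>\<^sup>+ y. ennreal ((norm (f n y - f (r k) y))\<^sup>2) \<partial>lborel))"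
      by (rule nn_integral_liminf) measurable
    also have "\<dots> \<le> ennreal e"
    proof (rule Liminf_le[OF sequentially_bot])
      show "\<forall>\<^sub>F k in sequentially. (\<integral>\<^sup>+ y. ennreal ((norm (f n y - f (r k) y))\<^sup>2) \<partial>lborel) \<le> ennreal e"
        using eventually_ge_at_top[of M]
      proof eventually_elim
        fix k assume "M \<le> k"
        hence "M \<le> r k" using rk[of k] by linarith
        thus "(\<integral>\<^sup>+ y. ennreal ((norm (f n y - f (r k) y))\<^sup>2) \<partial>lborel) \<le> ennreal e"
          using n by (simp add: nn_integral_L2[OF L2_diff[OF f f]] ennreal_leI)
      qed
    qed
    finally show ?thesis
      using L2_bound[of "\<lambda>y. f n y - g y" e] e by auto
  qed
  have g: "g \<in> L2"
  proof -
    obtain M where "\<forall>m\<ge>M. \<forall>n\<ge>M. L2_sq (\<lambda>y. f m y - f n y) \<le> 1" using C[of 1] by auto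
    hence "(\<lambda>y. f M y - g y) \<in> L2" using close[of 1 M M] by auto
    from L2_diff[OF f[of M] this] show ?thesis by simp
  qed
  moreover have "(\<lambda>n. L2_sq (\<lambda>y. f n y - g y)) \<longlonglongrightarrow> 0"
  proof (rule LIMSEQ_I)
    fix e :: real assume e: "0 < e"
    then obtain M where "\<forall>m\<ge>M. \<forall>n\<ge>M. L2_sq (\<lambda>y. f m y - f n y) \<le> e / 2" using C[of "e / 2"] by auto
    hence "L2_sq (\<lambda>y. f n y - g y) \<le> e / 2" if "M \<le> n" for n
      using close[of "e / 2" M n] that e by auto
    moreover have "e / 2 < e" using e by simp
    ultimately have "L2_sq (\<lambda>y. f n y - g y) < e" if "M \<le> n" for n
      using that by (blast intro: le_less_trans)
    thus "\<exists>no. \<forall>n\<ge>no. norm (L2_sq (\<lambda>y. f n y - g y) - 0) < e"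
      by (intro exI[of _ M]) simp
  qed
  ultimately show ?thesis by blast
qed

section \<open>The resolvent\<close>

definition yuk :: "real^3 \<Rightarrow> fn3" where
  "yuk p y = complex_of_real (yukawa (y - p))"

text \<open>Given at every point and not only almost everywhere: the translated potentials lie in
  \<open>L2\<close>, so the pairing exists for each \<open>p\<close>. The boundary conditions depend
  on these point values.\<close>

definition resolvent :: "fn3 \<Rightarrow> fn3" where
  "resolvent h p = (LINT y|lborel. yuk p y * h y)"

lemma yuk_measurable [measurable]: "yuk p \<in> borel_measurable borel"
  unfolding yuk_def[abs_def] by measurable

lemma yuk_L2 [simp, intro]: "yuk p \<in> L2"
proof (rule L2_bound(1))
  show "(\<integral>\<^sup>+ y. ennreal ((norm (yuk p y))\<^sup>2) \<partial>lborel) \<le> ennreal (1 / (8 * pi))"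
    using nn_integral_yukawa_yukawa[of p p] by (simp add: yuk_def power2_eq_square)
qed auto

lemma cnj_yuk [simp]: "cnj (yuk p y) = yuk p y"
  by (simp add: yuk_def)

lemma resolvent_yuk: "resolvent (yuk q) p = complex_of_real (exp (- norm (p - q)) / (8 * pi))"
proof -
  have "resolvent (yuk q) p = (LINT y|lborel. complex_of_real (yukawa (y - p) * yukawa (y - q)))"
    by (simp add: resolvent_def yuk_def)
  also have "\<dots> = complex_of_real (LINT y|lborel. yukawa (y - p) * yukawa (y - q))"
    by (rule integral_complex_of_real)
  also have "(LINT y|lborel. yukawa (y - p) * yukawa (y - q)) = exp (- norm (p - q)) / (8 * pi)"
    by (subst integral_eq_nn_integral) (auto simp: nn_integral_yukawa_yukawa)
  finally show ?thesis .
qed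

lemma yuk_mult_yuk: "(LINT y|lborel. yuk p y * yuk q y) = complex_of_real (exp (- norm (p - q)) / (8 * pi))"
  using resolvent_yuk[of q p] by (simp add: resolvent_def)

lemma resolvent_add: "f \<in> L2 \<Longrightarrow> g \<in> L2 \<Longrightarrow> resolvent (\<lambda>y. f y + g y) p = resolvent f p + resolvent g p"
  by (simp add: resolvent_def distrib_left L2_mult_integrable)

lemma resolvent_diff: "f \<in> L2 \<Longrightarrow> g \<in> L2 \<Longrightarrow> resolvent (\<lambda>y. f y - g y) p = resolvent f p - resolvent g p"
  by (simp add: resolvent_def right_diff_distrib L2_mult_integrable)

lemma resolvent_scale: "resolvent (\<lambda>y. c * f y) p = c * resolvent f p"
  by (simp add: resolvent_def mult.left_commute)

lemma resolvent_zero [simp]: "resolvent (\<lambda>_. 0) p = 0"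
  by (simp add: resolvent_def)

lemma resolvent_sum: "(\<And>i. i \<in> I \<Longrightarrow> f i \<in> L2) \<Longrightarrow> resolvent (\<lambda>y. \<Sum>i\<in>I. f i y) p = (\<Sum>i\<in>I. resolvent (f i) p)"
  by (simp add: resolvent_def sum_distrib_left L2_mult_integrable)

lemma resolvent_cnj: "resolvent (\<lambda>y. cnj (f y)) p = cnj (resolvent f p)"
proof -
  have "resolvent (\<lambda>y. cnj (f y)) p = (LINT y|lborel. cnj (yuk p y * f y))"
    unfolding resolvent_def by simp
  thus ?thesis by (simp only: Bochner_Integration.integral_cnj resolvent_def)
qed

lemma resolvent_cong: "ae_eq f g \<Longrightarrow> f \<in> L2 \<Longrightarrow> g \<in> L2 \<Longrightarrow> resolvent f p = resolvent g p"
  unfolding resolvent_def using integral_ae_eq[of f g "yuk p"] by (simp add: mult.commute)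

text \<open>By \<open>yuk_mult_yuk\<close> the squared distance of the potentials at
  \<open>p\<close> and \<open>q\<close> is explicit, and Cauchy-Schwarz applies. The bound amounts
  to Hoelder continuity of order 1/2 and takes the place of the Sobolev embedding.\<close>

lemma resolvent_diff_sq_le:
  assumes h: "h \<in> L2"
  shows "(norm (resolvent h p - resolvent h q))\<^sup>2 \<le> L2_sq h * ((1 - exp (- norm (p - q))) / (4 * pi))"
proof -
  have 1: "(\<lambda>y. yuk p y - yuk q y) \<in> L2" by auto
  have "complex_of_real (L2_sq (\<lambda>y. yuk p y - yuk q y)) = (LINT y|lborel. (yuk p y - yuk q y) * (yuk p y - yuk q y))"
    unfolding L2_sq_def integral_complex_of_real[symmetric]
    by (intro Bochner_Integration.integral_cong)
       (simp_all add: yuk_def power2_eq_square norm_mult[symmetric] of_real_diff[symmetric] of_real_mult[symmetric] del: of_real_diff of_real_mult)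
  also have "\<dots> = (LINT y|lborel. yuk p y * yuk p y - yuk p y * yuk q y - (yuk p y * yuk q y - yuk q y * yuk q y))"
    by (simp add: algebra_simps)
  also have "\<dots> = complex_of_real ((1 - exp (- norm (p - q))) / (4 * pi))"
    by (simp add: L2_mult_integrable yuk_mult_yuk) (simp add: field_simps)
  finally have 2: "L2_sq (\<lambda>y. yuk p y - yuk q y) = (1 - exp (- norm (p - q))) / (4 * pi)"
    by (simp only: of_real_eq_iff)
  have "(LINT y|lborel. h y * (yuk p y - yuk q y)) = (LINT y|lborel. yuk p y * h y - yuk q y * h y)"
    by (intro Bochner_Integration.integral_cong) (simp_all add: algebra_simps)
  also have "\<dots> = resolvent h p - resolvent h q"
    using h by (simp add: resolvent_def L2_mult_integrable)
  finally show ?thesis using L2_cauchy_schwarz[OF h 1] unfolding 2 by (simp only:)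
qed

lemma resolvent_continuous: assumes h: "h \<in> L2" shows "continuous_on UNIV (resolvent h)"
proof (unfold continuous_on_def, intro ballI)
  fix p :: "real^3"
  have "((\<lambda>q. sqrt (L2_sq h * ((1 - exp (- norm (q - p))) / (4 * pi)))) \<longlongrightarrow>
      sqrt (L2_sq h * ((1 - exp (- norm (p - p))) / (4 * pi)))) (at p within UNIV)"
    by (intro tendsto_intros) auto
  hence 1: "((\<lambda>q. sqrt (L2_sq h * ((1 - exp (- norm (q - p))) / (4 * pi)))) \<longlongrightarrow> 0) (at p within UNIV)"
    by simp
  have 2: "norm (resolvent h q - resolvent h p) \<le> sqrt (L2_sq h * ((1 - exp (- norm (q - p))) / (4 * pi)))" for q
    by (rule real_le_rsqrt[OF resolvent_diff_sq_le[OF h]])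
  have "((\<lambda>q. resolvent h q - resolvent h p) \<longlongrightarrow> 0) (at p within UNIV)"
    by (rule Lim_null_comparison[OF always_eventually[OF allI[OF 2]] 1])
  thus "(resolvent h \<longlongrightarrow> resolvent h p) (at p within UNIV)"
    by (simp only: LIM_zero_iff)
qed

lemma resolvent_measurable [measurable]: "h \<in> L2 \<Longrightarrow> resolvent h \<in> borel_measurable borel"
  by (intro borel_measurable_continuous_onI resolvent_continuous)

lemma nn_integral_yukawa_shift: "(\<integral>\<^sup>+ y. ennreal (yukawa (y - p)) \<partial>lborel) = 1"
  using nn_integral_lborel_shift[of "\<lambda>y. ennreal (yukawa y)" "- p"] nn_integral_yukawa by simp

text \<open>Jensen's inequality for the probability density \<open>yukawa\<close>: Cauchy-Schwarz
  with the kernel split into two square roots. Integrating over \<open>p\<close> makes the resolvent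
  a contraction.\<close>

lemma resolvent_sq_le:
  assumes h: "h \<in> L2"
  shows "ennreal ((norm (resolvent h p))\<^sup>2) \<le> (\<integral>\<^sup>+ y. ennreal (yukawa (y - p)) * ennreal ((norm (h y))\<^sup>2) \<partial>lborel)"
proof -
  have [measurable]: "h \<in> borel_measurable borel" using h by (rule L2_measurable)
  let ?f = "\<lambda>y. ennreal (sqrt (yukawa (y - p)))" and ?g = "\<lambda>y. ennreal (sqrt (yukawa (y - p)) * norm (h y))"
  have "ennreal (norm (resolvent h p)) \<le> (\<integral>\<^sup>+ y. ennreal (norm (yuk p y * h y)) \<partial>lborel)"
    unfolding resolvent_def by (intro integral_norm_bound_ennreal L2_mult_integrable yuk_L2 h)
  also have "\<dots> = (\<integral>\<^sup>+ y. ?f y * ?g y \<partial>lborel)"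
    by (intro nn_integral_cong) (simp add: yuk_def norm_mult ennreal_mult[symmetric] mult.assoc[symmetric])
  finally have "ennreal (norm (resolvent h p)) ^ 2 \<le> (\<integral>\<^sup>+ y. ?f y * ?g y \<partial>lborel)\<^sup>2"
    by (intro power_mono) auto
  also have "\<dots> \<le> (\<integral>\<^sup>+ y. ?f y ^ 2 \<partial>lborel) * (\<integral>\<^sup>+ y. ?g y ^ 2 \<partial>lborel)"
    by (rule Cauchy_Schwarz_nn_integral) measurable
  also have "(\<integral>\<^sup>+ y. ?f y ^ 2 \<partial>lborel) = 1"
    using nn_integral_yukawa_shift[of p] by (simp add: ennreal_power)
  also have "(\<integral>\<^sup>+ y. ?g y ^ 2 \<partial>lborel) = (\<integral>\<^sup>+ y. ennreal (yukawa (y - p)) * ennreal ((norm (h y))\<^sup>2) \<partial>lborel)"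
    by (intro nn_integral_cong) (simp add: ennreal_power power_mult_distrib ennreal_mult)
  finally show ?thesis by (simp add: ennreal_power)
qed

lemma resolvent_contraction:
  assumes h: "h \<in> L2" shows "resolvent h \<in> L2" "L2_sq (resolvent h) \<le> L2_sq h"
proof -
  have [measurable]: "h \<in> borel_measurable borel" using h by (rule L2_measurable)
  have "(\<integral>\<^sup>+ p. ennreal ((norm (resolvent h p))\<^sup>2) \<partial>lborel) \<le>
    (\<integral>\<^sup>+ p. (\<integral>\<^sup>+ y. ennreal (yukawa (y - p)) * ennreal ((norm (h y))\<^sup>2) \<partial>lborel) \<partial>lborel)"
    by (intro nn_integral_mono resolvent_sq_le h)
  also have "\<dots> = (\<integral>\<^sup>+ y. (\<integral>\<^sup>+ p. ennreal (yukawa (y - p)) * ennreal ((norm (h y))\<^sup>2) \<partial>lborel) \<partial>lborel)"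
    by (rule lborel_pair.Fubini') measurable
  also have "\<dots> = (\<integral>\<^sup>+ y. ennreal ((norm (h y))\<^sup>2) \<partial>lborel)"
  proof (intro nn_integral_cong)
    fix y
    have "(\<integral>\<^sup>+ p. ennreal (yukawa (y - p)) \<partial>lborel) = 1"
      using nn_integral_yukawa_shift[of y] by (simp only: yukawa_commute[of y])
    thus "(\<integral>\<^sup>+ p. ennreal (yukawa (y - p)) * ennreal ((norm (h y))\<^sup>2) \<partial>lborel) = ennreal ((norm (h y))\<^sup>2)"
      by (simp add: nn_integral_multc)
  qed
  also have "\<dots> = ennreal (L2_sq h)" by (rule nn_integral_L2[OF h])
  finally have le: "(\<integral>\<^sup>+ p. ennreal ((norm (resolvent h p))\<^sup>2) \<partial>lborel) \<le> ennreal (L2_sq h)" .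
  show "resolvent h \<in> L2" "L2_sq (resolvent h) \<le> L2_sq h"
    using L2_bound[OF _ le] h by auto
qed

lemma resolvent_L2 [intro]: "h \<in> L2 \<Longrightarrow> resolvent h \<in> L2"
  by (rule resolvent_contraction)

section \<open>The resolvent as an average of translations\<close>

lemma resolvent_conv:
  assumes "h \<in> L2" shows "resolvent h p = (LINT z|lborel. of_real (yukawa z) * h (p + z))"
proof -
  have [measurable]: "h \<in> borel_measurable borel" using assms by (rule L2_measurable)
  show ?thesis
    unfolding resolvent_def yuk_def
    using integral_lborel_shift[of "\<lambda>y. complex_of_real (yukawa (y - p)) * h y" p] by (simp add: add.commute)
qed

text \<open>The kernel is separated from the two functions. Whatever holds for the inner integral at
  every shift \<open>z\<close> (a reflection, an integration by parts, a weak equation) passes to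
  the resolvent, and the singular kernel is never differentiated.\<close>

lemma resolvent_pairing:
  assumes a: "a \<in> L2" and b: "b \<in> L2"
  shows "(LINT p|lborel. resolvent a p * b p) =
    (LINT z|lborel. of_real (yukawa z) * (LINT p|lborel. a (p + z) * b p))"
    and "integrable lborel (\<lambda>z. of_real (yukawa z) * (LINT p|lborel. a (p + z) * b p))"
proof -
  have [measurable]: "a \<in> borel_measurable borel" "b \<in> borel_measurable borel"
    using assms by (auto intro: L2_measurable)
  let ?f = "\<lambda>p z. complex_of_real (yukawa z) * (a (p + z) * b p)"
  define C where "C = L2_sq a + L2_sq b"
  have m: "case_prod ?f \<in> borel_measurable (lborel \<Otimes>\<^sub>M lborel)" by measurable
  have m': "(\<lambda>z. ennreal (norm (case_prod ?f z))) \<in> borel_measurable (lborel \<Otimes>\<^sub>M lborel)" using m by measurable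
  have inner: "(\<integral>\<^sup>+ p. ennreal (norm (?f p z)) \<partial>lborel) \<le> ennreal (yukawa z) * ennreal C" for z
  proof -
    have "norm (a (p + z) * b p) \<le> (norm (a (p + z)))\<^sup>2 + (norm (b p))\<^sup>2" for p
    proof -
      have "2 * (norm (a (p + z)) * norm (b p)) \<le> (norm (a (p + z)))\<^sup>2 + (norm (b p))\<^sup>2"
        using sum_squares_bound[of "norm (a (p + z))" "norm (b p)"] by simp
      moreover have "0 \<le> norm (a (p + z)) * norm (b p)" by simp
      ultimately show ?thesis unfolding norm_mult by linarith
    qed
    hence "(\<integral>\<^sup>+ p. ennreal (norm (?f p z)) \<partial>lborel) \<le>
        (\<integral>\<^sup>+ p. ennreal (yukawa z) * (ennreal ((norm (a (p + z)))\<^sup>2) + ennreal ((norm (b p))\<^sup>2)) \<partial>lborel)"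
      by (intro nn_integral_mono)
         (simp add: norm_mult[of "of_real _"] ennreal_mult[symmetric] ennreal_plus[symmetric] mult_left_mono ennreal_leI del: ennreal_plus)
    also have "\<dots> = ennreal (yukawa z) * ennreal C"
      by (simp add: nn_integral_cmult nn_integral_add nn_integral_L2[OF L2_shift(1)[OF a]] nn_integral_L2[OF b] L2_shift(2)[OF a] C_def)
    finally show ?thesis .
  qed
  have "(\<integral>\<^sup>+ z. ennreal (norm (case_prod ?f z)) \<partial>(lborel \<Otimes>\<^sub>M lborel)) =
    (\<integral>\<^sup>+ z. (\<integral>\<^sup>+ p. ennreal (norm (?f p z)) \<partial>lborel) \<partial>lborel)"
    using lborel_pair.nn_integral_snd[OF m'] by simp
  also have "\<dots> \<le> (\<integral>\<^sup>+ z. ennreal (yukawa z) * ennreal C \<partial>lborel)"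
    by (intro nn_integral_mono inner)
  also have "\<dots> = ennreal C"
    by (simp add: nn_integral_multc nn_integral_yukawa)
  also have "\<dots> < \<infinity>" by simp
  finally have int: "integrable (lborel \<Otimes>\<^sub>M lborel) (case_prod ?f)"
    using m by (intro integrableI_bounded)
  have "(LINT p|lborel. resolvent a p * b p) = (LINT p|lborel. (LINT z|lborel. ?f p z))"
    by (intro Bochner_Integration.integral_cong)
       (simp_all add: resolvent_conv[OF a] mult.assoc[symmetric])
  also have "\<dots> = (LINT z|lborel. (LINT p|lborel. ?f p z))"
    by (rule lborel_pair.Fubini_integral[OF int, symmetric])
  also have "\<dots> = (LINT z|lborel. of_real (yukawa z) * (LINT p|lborel. a (p + z) * b p))"
    by simp
  finally show "(LINT p|lborel. resolvent a p * b p) =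
    (LINT z|lborel. of_real (yukawa z) * (LINT p|lborel. a (p + z) * b p))" .
  show "integrable lborel (\<lambda>z. of_real (yukawa z) * (LINT p|lborel. a (p + z) * b p))"
    using lborel_pair.integrable_snd[OF int] by simp
qed

text \<open>Evenness of \<open>yukawa\<close> absorbs the reflection of \<open>z\<close>, and a
  translation of the inner integral moves the shift from \<open>a\<close> to
  \<open>b\<close>.\<close>

lemma resolvent_symmetric:
  assumes a: "a \<in> L2" and b: "b \<in> L2"
  shows "(LINT p|lborel. resolvent a p * b p) = (LINT p|lborel. a p * resolvent b p)"
proof -
  have [measurable]: "a \<in> borel_measurable borel" "b \<in> borel_measurable borel"
    using assms by (auto intro: L2_measurable)
  have "(LINT p|lborel. resolvent a p * b p) = (LINT z|lborel. of_real (yukawa z) * (LINT p|lborel. a (p + z) * b p))"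
    by (rule resolvent_pairing[OF a b])
  also have "\<dots> = (LINT z|lborel. of_real (yukawa (- z)) * (LINT p|lborel. a (p + - z) * b p))"
    by (rule integral_lborel_reflect[symmetric]) measurable
  also have "\<dots> = (LINT z|lborel. of_real (yukawa z) * (LINT p|lborel. b (p + z) * a p))"
    using integral_lborel_shift[of "\<lambda>p. a (p + - z) * b p" z for z]
    by (simp add: mult.commute)
  also have "\<dots> = (LINT p|lborel. a p * resolvent b p)"
    using resolvent_pairing(1)[OF b a] by (simp add: mult.commute)
  finally show ?thesis .
qed

section \<open>Calculus of test functions\<close>

lemma pdiff_eq: "(f has_derivative D) (at y) \<Longrightarrow> pdiff i f y = D (axis i 1)"
  unfolding pdiff_def using frechet_derivative_at[of f D y] by simp

lemma frechet_derivative_pdiff: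
  assumes "f differentiable (at y)"
  shows "frechet_derivative f (at y) v = (\<Sum>i\<in>UNIV. v $ i * pdiff i f y)"
proof -
  interpret linear "frechet_derivative f (at y)"
    by (rule linear_frechet_derivative[OF assms])
  have "v = (\<Sum>i\<in>UNIV. v $ i *\<^sub>R axis i 1)"
    using basis_expansion[of v] by (simp add: scalar_mult_eq_scaleR)
  hence "frechet_derivative f (at y) v = frechet_derivative f (at y) (\<Sum>i\<in>UNIV. v $ i *\<^sub>R axis i 1)"
    by simp
  also have "\<dots> = (\<Sum>i\<in>UNIV. v $ i * pdiff i f y)"
    by (simp add: sum scale pdiff_def)
  finally show ?thesis .
qed

lemma has_derivative_pdiff:
  assumes "f differentiable (at y)"
  shows "(f has_derivative (\<lambda>v. \<Sum>i\<in>UNIV. v $ i * pdiff i f y)) (at y)"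
  using assms frechet_derivative_pdiff[OF assms] by (metis (no_types, lifting) ext frechet_derivative_works)

lemma pdiff_shift:
  assumes "f differentiable (at (y + c))"
  shows "pdiff i (\<lambda>y. f (y + c)) y = pdiff i f (y + c)"
    and "(\<lambda>y. f (y + c)) differentiable (at y)"
proof -
  have "((\<lambda>y. f (y + c)) has_derivative frechet_derivative f (at (y + c)) \<circ> (\<lambda>h. h)) (at y)"
    unfolding o_def
    by (rule has_derivative_compose[of "\<lambda>y. y + c" "\<lambda>h. h"])
       (use assms in \<open>auto intro!: derivative_eq_intros simp: frechet_derivative_works[symmetric]\<close>)
  thus "pdiff i (\<lambda>y. f (y + c)) y = pdiff i f (y + c)" "(\<lambda>y. f (y + c)) differentiable (at y)"
    by (auto simp: pdiff_eq pdiff_def[of i f] differentiable_def)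
qed

lemma pdiff_add:
  assumes "f differentiable (at y)" "g differentiable (at y)"
  shows "pdiff i (\<lambda>y. f y + g y) y = pdiff i f y + pdiff i g y"
  using pdiff_eq[OF has_derivative_add[OF assms[THEN frechet_derivative_works[THEN iffD1]]]]
  by (simp add: pdiff_def)

lemma pdiff_cmult:
  assumes "f differentiable (at y)"
  shows "pdiff i (\<lambda>y. c * f y) y = c * pdiff i f y"
  using pdiff_eq[OF has_derivative_mult_right[OF assms[THEN frechet_derivative_works[THEN iffD1]]]]
  by (simp add: pdiff_def)

lemma pdiff_mult:
  assumes "f differentiable (at y)" "g differentiable (at y)"
  shows "pdiff i (\<lambda>y. f y * g y) y = f y * pdiff i g y + pdiff i f y * g y"
  using pdiff_eq[OF has_derivative_mult[OF assms[THEN frechet_derivative_works[THEN iffD1]]]]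
  by (simp add: pdiff_def)

lemma DERIV_along_axis:
  assumes "f differentiable (at (y + s *\<^sub>R axis i 1))"
  shows "((\<lambda>s. f (y + s *\<^sub>R axis i 1)) has_real_derivative pdiff i f (y + s *\<^sub>R axis i 1)) (at s)"
proof -
  have lin: "linear (frechet_derivative f (at (y + s *\<^sub>R axis i 1)))"
    by (rule linear_frechet_derivative[OF assms])
  have 1: "((\<lambda>s. y + s *\<^sub>R axis i 1) has_derivative (\<lambda>h. h *\<^sub>R axis i 1)) (at s)"
    by (auto intro!: derivative_eq_intros)
  have "((\<lambda>s. f (y + s *\<^sub>R axis i 1)) has_derivative
      (\<lambda>h. frechet_derivative f (at (y + s *\<^sub>R axis i 1)) (h *\<^sub>R axis i 1))) (at s)"
    using diff_chain_at[OF 1] frechet_derivative_works assms by (auto simp: o_def)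
  thus ?thesis
    by (simp add: has_field_derivative_def pdiff_def linear_cmul[OF lin] mult.commute[of _ "frechet_derivative _ _ _"])
qed

section \<open>Iterated derivatives and test functions\<close>

lemma pdiffs_Nil [simp]: "pdiffs [] f = f"
  and pdiffs_Cons [simp]: "pdiffs (i # is) f = pdiff i (pdiffs is f)"
  by (simp_all add: pdiffs_def)

lemma test_function_iff:
  "test_function f \<longleftrightarrow> (\<forall>is y. pdiffs is f differentiable (at y)) \<and> bounded {y. f y \<noteq> 0}"
  by (simp add: test_function_def differentiable_on_def)

lemma test_function_differentiable: "test_function f \<Longrightarrow> f differentiable (at y)"
  unfolding test_function_iff by (metis pdiffs_Nil)

lemma pdiff_eq_0_off_support:
  assumes "y \<notin> closure {y. f y \<noteq> 0}" shows "pdiff i f y = 0"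
proof -
  have "((\<lambda>_. 0) has_derivative (\<lambda>_. 0)) (at y)" by simp
  hence "(f has_derivative (\<lambda>_. 0)) (at y)"
    by (rule has_derivative_transform_within_open[of _ _ _ _ "- closure {y. f y \<noteq> 0}"])
       (use assms closure_subset[of "{y. f y \<noteq> 0}"] in auto)
  thus ?thesis by (simp add: pdiff_eq)
qed

lemma test_function_pdiff: assumes "test_function f" shows "test_function (pdiff i f)"
proof -
  have "pdiffs is (pdiff i f) = pdiffs (is @ [i]) f" for "is"
    by (simp add: pdiffs_def)
  moreover have "bounded {y. pdiff i f y \<noteq> 0}"
  proof (rule bounded_subset)
    show "bounded (closure {y. f y \<noteq> 0})"
      using assms by (auto simp: test_function_iff)
    show "{y. pdiff i f y \<noteq> 0} \<subseteq> closure {y. f y \<noteq> 0}"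
      using pdiff_eq_0_off_support by blast
  qed
  ultimately show ?thesis using assms unfolding test_function_iff by simp
qed

lemma test_function_pdiffs: "test_function f \<Longrightarrow> test_function (pdiffs is f)"
  by (induction "is") (auto intro: test_function_pdiff)

lemma test_function_add: assumes "test_function f" "test_function g"
  shows "test_function (\<lambda>y. f y + g y)"
proof -
  have "pdiffs is (\<lambda>y. f y + g y) = (\<lambda>y. pdiffs is f y + pdiffs is g y)" for "is"
    using assms by (induction "is") (auto simp: pdiff_add test_function_differentiable test_function_pdiffs)
  moreover have "bounded {y. f y + g y \<noteq> 0}"
    by (rule bounded_subset[of "{y. f y \<noteq> 0} \<union> {y. g y \<noteq> 0}"]) (use assms in \<open>auto simp: test_function_iff\<close>)
  ultimately show ?thesis using assms unfolding test_function_iff by auto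
qed

lemma test_function_cmult: assumes "test_function f"
  shows "test_function (\<lambda>y. c * f y)"
proof -
  have "pdiffs is (\<lambda>y. c * f y) = (\<lambda>y. c * pdiffs is f y)" for "is"
    using assms by (induction "is") (auto simp: pdiff_cmult test_function_differentiable test_function_pdiffs)
  moreover have "bounded {y. c * f y \<noteq> 0}"
    by (rule bounded_subset[of "{y. f y \<noteq> 0}"]) (use assms in \<open>auto simp: test_function_iff\<close>)
  ultimately show ?thesis using assms unfolding test_function_iff by auto
qed

lemma test_function_diff: "test_function f \<Longrightarrow> test_function g \<Longrightarrow> test_function (\<lambda>y. f y - g y)"
  using test_function_add[of f "\<lambda>y. (-1) * g y"] test_function_cmult[of g "-1"] by simp

lemma pdiffs_shift: assumes "test_function f"
  shows "pdiffs is (\<lambda>y. f (y + c)) = (\<lambda>y. pdiffs is f (y + c))"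
  using assms by (induction "is") (auto simp: pdiff_shift test_function_differentiable test_function_pdiffs)

lemma test_function_shift: assumes "test_function f" shows "test_function (\<lambda>y. f (y + c))"
proof -
  have "{y. f (y + c) \<noteq> 0} = (\<lambda>y. - c + y) ` {y. f y \<noteq> 0}"
    by (auto simp: image_iff intro!: exI[of _ "_ + c"])
  hence "bounded {y. f (y + c) \<noteq> 0}"
    using assms by (simp only: bounded_translation test_function_iff)
  moreover have "(\<lambda>y. pdiffs is f (y + c)) differentiable (at y)" for "is" y
    using assms by (intro pdiff_shift) (simp add: test_function_iff)
  ultimately show ?thesis using pdiffs_shift[OF assms] by (simp add: test_function_iff)
qed

lemma test_function_continuous: "test_function f \<Longrightarrow> continuous_on UNIV f"
  by (simp add: continuous_on_eq_continuous_at differentiable_imp_continuous_within test_function_differentiable)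

lemma test_function_measurable [measurable_dest]: "test_function f \<Longrightarrow> f \<in> borel_measurable borel"
  by (intro borel_measurable_continuous_onI test_function_continuous)

section \<open>Integrals of functions with bounded support\<close>

lemma integrable_continuous_bounded_support:
  fixes f :: "real^3 \<Rightarrow> real"
  assumes "continuous_on UNIV f" "bounded {y. f y \<noteq> 0}"
  shows "integrable lborel f"
proof -
  have "integrable lborel (\<lambda>y. indicator (closure {y. f y \<noteq> 0}) y *\<^sub>R f y)"
    using assms by (intro borel_integrable_compact) (auto intro: continuous_on_subset)
  also have "(\<lambda>y. indicator (closure {y. f y \<noteq> 0}) y *\<^sub>R f y) = f"
    using closure_subset[of "{y. f y \<noteq> 0}"] by (intro ext) (auto simp: indicator_def)
  finally show ?thesis .
qed

lemma test_function_bounded: assumes "test_function f" obtains C where "\<And>y. \<bar>f y\<bar> \<le> C" "0 \<le> C"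
proof -
  let ?K = "closure {y. f y \<noteq> 0}"
  have "compact (f ` ?K)"
    using assms by (intro compact_continuous_image continuous_on_subset[OF test_function_continuous])
      (auto simp: test_function_iff)
  then obtain C where C: "\<And>y. y \<in> ?K \<Longrightarrow> \<bar>f y\<bar> \<le> C"
    using compact_imp_bounded bounded_iff[of "f ` ?K"] by auto
  have "\<bar>f y\<bar> \<le> max C 0" for y
    using C[of y] closure_subset[of "{y. f y \<noteq> 0}"] by (cases "f y = 0") (auto simp: subset_iff le_max_iff_disj)
  thus ?thesis using that[of "max C 0"] by auto
qed

lemma test_function_L2 [intro]: assumes "test_function f" shows "(\<lambda>y. complex_of_real (f y)) \<in> L2"
proof -
  have [measurable]: "f \<in> borel_measurable borel" using assms by (rule test_function_measurable)
  have "integrable lborel (\<lambda>y. (f y)\<^sup>2)"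
    using assms by (intro integrable_continuous_bounded_support continuous_intros test_function_continuous)
      (auto simp: test_function_iff)
  thus ?thesis by (simp add: L2_def)
qed

text \<open>Integrate \<open>F (y + axis i 1) - F y = (LINT s:{0..1}|lborel. pdiff i F (y + s *\<^sub>R axis i 1))\<close>
  over \<open>y\<close>: translation invariance makes the left side vanish and the inner integral
  independent of \<open>s\<close>.\<close>

lemma integral_pdiff_eq_0:
  assumes d: "\<And>y. F differentiable (at y)" and c: "continuous_on UNIV (pdiff i F)"
    and b: "bounded {y. F y \<noteq> 0}"
  shows "(LINT y|lborel. pdiff i F y) = 0"
proof -
  let ?e = "axis i 1 :: real^3"
  have cF: "continuous_on UNIV F"
    using d by (simp add: continuous_on_eq_continuous_at differentiable_imp_continuous_within)
  have "{y. pdiff i F y \<noteq> 0} \<subseteq> closure {y. F y \<noteq> 0}"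
    using pdiff_eq_0_off_support by blast
  hence b': "bounded {y. pdiff i F y \<noteq> 0}"
    by (rule bounded_subset[OF bounded_closure[OF b]])
  have iF: "integrable lborel F" and ip: "integrable lborel (pdiff i F)"
    by (intro integrable_continuous_bounded_support cF b c b')+
  have [measurable]: "F \<in> borel_measurable borel" "pdiff i F \<in> borel_measurable borel"
    using cF c by (auto intro: borel_measurable_continuous_onI)
  let ?g = "\<lambda>s y. indicator {0..1} s * pdiff i F (y + s *\<^sub>R ?e)"
  have ip': "integrable lborel (\<lambda>y. pdiff i F (y + s *\<^sub>R ?e))" for s
  proof (rule integrable_continuous_bounded_support)
    show "continuous_on UNIV (\<lambda>y. pdiff i F (y + s *\<^sub>R ?e))"
      by (rule continuous_on_compose2[OF c]) (auto intro!: continuous_intros)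
    have "{y. pdiff i F (y + s *\<^sub>R ?e) \<noteq> 0} = (\<lambda>y. - (s *\<^sub>R ?e) + y) ` {y. pdiff i F y \<noteq> 0}"
      by (auto simp: image_iff intro!: exI[of _ "_ + s *\<^sub>R ?e"])
    thus "bounded {y. pdiff i F (y + s *\<^sub>R ?e) \<noteq> 0}" using b' by (simp only: bounded_translation)
  qed
  have iF': "integrable lborel (\<lambda>y. F (y + ?e))"
  proof (rule integrable_continuous_bounded_support)
    show "continuous_on UNIV (\<lambda>y. F (y + ?e))"
      by (rule continuous_on_compose2[OF cF]) (auto intro!: continuous_intros)
    have "{y. F (y + ?e) \<noteq> 0} = (\<lambda>y. - ?e + y) ` {y. F y \<noteq> 0}"
      by (auto simp: image_iff intro!: exI[of _ "_ + ?e"])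
    thus "bounded {y. F (y + ?e) \<noteq> 0}" using b by (simp only: bounded_translation)
  qed
  have ftc: "(LINT s|lborel. ?g s y) = F (y + ?e) - F y" for y
  proof -
    have "(LINT s|lborel. indicator {0..1} s *\<^sub>R pdiff i F (y + s *\<^sub>R ?e)) = F (y + 1 *\<^sub>R ?e) - F (y + 0 *\<^sub>R ?e)"
    proof (rule integral_FTC_atLeastAtMost)
      show "continuous_on {0..1} (\<lambda>s. pdiff i F (y + s *\<^sub>R ?e))"
        by (rule continuous_on_compose2[OF c]) (auto intro!: continuous_intros)
      show "((\<lambda>s. F (y + s *\<^sub>R ?e)) has_vector_derivative pdiff i F (y + s *\<^sub>R ?e)) (at s within {0..1})" for s
        by (rule has_vector_derivative_at_within)
           (simp only: has_real_derivative_iff_has_vector_derivative[symmetric] DERIV_along_axis d)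
    qed auto
    thus ?thesis by simp
  qed
  have int: "integrable (lborel \<Otimes>\<^sub>M lborel) (case_prod ?g)"
  proof (rule lborel_pair.Fubini_integrable)
    have "(LINT y|lborel. norm (case_prod ?g (s, y))) = indicator {0..1} s * (LINT y|lborel. \<bar>pdiff i F y\<bar>)" for s
      using integral_lborel_shift[of "\<lambda>y. \<bar>pdiff i F y\<bar>" "s *\<^sub>R ?e"] by (simp add: abs_mult)
    thus "integrable lborel (\<lambda>s. LINT y|lborel. norm (case_prod ?g (s, y)))" by simp
    show "AE s in lborel. integrable lborel (\<lambda>y. case_prod ?g (s, y))"
      using ip' by (intro AE_I2) simp
  qed measurable
  have "0 = (LINT y|lborel. F (y + ?e) - F y)"
    using integral_lborel_shift[of F ?e] iF iF' by simp
  also have "\<dots> = (LINT y|lborel. (LINT s|lborel. ?g s y))"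
    by (simp only: ftc)
  also have "\<dots> = (LINT s|lborel. (LINT y|lborel. ?g s y))"
    by (rule lborel_pair.Fubini_integral[OF int])
  also have "\<dots> = (LINT s::real|lborel. indicator {0..1} s * (LINT y|lborel. pdiff i F y))"
    using integral_lborel_shift[of "pdiff i F"] by simp
  also have "\<dots> = (LINT y|lborel. pdiff i F y)" by simp
  finally show ?thesis by simp
qed

text \<open>The second difference of \<open>f\<close> over a square of side \<open>h\<close> is
  symmetric in the two directions. Applying the mean value theorem twice turns it into a mixed
  derivative at an intermediate point, in either order; then \<open>h\<close> tends to
  \<open>0\<close>.\<close>

lemma pdiff_commute:
  assumes f: "test_function f" shows "pdiff i (pdiff j f) = pdiff j (pdiff i f)"
proof (rule ext)
  fix y
  have key: "\<exists>s t. 0 < s \<and> s < h \<and> 0 < t \<and> t < h \<and>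
      f (y + h *\<^sub>R axis i 1 + h *\<^sub>R axis j 1) - f (y + h *\<^sub>R axis i 1) - f (y + h *\<^sub>R axis j 1) + f y
        = h * (h * pdiff j (pdiff i f) (y + s *\<^sub>R axis i 1 + t *\<^sub>R axis j 1))"
    if h: "0 < h" for h i j
  proof -
    define g where "g s = f ((y + h *\<^sub>R axis j 1) + s *\<^sub>R axis i 1) - f (y + s *\<^sub>R axis i 1)" for s
    have "\<exists>s. 0 < s \<and> s < h \<and> g h - g 0 = (h - 0) * (pdiff i f ((y + h *\<^sub>R axis j 1) + s *\<^sub>R axis i 1) - pdiff i f (y + s *\<^sub>R axis i 1))"
      unfolding g_def
      by (intro MVT2 h DERIV_diff DERIV_along_axis test_function_differentiable f)
    then obtain s where s: "0 < s" "s < h" and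
      1: "g h - g 0 = h * (pdiff i f ((y + h *\<^sub>R axis j 1) + s *\<^sub>R axis i 1) - pdiff i f (y + s *\<^sub>R axis i 1))" by auto
    have "\<exists>t. 0 < t \<and> t < h \<and> pdiff i f ((y + s *\<^sub>R axis i 1) + h *\<^sub>R axis j 1) - pdiff i f ((y + s *\<^sub>R axis i 1) + 0 *\<^sub>R axis j 1)
       = (h - 0) * pdiff j (pdiff i f) ((y + s *\<^sub>R axis i 1) + t *\<^sub>R axis j 1)"
      by (intro MVT2 h DERIV_along_axis test_function_differentiable test_function_pdiff f)
    then obtain t where t: "0 < t" "t < h" and
      2: "pdiff i f ((y + s *\<^sub>R axis i 1) + h *\<^sub>R axis j 1) - pdiff i f (y + s *\<^sub>R axis i 1)
       = h * pdiff j (pdiff i f) (y + s *\<^sub>R axis i 1 + t *\<^sub>R axis j 1)" by auto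
    have "f (y + h *\<^sub>R axis i 1 + h *\<^sub>R axis j 1) - f (y + h *\<^sub>R axis i 1) - f (y + h *\<^sub>R axis j 1) + f y = g h - g 0"
      by (simp add: g_def ac_simps)
    also have "\<dots> = h * (h * pdiff j (pdiff i f) (y + s *\<^sub>R axis i 1 + t *\<^sub>R axis j 1))"
      unfolding 1 2[symmetric] by (simp add: ac_simps)
    finally show ?thesis using s t by blast
  qed
  have "\<exists>s t s' t'. 0 < s \<and> s < h \<and> 0 < t \<and> t < h \<and> 0 < s' \<and> s' < h \<and> 0 < t' \<and> t' < h \<and>
     pdiff j (pdiff i f) (y + s *\<^sub>R axis i 1 + t *\<^sub>R axis j 1) = pdiff i (pdiff j f) (y + s' *\<^sub>R axis j 1 + t' *\<^sub>R axis i 1)"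
    if h: "0 < h" for h :: real
  proof -
    obtain s t where 1: "0 < s" "s < h" "0 < t" "t < h"
      "f (y + h *\<^sub>R axis i 1 + h *\<^sub>R axis j 1) - f (y + h *\<^sub>R axis i 1) - f (y + h *\<^sub>R axis j 1) + f y
        = h * (h * pdiff j (pdiff i f) (y + s *\<^sub>R axis i 1 + t *\<^sub>R axis j 1))" using key[OF h, of i j] by blast
    obtain s' t' where 2: "0 < s'" "s' < h" "0 < t'" "t' < h"
      "f (y + h *\<^sub>R axis j 1 + h *\<^sub>R axis i 1) - f (y + h *\<^sub>R axis j 1) - f (y + h *\<^sub>R axis i 1) + f y
        = h * (h * pdiff i (pdiff j f) (y + s' *\<^sub>R axis j 1 + t' *\<^sub>R axis i 1))" using key[OF h, of j i] by blast
    have "h * (h * pdiff j (pdiff i f) (y + s *\<^sub>R axis i 1 + t *\<^sub>R axis j 1)) =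
       h * (h * pdiff i (pdiff j f) (y + s' *\<^sub>R axis j 1 + t' *\<^sub>R axis i 1))"
      unfolding 1(5)[symmetric] 2(5)[symmetric] by (simp add: ac_simps)
    thus ?thesis using h 1(1-4) 2(1-4) by (metis mult_cancel_left less_irrefl)
  qed
  hence "\<exists>s t s' t'. 0 < s \<and> s < inverse (Suc n) \<and> 0 < t \<and> t < inverse (Suc n) \<and> 0 < s' \<and> s' < inverse (Suc n) \<and> 0 < t' \<and> t' < inverse (Suc n) \<and>
     pdiff j (pdiff i f) (y + s *\<^sub>R axis i 1 + t *\<^sub>R axis j 1) = pdiff i (pdiff j f) (y + s' *\<^sub>R axis j 1 + t' *\<^sub>R axis i 1)" for n
    by (simp del: of_nat_Suc)
  then obtain s t s' t' where st: "\<And>n. 0 < s n" "\<And>n. s n < inverse (Suc n)" "\<And>n. 0 < t n" "\<And>n. t n < inverse (Suc n)"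
    "\<And>n. 0 < s' n" "\<And>n. s' n < inverse (Suc n)" "\<And>n. 0 < t' n" "\<And>n. t' n < inverse (Suc n)" and
    eq: "\<And>n. pdiff j (pdiff i f) (y + s n *\<^sub>R axis i 1 + t n *\<^sub>R axis j 1) =
       pdiff i (pdiff j f) (y + s' n *\<^sub>R axis j 1 + t' n *\<^sub>R axis i 1)" by metis
  have lim: "u \<longlonglongrightarrow> 0" if "\<And>n. 0 < u n" "\<And>n. u n < inverse (Suc n)" for u :: "nat \<Rightarrow> real"
    by (rule tendsto_sandwich[OF _ _ tendsto_const LIMSEQ_inverse_real_of_nat])
       (use that in \<open>auto intro!: always_eventually less_imp_le\<close>)
  have c: "isCont (pdiff k (pdiff l f)) z" for k l z
    using f test_function_differentiable test_function_pdiff differentiable_imp_continuous_within by blast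
  have "(\<lambda>n. pdiff j (pdiff i f) (y + s n *\<^sub>R axis i 1 + t n *\<^sub>R axis j 1)) \<longlonglongrightarrow> pdiff j (pdiff i f) (y + 0 *\<^sub>R axis i 1 + 0 *\<^sub>R axis j 1)"
    by (intro isCont_tendsto_compose[OF c] tendsto_intros lim st)
  moreover have "(\<lambda>n. pdiff i (pdiff j f) (y + s' n *\<^sub>R axis j 1 + t' n *\<^sub>R axis i 1)) \<longlonglongrightarrow> pdiff i (pdiff j f) (y + 0 *\<^sub>R axis j 1 + 0 *\<^sub>R axis i 1)"
    by (intro isCont_tendsto_compose[OF c] tendsto_intros lim st)
  ultimately show "pdiff i (pdiff j f) y = pdiff j (pdiff i f) y"
    unfolding eq using LIMSEQ_unique by fastforce
qed

lemma integral_by_parts_pdiff: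
  assumes f: "test_function f" and g: "test_function g"
  shows "(LINT y|lborel. pdiff i f y * g y) = - (LINT y|lborel. f y * pdiff i g y)"
proof -
  note d = test_function_differentiable
  have c: "continuous_on UNIV f" "continuous_on UNIV g" "continuous_on UNIV (pdiff i f)" "continuous_on UNIV (pdiff i g)"
    using f g by (auto intro: test_function_continuous test_function_pdiff)
  have b: "bounded {y. f y \<noteq> 0}" using f by (simp add: test_function_iff)
  have p: "pdiff i (\<lambda>y. f y * g y) = (\<lambda>y. f y * pdiff i g y + pdiff i f y * g y)"
    using f g by (auto simp: pdiff_mult d)
  have "0 = (LINT y|lborel. pdiff i (\<lambda>y. f y * g y) y)"
  proof (rule integral_pdiff_eq_0[symmetric])
    show "(\<lambda>y. f y * g y) differentiable at y" for y
      using f g by (intro differentiable_mult d)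
    show "continuous_on UNIV (pdiff i (\<lambda>y. f y * g y))"
      unfolding p by (intro continuous_intros c)
    show "bounded {y. f y * g y \<noteq> 0}" by (rule bounded_subset[OF b]) auto
  qed
  also have "\<dots> = (LINT y|lborel. f y * pdiff i g y) + (LINT y|lborel. pdiff i f y * g y)"
    unfolding p
  proof (rule Bochner_Integration.integral_add)
    show "integrable lborel (\<lambda>y. f y * pdiff i g y)"
    proof (rule integrable_continuous_bounded_support)
      show "continuous_on UNIV (\<lambda>y. f y * pdiff i g y)" by (intro continuous_on_mult c)
      show "bounded {y. f y * pdiff i g y \<noteq> 0}" by (rule bounded_subset[OF b]) auto
    qed
    show "integrable lborel (\<lambda>y. pdiff i f y * g y)"
    proof (rule integrable_continuous_bounded_support)
      show "continuous_on UNIV (\<lambda>y. pdiff i f y * g y)" by (intro continuous_on_mult c)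
      have "bounded {y. g y \<noteq> 0}" using g by (simp add: test_function_iff)
      thus "bounded {y. pdiff i f y * g y \<noteq> 0}" by (rule bounded_subset) auto
    qed
  qed
  finally show ?thesis by simp
qed

section \<open>Density of test functions\<close>

text \<open>Polynomials in \<open>1 / t\<close> make the family closed under differentiation, see
  \<open>flat_DERIV\<close>, so smoothness at the origin to all orders rests on a single
  limit.\<close>

definition flat :: "real poly \<Rightarrow> real \<Rightarrow> real" where
  "flat p t = (if 0 < t then poly p (1 / t) * exp (- (1 / t)) else 0)"

lemma poly_div_exp_tendsto_0: "((\<lambda>x. poly p x / exp x) \<longlongrightarrow> (0::real)) at_top"
proof -
  have "((\<lambda>x. \<Sum>i\<le>degree p. coeff p i * (x ^ i / exp x)) \<longlongrightarrow> (\<Sum>i\<le>degree p. coeff p i * 0)) at_top"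
    by (intro tendsto_sum tendsto_mult tendsto_const tendsto_power_div_exp_0)
  thus ?thesis by (simp add: poly_altdef sum_divide_distrib)
qed

lemma flat_DERIV: "(flat p has_real_derivative flat ([:0, 0, 1:] * (p - pderiv p)) t) (at t)"
proof (cases t "0::real" rule: linorder_cases)
  case less
  have "((\<lambda>_. 0) has_real_derivative 0) (at t)" by simp
  hence "(flat p has_real_derivative 0) (at t)"
    by (rule DERIV_cong_ev[THEN iffD1, rotated -1])
       (use less eventually_nhds_in_open[of "{..<0}" t] in \<open>auto simp: flat_def elim!: eventually_mono\<close>)
  thus ?thesis using less by (simp add: flat_def)
next
  case greater
  have "((\<lambda>t. poly p (1 / t) * exp (- (1 / t))) has_real_derivative
      flat ([:0, 0, 1:] * (p - pderiv p)) t) (at t)"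
    using greater
    by (auto intro!: derivative_eq_intros DERIV_chain2[OF poly_DERIV] simp: flat_def field_simps power2_eq_square)
  thus ?thesis
    by (rule DERIV_cong_ev[THEN iffD1, rotated -1])
       (use greater eventually_nhds_in_open[of "{0<..}" t] in \<open>auto simp: flat_def elim!: eventually_mono\<close>)
next
  case equal
  have "((\<lambda>h. (flat p (0 + h) - flat p 0) / h) \<longlongrightarrow> 0) (at 0)"
  proof (rule filterlim_split_at)
    show "((\<lambda>h. (flat p (0 + h) - flat p 0) / h) \<longlongrightarrow> 0) (at_left 0)"
    proof (rule Lim_transform_eventually[OF tendsto_const])
      show "\<forall>\<^sub>F h in at_left 0. 0 = (flat p (0 + h) - flat p 0) / h"
        by (auto simp: eventually_at_filter flat_def)
    qed
    \<comment> \<open>\<open>pCons 0 p\<close> is the polynomial times its variable, which at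
      \<open>inverse h\<close> absorbs the division by \<open>h\<close> in the difference
      quotient.\<close>
    have "((\<lambda>h. poly (pCons 0 p) (inverse h) / exp (inverse h)) \<longlongrightarrow> 0) (at_right 0)"
      by (rule filterlim_compose[OF poly_div_exp_tendsto_0 filterlim_inverse_at_top_right])
    moreover have "\<forall>\<^sub>F h in at_right 0. poly (pCons 0 p) (inverse h) / exp (inverse h) = (flat p (0 + h) - flat p 0) / h"
      by (auto simp: eventually_at_filter flat_def exp_minus field_simps)
    ultimately show "((\<lambda>h. (flat p (0 + h) - flat p 0) / h) \<longlongrightarrow> 0) (at_right 0)"
      by (rule Lim_transform_eventually)
  qed
  thus ?thesis using equal by (simp add: DERIV_def flat_def)
qed

text \<open>An algebra stable under \<open>pdiff\<close>. Every iterated partial derivative stays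
  inside it, so smoothness follows by induction on the list of directions, without formulas for
  higher derivatives.\<close>

inductive_set flat_algebra :: "(real^3 \<Rightarrow> real) set" where
  coord: "(\<lambda>y. flat p (c * (y $ i) + d)) \<in> flat_algebra"
| const: "(\<lambda>_. c) \<in> flat_algebra"
| add: "f \<in> flat_algebra \<Longrightarrow> g \<in> flat_algebra \<Longrightarrow> (\<lambda>y. f y + g y) \<in> flat_algebra"
| mult: "f \<in> flat_algebra \<Longrightarrow> g \<in> flat_algebra \<Longrightarrow> (\<lambda>y. f y * g y) \<in> flat_algebra"

lemma flat_algebra_pdiff:
  assumes "f \<in> flat_algebra"
  shows "(\<forall>y. f differentiable (at y)) \<and> (\<forall>i. pdiff i f \<in> flat_algebra)"
  using assms
proof induction
  case (coord p c i d)
  let ?q = "[:0, 0, 1:] * (p - pderiv p)"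
  have d: "((\<lambda>y. flat p (c * (y $ i) + d)) has_derivative (\<lambda>h. flat ?q (c * (y $ i) + d) * (c * (h $ i)))) (at y)" for y
    by (rule has_derivative_compose[OF _ flat_DERIV[unfolded has_field_derivative_def]])
       (auto intro!: derivative_eq_intros bounded_linear.has_derivative[OF bounded_linear_vec_nth])
  have "pdiff j (\<lambda>y. flat p (c * (y $ i) + d)) = (\<lambda>y. flat ?q (c * (y $ i) + d) * (c * (axis j 1 $ i)))" for j
    by (rule ext) (rule pdiff_eq[OF d])
  thus ?case using d
    by (auto simp: differentiable_def intro!: flat_algebra.intros)
next
  case (const c)
  have "pdiff i (\<lambda>_. c) = (\<lambda>_. 0)" for i
    by (rule ext) (rule pdiff_eq, rule has_derivative_const)
  thus ?case by (auto intro: flat_algebra.intros)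
next
  case (add f g)
  hence "pdiff i (\<lambda>y. f y + g y) = (\<lambda>y. pdiff i f y + pdiff i g y)" for i
    by (intro ext pdiff_add) auto
  thus ?case using add by (auto intro!: flat_algebra.intros differentiable_add)
next
  case (mult f g)
  hence "pdiff i (\<lambda>y. f y * g y) = (\<lambda>y. f y * pdiff i g y + pdiff i f y * g y)" for i
    by (intro ext pdiff_mult) auto
  thus ?case using mult by (auto intro!: flat_algebra.intros differentiable_mult)
qed

lemma flat_algebra_prod: "(\<And>i. i \<in> I \<Longrightarrow> f i \<in> flat_algebra) \<Longrightarrow> (\<lambda>y. \<Prod>i\<in>I. f i y) \<in> flat_algebra"
  by (induction I rule: infinite_finite_induct) (auto intro: flat_algebra.intros)

lemma flat_algebra_test_function:
  assumes "f \<in> flat_algebra" "bounded {y. f y \<noteq> 0}" shows "test_function f"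
proof -
  have "pdiffs is f \<in> flat_algebra" for "is"
    by (induction "is") (use assms(1) flat_algebra_pdiff in auto)
  thus ?thesis using assms(2) flat_algebra_pdiff by (auto simp: test_function_iff)
qed

text \<open>For \<open>n > 0\<close> the support stays in the box, while inside the box each factor
  has the form \<open>exp (- 1 / (n * d))\<close> and tends to \<open>1\<close> as \<open>n\<close>
  grows. Indicators of boxes are thus reached without mollification.\<close>

definition box_bump :: "real \<Rightarrow> real^3 \<Rightarrow> real^3 \<Rightarrow> real^3 \<Rightarrow> real" where
  "box_bump n a b y = (\<Prod>i\<in>UNIV. flat 1 (n * (y $ i - a $ i)) * flat 1 (n * (b $ i - y $ i)))"

lemma flat_1_bounds: "0 \<le> flat 1 t" "flat 1 t \<le> 1"
  by (auto simp: flat_def)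

lemma box_bump_bounds: "0 \<le> box_bump n a b y" "box_bump n a b y \<le> 1"
  unfolding box_bump_def using flat_1_bounds
  by (auto intro!: prod_nonneg prod_le_1 mult_le_one)

lemma box_bump_outside: assumes "0 < n" "y \<notin> box a b" shows "box_bump n a b y = 0"
proof -
  from assms(2) obtain i where "y $ i \<le> a $ i \<or> b $ i \<le> y $ i"
    by (auto simp: mem_box_cart not_less)
  hence "flat 1 (n * (y $ i - a $ i)) * flat 1 (n * (b $ i - y $ i)) = 0"
    using assms(1) by (auto simp: flat_def zero_less_mult_iff)
  thus ?thesis unfolding box_bump_def by (intro prod_zero) auto
qed

lemma test_function_box_bump: assumes "0 < n" shows "test_function (box_bump n a b)"
proof (rule flat_algebra_test_function)
  have "(\<lambda>y. flat 1 (n * (y $ i) + (- n * a $ i)) * flat 1 (- n * (y $ i) + n * b $ i)) \<in> flat_algebra" for i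
    by (intro flat_algebra.intros)
  hence "(\<lambda>y. flat 1 (n * (y $ i - a $ i)) * flat 1 (n * (b $ i - y $ i))) \<in> flat_algebra" for i
    by (simp add: algebra_simps)
  thus "box_bump n a b \<in> flat_algebra"
    unfolding box_bump_def[abs_def] by (intro flat_algebra_prod)
  show "bounded {y. box_bump n a b y \<noteq> 0}"
    by (rule bounded_subset[OF bounded_box[of a b]]) (use box_bump_outside[OF assms] in blast)
qed

lemma flat_1_tendsto: "0 < t \<Longrightarrow> (\<lambda>k. flat 1 (real (Suc k) * t)) \<longlonglongrightarrow> 1"
proof -
  assume t: "0 < t"
  have "(\<lambda>k. exp (- (1 / t * inverse (real (Suc k))))) \<longlonglongrightarrow> exp (- (1 / t * 0))"
    by (intro tendsto_intros LIMSEQ_inverse_real_of_nat)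
  moreover have "flat 1 (real (Suc k) * t) = exp (- (1 / t * inverse (real (Suc k))))" for k
    using t by (simp add: flat_def divide_inverse mult.commute del: of_nat_Suc)
  ultimately show ?thesis by simp
qed

lemma box_bump_tendsto: "(\<lambda>k. box_bump (real (Suc k)) a b y) \<longlonglongrightarrow> indicator (box a b) y"
proof (cases "y \<in> box a b")
  case True
  have "(\<lambda>k. box_bump (real (Suc k)) a b y) \<longlonglongrightarrow> (\<Prod>i\<in>(UNIV::3 set). 1 * 1)"
    unfolding box_bump_def
    by (intro tendsto_prod tendsto_mult flat_1_tendsto) (use True in \<open>auto simp: mem_box_cart\<close>)
  thus ?thesis using True by simp
next
  case False
  hence "box_bump (real (Suc k)) a b y = 0" for k by (intro box_bump_outside) auto
  thus ?thesis using False by (simp del: of_nat_Suc)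
qed

section \<open>Approximation by test functions\<close>

definition test_approximable :: "fn3 \<Rightarrow> bool" where
  "test_approximable f \<longleftrightarrow> f \<in> L2 \<and> (\<forall>e>0. \<exists>\<alpha> \<beta>. test_function \<alpha> \<and> test_function \<beta> \<and>
     L2_sq (\<lambda>y. f y - Complex (\<alpha> y) (\<beta> y)) < e)"

lemma Complex_test_L2 [intro]:
  assumes "test_function \<alpha>" "test_function \<beta>" shows "(\<lambda>y. Complex (\<alpha> y) (\<beta> y)) \<in> L2"
  using L2_add[OF test_function_L2[OF assms(1)] L2_scale[OF test_function_L2[OF assms(2)], of \<i>]]
  by (simp add: Complex_eq)

lemma L2_sq_limit_le: assumes "f \<in> L2" "g \<in> L2" "h \<in> L2"
  shows "L2_sq (\<lambda>y. f y - h y) \<le> 2 * L2_sq (\<lambda>y. f y - g y) + 2 * L2_sq (\<lambda>y. g y - h y)"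
  using L2_sq_add_le[OF L2_diff[OF assms(1,2)] L2_diff[OF assms(2,3)]] by simp

lemma test_approximable_limit:
  assumes "\<And>n. test_approximable (f n)" "g \<in> L2" "(\<lambda>n. L2_sq (\<lambda>y. f n y - g y)) \<longlonglongrightarrow> 0"
  shows "test_approximable g"
  unfolding test_approximable_def
proof (intro conjI allI impI assms(2))
  fix e :: real assume e: "0 < e"
  have "\<forall>\<^sub>F n in sequentially. L2_sq (\<lambda>y. f n y - g y) < e / 4"
    using order_tendstoD(2)[OF assms(3), of "e / 4"] e by simp
  then obtain n where n: "L2_sq (\<lambda>y. f n y - g y) < e / 4"
    using eventually_happens by fastforce
  obtain \<alpha> \<beta> where ab: "test_function \<alpha>" "test_function \<beta>" "L2_sq (\<lambda>y. f n y - Complex (\<alpha> y) (\<beta> y)) < e / 4"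
    using assms(1)[of n] e unfolding test_approximable_def by (meson zero_less_divide_iff zero_less_numeral)
  have "L2_sq (\<lambda>y. g y - Complex (\<alpha> y) (\<beta> y)) \<le> 2 * L2_sq (\<lambda>y. g y - f n y) + 2 * L2_sq (\<lambda>y. f n y - Complex (\<alpha> y) (\<beta> y))"
    using assms(1,2) ab by (intro L2_sq_limit_le) (auto simp: test_approximable_def)
  also have "\<dots> < e" using n ab(3) L2_sq_minus_commute[of g "f n"] by simp
  finally show "\<exists>\<alpha> \<beta>. test_function \<alpha> \<and> test_function \<beta> \<and> L2_sq (\<lambda>y. g y - Complex (\<alpha> y) (\<beta> y)) < e"
    using ab by blast
qed

lemma test_approximable_test:
  assumes "test_function \<alpha>" "test_function \<beta>" shows "test_approximable (\<lambda>y. Complex (\<alpha> y) (\<beta> y))"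
  unfolding test_approximable_def
proof (intro conjI allI impI exI)
  show "L2_sq (\<lambda>y. Complex (\<alpha> y) (\<beta> y) - Complex (\<alpha> y) (\<beta> y)) < e" if "0 < e" for e
    using that by simp
qed (use assms in auto)

lemma test_approximable_add:
  assumes "test_approximable f" "test_approximable g"
  shows "test_approximable (\<lambda>y. f y + g y)"
  unfolding test_approximable_def
proof (intro conjI allI impI)
  show "(\<lambda>y. f y + g y) \<in> L2" using assms by (auto simp: test_approximable_def)
  fix e :: real assume e: "0 < e"
  obtain \<alpha> \<beta> where 1: "test_function \<alpha>" "test_function \<beta>" "L2_sq (\<lambda>y. f y - Complex (\<alpha> y) (\<beta> y)) < e / 4"
    using assms(1) e unfolding test_approximable_def by (meson zero_less_divide_iff zero_less_numeral)
  obtain \<alpha>' \<beta>' where 2: "test_function \<alpha>'" "test_function \<beta>'" "L2_sq (\<lambda>y. g y - Complex (\<alpha>' y) (\<beta>' y)) < e / 4"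
    using assms(2) e unfolding test_approximable_def by (meson zero_less_divide_iff zero_less_numeral)
  have "(\<lambda>y. f y + g y - Complex (\<alpha> y + \<alpha>' y) (\<beta> y + \<beta>' y)) =
     (\<lambda>y. (f y - Complex (\<alpha> y) (\<beta> y)) + (g y - Complex (\<alpha>' y) (\<beta>' y)))"
    by (auto simp: complex_eq_iff)
  hence "L2_sq (\<lambda>y. f y + g y - Complex (\<alpha> y + \<alpha>' y) (\<beta> y + \<beta>' y)) \<le>
     2 * L2_sq (\<lambda>y. f y - Complex (\<alpha> y) (\<beta> y)) + 2 * L2_sq (\<lambda>y. g y - Complex (\<alpha>' y) (\<beta>' y))"
    using assms 1 2 L2_sq_add_le[OF L2_diff[of f "\<lambda>y. Complex (\<alpha> y) (\<beta> y)"] L2_diff[of g "\<lambda>y. Complex (\<alpha>' y) (\<beta>' y)"]]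
    by (auto simp: test_approximable_def)
  also have "\<dots> < e" using 1(3) 2(3) by simp
  finally show "\<exists>\<alpha> \<beta>. test_function \<alpha> \<and> test_function \<beta> \<and> L2_sq (\<lambda>y. f y + g y - Complex (\<alpha> y) (\<beta> y)) < e"
    using test_function_add[OF 1(1) 2(1)] test_function_add[OF 1(2) 2(2)] by blast
qed

lemma test_approximable_scale:
  assumes "test_approximable f"
  shows "test_approximable (\<lambda>y. c * f y)"
  unfolding test_approximable_def
proof (intro conjI allI impI)
  show "(\<lambda>y. c * f y) \<in> L2" using assms by (auto simp: test_approximable_def)
  fix e :: real assume e: "0 < e"
  \<comment> \<open>The summand \<open>1\<close> keeps the quotient meaningful for
    \<open>c = 0\<close> and makes the final inequality strict.\<close>
  define d where "d = e / ((norm c)\<^sup>2 + 1)"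
  have p: "0 < (norm c)\<^sup>2 + 1" by (simp add: add_nonneg_pos)
  hence d: "0 < d" using e by (simp add: d_def)
  obtain \<alpha> \<beta> where 1: "test_function \<alpha>" "test_function \<beta>" "L2_sq (\<lambda>y. f y - Complex (\<alpha> y) (\<beta> y)) < d"
    using assms d unfolding test_approximable_def by blast
  let ?a = "\<lambda>y. Re c * \<alpha> y - Im c * \<beta> y" and ?b = "\<lambda>y. Re c * \<beta> y + Im c * \<alpha> y"
  have "(\<lambda>y. c * f y - Complex (?a y) (?b y)) = (\<lambda>y. c * (f y - Complex (\<alpha> y) (\<beta> y)))"
    by (auto simp: complex_eq_iff algebra_simps)
  hence "L2_sq (\<lambda>y. c * f y - Complex (?a y) (?b y)) = (norm c)\<^sup>2 * L2_sq (\<lambda>y. f y - Complex (\<alpha> y) (\<beta> y))"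
    by (simp only: L2_sq_scale)
  also have "\<dots> \<le> (norm c)\<^sup>2 * d" using 1(3) by (intro mult_left_mono) auto
  also have "\<dots> < ((norm c)\<^sup>2 + 1) * d" using d by (simp add: algebra_simps)
  also have "\<dots> = e" using p by (simp add: d_def)
  finally show "\<exists>\<alpha> \<beta>. test_function \<alpha> \<and> test_function \<beta> \<and> L2_sq (\<lambda>y. c * f y - Complex (\<alpha> y) (\<beta> y)) < e"
    using test_function_diff[OF test_function_cmult[OF 1(1)] test_function_cmult[OF 1(2)], of "Re c" "Im c"]
      test_function_add[OF test_function_cmult[OF 1(2)] test_function_cmult[OF 1(1)], of "Re c" "Im c"] by blast
qed

lemma test_function_zero: "test_function (\<lambda>_. 0)"
  using test_function_cmult[OF test_function_box_bump[of 1 0 0], of 0] by simp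

lemma test_approximable_zero: "test_approximable (\<lambda>_. 0)"
  using test_approximable_test[OF test_function_zero test_function_zero] by (simp add: Complex_eq)

lemma test_approximable_sum:
  "(\<And>i. i \<in> I \<Longrightarrow> test_approximable (f i)) \<Longrightarrow> test_approximable (\<lambda>y. \<Sum>i\<in>I. f i y)"
  by (induction I rule: infinite_finite_induct) (auto intro: test_approximable_zero test_approximable_add)

lemma indicator_L2: assumes "A \<in> sets borel" "A \<subseteq> box a b" shows "(indicator A :: fn3) \<in> L2"
proof -
  have "integrable lborel (indicator A :: real^3 \<Rightarrow> real)"
    using assms emeasure_mono[OF assms(2), of lborel] emeasure_lborel_box_finite[of a b]
    by (intro integrable_real_indicator) (auto intro: le_less_trans)
  moreover have "(\<lambda>y. (norm (indicator A y :: complex))\<^sup>2) = (indicator A :: real^3 \<Rightarrow> real)"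
    by (auto simp: indicator_def)
  ultimately show ?thesis using assms(1) by (simp add: L2_def)
qed

lemma test_approximable_box: "test_approximable (indicator (box a b))"
proof (rule test_approximable_limit)
  let ?f = "\<lambda>k y. Complex (box_bump (real (Suc k)) a b y) 0"
  note tf = test_function_box_bump[of "real (Suc k)" a b for k, OF of_nat_0_less_iff[THEN iffD2, OF zero_less_Suc]]
  show "test_approximable (?f k)" for k
    by (intro test_approximable_test tf test_function_zero)
  show F: "(indicator (box a b) :: fn3) \<in> L2" by (rule indicator_L2) auto
  show "(\<lambda>k. L2_sq (\<lambda>y. ?f k y - indicator (box a b) y)) \<longlonglongrightarrow> 0"
  proof (rule L2_dominated_convergence[OF _ F])
    show "?f k \<in> borel_measurable borel" for k
      by (intro L2_measurable Complex_test_L2 tf test_function_zero)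
    show "norm (?f k y) \<le> norm (indicator (box a b) y :: complex)" for k y
    proof (cases "y \<in> box a b")
      case True thus ?thesis using box_bump_bounds[of "real (Suc k)" a b y] by (simp add: Complex_eq del: of_nat_Suc)
    next
      case False
      hence "box_bump (real (Suc k)) a b y = 0" by (intro box_bump_outside) auto
      thus ?thesis by (simp add: Complex_eq del: of_nat_Suc)
    qed
    show "(\<lambda>k. ?f k y) \<longlonglongrightarrow> indicator (box a b) y" for y
      using tendsto_of_real[OF box_bump_tendsto[of a b y], where 'a=complex]
      by (cases "y \<in> box a b") (simp_all add: Complex_eq del: of_nat_Suc)
    show "(indicator (box a b) :: fn3) \<in> borel_measurable borel" by simp
  qed
qed

text \<open>Dynkin's theorem with the boxes as generator. The intersection with a fixed box keeps
  every indicator square-integrable and lets complements be taken relative to that box.\<close>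

lemma test_approximable_indicator:
  assumes "A \<in> sets borel"
  shows "test_approximable (indicator (A \<inter> box a b))"
proof -
  let ?G = "range (\<lambda>(a, b). box a b :: (real^3) set)"
  have G: "sets borel = sigma_sets UNIV ?G" by (simp add: borel_eq_box)
  have I: "box c d \<inter> box c' d' = box (\<chi> i. max (c $ i) (c' $ i)) (\<chi> i. min (d $ i) (d' $ i))" for c d c' d' :: "real^3"
    by (auto simp: mem_box_cart)
  have "Int_stable ?G"
    by (rule Int_stableI) (force simp: I)
  moreover have "?G \<subseteq> Pow UNIV" by simp
  moreover have "A \<in> sigma_sets UNIV ?G" using assms G by simp
  ultimately show ?thesis
  proof (induction rule: sigma_sets_induct_disjoint)
    case (basic A)
    thus ?case by (auto simp: I test_approximable_box)
  next
    case empty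
    have "(indicator ({} \<inter> box a b) :: fn3) = (\<lambda>_. 0)" by auto
    thus ?case using test_approximable_zero by metis
  next
    case (compl A)
    have "(indicator ((UNIV - A) \<inter> box a b) :: fn3) = (\<lambda>y. indicator (box a b) y + (-1) * indicator (A \<inter> box a b) y)"
      by (auto simp: indicator_def)
    thus ?case
      using compl test_approximable_add[OF test_approximable_box test_approximable_scale] by metis
  next
    case (union A)
    have A: "A i \<in> sets borel" for i using union(2) G by auto
    show ?case
    proof (rule test_approximable_limit)
      let ?f = "\<lambda>n y. \<Sum>i<n. indicator (A i \<inter> box a b) y :: complex"
      show "test_approximable (?f n)" for n
        by (intro test_approximable_sum union.IH)
      have fe: "?f n y = indicator ((\<Union>i<n. A i) \<inter> box a b) y" for n y
      proof -
        have "indicator (\<Union>i<n. A i \<inter> box a b) y = ?f n y"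
          by (rule indicator_UN_disjoint) (use union(1) in \<open>auto simp: disjoint_family_on_def\<close>)
        thus ?thesis by simp
      qed
      have B: "(indicator (box a b) :: fn3) \<in> L2" by (rule indicator_L2) auto
      show "(indicator (\<Union> (range A) \<inter> box a b) :: fn3) \<in> L2"
        using A by (intro indicator_L2) auto
      show "(\<lambda>n. L2_sq (\<lambda>y. ?f n y - indicator (\<Union> (range A) \<inter> box a b) y)) \<longlonglongrightarrow> 0"
        unfolding fe
      proof (rule L2_dominated_convergence[OF _ B])
        show "(indicator ((\<Union>i<n. A i) \<inter> box a b) :: fn3) \<in> borel_measurable borel" for n
          using A by auto
        show "norm (indicator ((\<Union>i<n. A i) \<inter> box a b) y :: complex) \<le> norm (indicator (box a b) y :: complex)" for n y
          by (auto simp: indicator_def)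
        show "(\<lambda>n. indicator ((\<Union>i<n. A i) \<inter> box a b) y :: complex) \<longlonglongrightarrow> indicator (\<Union> (range A) \<inter> box a b) y" for y
        proof -
          have "(\<lambda>n. indicator (\<Union>i<n. A i \<inter> box a b) y :: complex) \<longlonglongrightarrow> indicator (\<Union>i. A i \<inter> box a b) y"
            by (rule LIMSEQ_indicator_UN)
          thus ?thesis by simp
        qed
        show "(indicator (\<Union> (range A) \<inter> box a b) :: fn3) \<in> borel_measurable borel"
          using A by auto
      qed
    qed
  qed
qed

lemma test_approximable_L2: assumes f: "f \<in> L2" shows "test_approximable f"
proof -
  have [measurable]: "f \<in> borel_measurable borel" using f by (rule L2_measurable)
  obtain s where s: "\<And>i. simple_function lborel (s i)" "\<And>y. (\<lambda>i. s i y) \<longlonglongrightarrow> f y"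
    "\<And>i y. dist (s i y) 0 \<le> 2 * dist (f y) 0"
    using borel_measurable_implies_sequence_metric[of f lborel 0] by (auto simp: space_borel)
  have sm [measurable]: "s i \<in> borel_measurable borel" for i
    using borel_measurable_simple_function[OF s(1)[of i]] by simp
  define B where "B n = (box (\<chi> i. - real n) (\<chi> i. real n) :: (real^3) set)" for n
  have B: "\<forall>\<^sub>F n in sequentially. y \<in> B n" for y
  proof -
    obtain N :: nat where N: "norm y < real N" using reals_Archimedean2 by blast
    have "y \<in> B n" if "N \<le> n" for n
    proof -
      have "\<bar>y $ i\<bar> < real n" for i
        using component_le_norm_cart[of y i] N that by linarith
      hence "- real n < y $ i \<and> y $ i < real n" for i
        by (simp add: abs_less_iff minus_less_iff)
      thus ?thesis unfolding B_def mem_box_cart by simp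
    qed
    thus ?thesis by (auto simp: eventually_sequentially)
  qed
  \<comment> \<open>The truncation brings the level sets of the simple functions into the form of
    \<open>test_approximable_indicator\<close>; every point lies in \<open>B n\<close> eventually,
    so the pointwise limit is unchanged.\<close>
  define g where "g n y = indicator (B n) y * s n y" for n y
  show ?thesis
  proof (rule test_approximable_limit[OF _ f])
    show "test_approximable (g n)" for n
    proof -
      have fin: "finite (range (s n))" using simple_functionD(1)[OF s(1)[of n]] by simp
      have "g n = (\<lambda>y. \<Sum>c\<in>range (s n). c * indicator (s n -` {c} \<inter> B n) y)"
      proof (rule ext)
        fix y
        have "(\<Sum>c\<in>range (s n). c * indicator (s n -` {c} \<inter> B n) y) =
          (\<Sum>c\<in>range (s n). if c = s n y then s n y * indicator (B n) y else 0)"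
          by (intro sum.cong) (auto simp: indicator_def)
        thus "g n y = (\<Sum>c\<in>range (s n). c * indicator (s n -` {c} \<inter> B n) y)"
          using fin by (simp add: g_def)
      qed
      moreover have "s n -` {c} \<in> sets borel" for c
        using measurable_sets[OF sm[of n], of "{c}"] by simp
      ultimately show ?thesis
        by (auto simp: B_def intro!: test_approximable_sum test_approximable_scale test_approximable_indicator)
    qed
    show "(\<lambda>n. L2_sq (\<lambda>y. g n y - f y)) \<longlonglongrightarrow> 0"
    proof (rule L2_dominated_convergence[OF _ L2_scale[OF f, of 2]])
      show "g n \<in> borel_measurable borel" for n
        unfolding g_def[abs_def] B_def by measurable
      show "norm (g n y) \<le> norm (2 * f y)" for n y
        using s(3)[of n y] by (auto simp: g_def indicator_def norm_mult)
      show "(\<lambda>n. g n y) \<longlonglongrightarrow> f y" for y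
        by (rule Lim_transform_eventually[OF s(2)]) (use B[of y] in \<open>auto elim!: eventually_mono simp: g_def\<close>)
    qed measurable
  qed
qed

lemma test_functions_dense:
  assumes "f \<in> L2"
  obtains \<alpha> \<beta> where "\<And>n::nat. test_function (\<alpha> n)" "\<And>n. test_function (\<beta> n)"
    "(\<lambda>n. L2_sq (\<lambda>y. Complex (\<alpha> n y) (\<beta> n y) - f y)) \<longlonglongrightarrow> 0"
proof -
  have "\<exists>\<alpha> \<beta>. test_function \<alpha> \<and> test_function \<beta> \<and> L2_sq (\<lambda>y. f y - Complex (\<alpha> y) (\<beta> y)) < inverse (Suc n)" for n :: nat
    using test_approximable_L2[OF assms] unfolding test_approximable_def by simp
  then obtain \<alpha> \<beta> where 1: "\<And>n. test_function (\<alpha> n)" "\<And>n. test_function (\<beta> n)"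
    "\<And>n::nat. L2_sq (\<lambda>y. f y - Complex (\<alpha> n y) (\<beta> n y)) < inverse (Suc n)" by metis
  have "(\<lambda>n. L2_sq (\<lambda>y. f y - Complex (\<alpha> n y) (\<beta> n y))) \<longlonglongrightarrow> 0"
    by (rule tendsto_sandwich[OF _ _ tendsto_const LIMSEQ_inverse_real_of_nat])
       (use 1(3) in \<open>auto intro!: always_eventually less_imp_le\<close>)
  thus ?thesis using that[of \<alpha> \<beta>] 1(1,2) by (simp only: L2_sq_minus_commute[of f])
qed

text \<open>Test functions converging to \<open>cnj w\<close> turn the hypothesis into the vanishing
  of the integral of \<open>cnj w * w\<close>.\<close>

lemma test_functions_separate:
  assumes w: "w \<in> L2" and z: "\<And>\<phi>. test_function \<phi> \<Longrightarrow> (LINT y|lborel. w y * of_real (\<phi> y)) = 0"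
  shows "ae_eq w (\<lambda>_. 0)"
proof -
  obtain \<alpha> \<beta> where ab: "\<And>n::nat. test_function (\<alpha> n)" "\<And>n. test_function (\<beta> n)"
    "(\<lambda>n. L2_sq (\<lambda>y. Complex (\<alpha> n y) (\<beta> n y) - cnj (w y))) \<longlonglongrightarrow> 0"
    using test_functions_dense[OF L2_cnj[OF w]] by blast
  have "(\<lambda>n. LINT y|lborel. Complex (\<alpha> n y) (\<beta> n y) * w y) \<longlonglongrightarrow> (LINT y|lborel. cnj (w y) * w y)"
    using ab w by (intro L2_tendsto_integral) auto
  moreover have "(LINT y|lborel. Complex (\<alpha> n y) (\<beta> n y) * w y) = 0" for n
  proof -
    have "(LINT y|lborel. Complex (\<alpha> n y) (\<beta> n y) * w y) =
       (LINT y|lborel. w y * of_real (\<alpha> n y) + \<i> * (w y * of_real (\<beta> n y)))"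
      by (intro Bochner_Integration.integral_cong) (simp_all add: Complex_eq algebra_simps)
    also have "\<dots> = 0"
      using w ab z by (simp add: L2_mult_integrable test_function_L2)
    finally show ?thesis .
  qed
  ultimately have "(LINT y|lborel. cnj (w y) * w y) = 0"
    by (simp add: LIMSEQ_const_iff)
  moreover have "(LINT y|lborel. cnj (w y) * w y) = of_real (L2_sq w)"
    unfolding L2_sq_def integral_complex_of_real[symmetric]
    by (intro Bochner_Integration.integral_cong) (simp_all only: complex_norm_square mult.commute refl)
  ultimately have "L2_sq w = 0" by simp
  thus ?thesis by (rule L2_sq_eq_0D[OF w])
qed

section \<open>The fundamental solution\<close>

definition laplacian :: "(real^3 \<Rightarrow> real) \<Rightarrow> real^3 \<Rightarrow> real" where
  "laplacian f y = (\<Sum>i\<in>UNIV. pdiff i (pdiff i f) y)"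

definition exp_weight :: "real \<Rightarrow> real" where
  "exp_weight t = indicator {0<..} t * exp (- t)"

lemma exp_weight_measurable [measurable]: "exp_weight \<in> borel_measurable borel"
  unfolding exp_weight_def[abs_def] by measurable

lemma exp_weight_nonneg [simp]: "0 \<le> exp_weight t"
  by (simp add: exp_weight_def)

lemma exp_weight_nonpos [simp]: "t \<le> 0 \<Longrightarrow> exp_weight t = 0"
  and exp_weight_pos: "0 < t \<Longrightarrow> exp_weight t = exp (- t)"
  by (auto simp: exp_weight_def)

section \<open>Gaussian displacements at an exponential time\<close>

abbreviation path_weight :: "real \<times> (real^3) \<Rightarrow> real" where
  "path_weight w \<equiv> exp_weight (fst w) * heat 1 (snd w)"

text \<open>The contribution of coordinate \<open>i\<close> to the time derivative in
  \<open>has_real_derivative_along_sqrt\<close>.\<close>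

abbreviation drift :: "3 \<Rightarrow> (real^3 \<Rightarrow> real) \<Rightarrow> real^3 \<Rightarrow> real \<Rightarrow> real^3 \<Rightarrow> real" where
  "drift i f p t z \<equiv> z $ i * pdiff i f (p + sqrt t *\<^sub>R z) / (2 * sqrt t)"

abbreviation path_measure :: "(real \<times> (real^3)) measure" where
  "path_measure \<equiv> lborel \<Otimes>\<^sub>M lborel"

text \<open>After rescaling, time enters only through the argument of \<open>f\<close>. Time
  derivatives then fall on a smooth function and not on the kernel, which degenerates at
  \<open>t = 0\<close>.\<close>

lemma nn_integral_heat_scaling:
  assumes t: "0 < t" and [measurable]: "f \<in> borel_measurable borel"
  shows "(\<integral>\<^sup>+ y. ennreal (heat t y) * f y \<partial>lborel) = (\<integral>\<^sup>+ z. ennreal (heat 1 z) * f (sqrt t *\<^sub>R z) \<partial>lborel)"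
proof -
  have h: "heat t (sqrt t *\<^sub>R z) * sqrt t ^ 3 = heat 1 z" for z :: "real^3"
    using t by (simp add: heat_def power_mult_distrib real_sqrt_mult)
  have "(\<integral>\<^sup>+ y. ennreal (heat t y) * f y \<partial>lborel) =
    (\<integral>\<^sup>+ y. ennreal (heat t y) * f y \<partial>density (distr lborel borel (\<lambda>x. 0 + sqrt t *\<^sub>R x)) (\<lambda>_. \<bar>sqrt t\<bar> ^ DIM(real^3)))"
    using t by (subst lborel_affine[of "sqrt t" "0::real^3"]) auto
  also have "\<dots> = (\<integral>\<^sup>+ z. ennreal (sqrt t ^ 3) * (ennreal (heat t (sqrt t *\<^sub>R z)) * f (sqrt t *\<^sub>R z)) \<partial>lborel)"
    using t by (simp add: nn_integral_density nn_integral_distr)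
  also have "\<dots> = (\<integral>\<^sup>+ z. ennreal (heat 1 z) * f (sqrt t *\<^sub>R z) \<partial>lborel)"
  proof (intro nn_integral_cong)
    fix z :: "real^3"
    have "ennreal (heat 1 z) = ennreal (sqrt t ^ 3) * ennreal (heat t (sqrt t *\<^sub>R z))"
      unfolding h[symmetric] using t by (simp add: ennreal_mult mult.commute)
    thus "ennreal (sqrt t ^ 3) * (ennreal (heat t (sqrt t *\<^sub>R z)) * f (sqrt t *\<^sub>R z)) = ennreal (heat 1 z) * f (sqrt t *\<^sub>R z)"
      by (simp only: mult.assoc)
  qed
  finally show ?thesis .
qed

text \<open>Subordination: the Yukawa potential is the density of \<open>sqrt t\<close> times a Gaussian vector, where
  \<open>t\<close> is an independent exponential time.\<close>

lemma density_yukawa_eq_distr: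
  "density lborel (\<lambda>y. ennreal (yukawa y)) =
    distr (density (lborel \<Otimes>\<^sub>M lborel) (\<lambda>w. ennreal (path_weight w))) borel (\<lambda>w. sqrt (fst w) *\<^sub>R snd w)"
  (is "?L = distr ?M borel ?X")
proof (rule measure_eqI)
  have X: "?X \<in> measurable ?M borel"
    by measurable
  fix A assume "A \<in> sets ?L"
  hence [measurable]: "A \<in> sets borel" by simp
  have "emeasure ?L A = (\<integral>\<^sup>+ y. ennreal (yukawa y) * indicator A y \<partial>lborel)"
    by (simp add: emeasure_density)
  also have "\<dots> = (\<integral>\<^sup>+ t. (\<integral>\<^sup>+ y. ennreal (exp (- t) * heat t y) * indicator A y \<partial>lborel) * indicator {0<..} t \<partial>lborel)"
    by (rule nn_integral_yukawa_eq) measurable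
  also have "\<dots> = (\<integral>\<^sup>+ t. (\<integral>\<^sup>+ z. ennreal (exp_weight t * heat 1 z) * indicator A (sqrt t *\<^sub>R z) \<partial>lborel) \<partial>lborel)"
  proof (intro nn_integral_cong)
    fix t :: real
    show "(\<integral>\<^sup>+ y. ennreal (exp (- t) * heat t y) * indicator A y \<partial>lborel) * indicator {0<..} t =
      (\<integral>\<^sup>+ z. ennreal (exp_weight t * heat 1 z) * indicator A (sqrt t *\<^sub>R z) \<partial>lborel)"
    proof (cases "0 < t")
      case True
      have "(\<integral>\<^sup>+ y. ennreal (exp (- t) * heat t y) * indicator A y \<partial>lborel) =
         ennreal (exp (- t)) * (\<integral>\<^sup>+ y. ennreal (heat t y) * indicator A y \<partial>lborel)"
        using True by (simp add: ennreal_mult mult.assoc nn_integral_cmult)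
      also have "\<dots> = ennreal (exp (- t)) * (\<integral>\<^sup>+ z. ennreal (heat 1 z) * indicator A (sqrt t *\<^sub>R z) \<partial>lborel)"
        by (subst nn_integral_heat_scaling[OF True]) auto
      also have "\<dots> = (\<integral>\<^sup>+ z. ennreal (exp_weight t * heat 1 z) * indicator A (sqrt t *\<^sub>R z) \<partial>lborel)"
        using True by (simp add: exp_weight_pos ennreal_mult mult.assoc nn_integral_cmult)
      finally show ?thesis using True by simp
    qed (simp add: exp_weight_def)
  qed
  also have "\<dots> = (\<integral>\<^sup>+ w. ennreal (path_weight w) * indicator A (?X w) \<partial>(lborel \<Otimes>\<^sub>M lborel))"
    by (subst lborel.nn_integral_fst[symmetric]) simp_all
  also have "\<dots> = (\<integral>\<^sup>+ w. indicator A (?X w) \<partial>?M)"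
    by (simp add: nn_integral_density)
  also have "\<dots> = (\<integral>\<^sup>+ w. indicator (?X -` A \<inter> space ?M) w \<partial>?M)"
    by (intro nn_integral_cong) (auto simp: indicator_def)
  also have "\<dots> = emeasure (distr ?M borel ?X) A"
    using measurable_sets[OF X, of A] by (simp add: emeasure_distr[OF X])
  finally show "emeasure ?L A = emeasure (distr ?M borel ?X) A" .
qed simp

lemma integral_yukawa_subordination:
  fixes f :: "real^3 \<Rightarrow> real"
  assumes [measurable]: "f \<in> borel_measurable borel"
  shows "(LINT y|lborel. yukawa (y - p) * f y) =
    (LINT w|(lborel \<Otimes>\<^sub>M lborel). path_weight w * f (p + sqrt (fst w) *\<^sub>R snd w))"
proof -
  let ?M = "density (lborel \<Otimes>\<^sub>M lborel) (\<lambda>w. ennreal (path_weight w)) :: (real \<times> (real^3)) measure"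
  have "(LINT y|lborel. yukawa (y - p) * f y) = (LINT y|lborel. yukawa y * f (p + y))"
    using integral_lborel_shift[of "\<lambda>y. yukawa (y - p) * f y" p] by (simp add: add.commute)
  also have "\<dots> = (LINT y|density lborel (\<lambda>y. ennreal (yukawa y)). f (p + y))"
    by (simp add: integral_density)
  also have "\<dots> = (LINT w|?M. f (p + sqrt (fst w) *\<^sub>R snd w))"
    unfolding density_yukawa_eq_distr by (rule integral_distr) measurable
  also have "\<dots> = (LINT w|(lborel \<Otimes>\<^sub>M lborel). path_weight w * f (p + sqrt (fst w) *\<^sub>R snd w))"
    by (subst integral_density) auto
  finally show ?thesis .
qed

lemma integrable_heat: "0 < t \<Longrightarrow> integrable lborel (heat t)"
  using nn_integral_heat[of t 0] by (intro integrableI_nonneg) auto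

lemma integral_heat: "0 < t \<Longrightarrow> (LINT z|lborel. heat t z) = 1"
  using nn_integral_heat[of t 0] by (subst integral_eq_nn_integral) auto

lemma integrable_exp_weight: "integrable lborel exp_weight"
proof (rule integrableI_nonneg)
  have "(\<integral>\<^sup>+ t. ennreal (exp_weight t) \<partial>lborel) = (\<integral>\<^sup>+ t. ennreal (exp (- t)) * indicator {0<..} t \<partial>lborel)"
    by (intro nn_integral_cong) (auto simp: exp_weight_def split: split_indicator)
  thus "(\<integral>\<^sup>+ t. ennreal (exp_weight t) \<partial>lborel) < \<infinity>" by (simp add: nn_integral_exp_minus)
qed auto

text \<open>The factor \<open>1 / sqrt t\<close> is that of \<open>drift\<close>; it is integrable
  at \<open>0\<close> because \<open>exp (- t) / sqrt t\<close> is the derivative of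
  \<open>2 * gauss_prim (sqrt t)\<close>.\<close>

lemma integrable_exp_weight_div_sqrt: "integrable lborel (\<lambda>t. exp_weight t / sqrt t)"
proof (rule integrableI_nonneg)
  have "(\<integral>\<^sup>+ t. ennreal (exp_weight t / sqrt t) \<partial>lborel) = (\<integral>\<^sup>+ t. ennreal (exp (- t) / sqrt t) * indicator {0<..} t \<partial>lborel)"
    by (intro nn_integral_cong) (auto simp: exp_weight_def split: split_indicator)
  also have "\<dots> = ennreal (2 * (sqrt pi / 2) - 2 * gauss_prim (sqrt 0))"
  proof (rule nn_integral_FTC_0_top[where F="\<lambda>t. 2 * gauss_prim (sqrt t)"])
    fix t :: real assume t: "0 < t"
    have 1: "(sqrt has_real_derivative 1 / (2 * sqrt t)) (at t)"
      using t by (auto intro!: derivative_eq_intros simp: divide_simps)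
    show "((\<lambda>t. 2 * gauss_prim (sqrt t)) has_real_derivative exp (- t) / sqrt t) (at t)"
      by (rule DERIV_cong[OF DERIV_cmult[OF DERIV_chain2[OF gauss_prim_deriv 1]]]) (use t in simp)
    show "isCont (\<lambda>t. exp (- t) / sqrt t) t" using t by (intro continuous_intros) auto
    show "0 \<le> exp (- t) / sqrt t" using t by simp
  next
    show "((\<lambda>t. 2 * gauss_prim (sqrt t)) \<longlongrightarrow> 2 * gauss_prim (sqrt 0)) (at_right 0)"
      by (intro tendsto_intros isCont_tendsto_compose[OF DERIV_isCont[OF gauss_prim_deriv]])
    show "((\<lambda>t. 2 * gauss_prim (sqrt t)) \<longlongrightarrow> 2 * (sqrt pi / 2)) at_top"
      by (intro tendsto_intros filterlim_compose[OF gauss_prim_at_top] sqrt_at_top)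
  qed
  finally show "(\<integral>\<^sup>+ t. ennreal (exp_weight t / sqrt t) \<partial>lborel) < \<infinity>" by simp
qed (auto intro!: AE_I2 simp: exp_weight_def split: split_indicator)

lemma integrable_pair_mult:
  fixes f :: "'a::euclidean_space \<Rightarrow> real" and g :: "'b::euclidean_space \<Rightarrow> real"
  assumes f: "integrable lborel f" and g: "integrable lborel g"
  shows "integrable (lborel \<Otimes>\<^sub>M lborel) (\<lambda>w. f (fst w) * g (snd w))"
proof (rule lborel_pair.Fubini_integrable)
  have [measurable]: "f \<in> borel_measurable borel" "g \<in> borel_measurable borel"
    using borel_measurable_integrable[OF f] borel_measurable_integrable[OF g] by auto
  show "(\<lambda>w. f (fst w) * g (snd w)) \<in> borel_measurable (lborel \<Otimes>\<^sub>M lborel)" by measurable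
  show "integrable lborel (\<lambda>x. LINT y|lborel. norm (f (fst (x, y)) * g (snd (x, y))))"
    using f by (simp add: abs_mult)
  show "AE x in lborel. integrable lborel (\<lambda>y. f (fst (x, y)) * g (snd (x, y)))"
    using g by simp
qed

text \<open>The linear factor is absorbed by doubling the time of the Gaussian; the constant is
  \<open>2 * sqrt 2 ^ 3\<close> rounded up. This supplies the majorant in
  \<open>integrable_drift\<close>.\<close>

lemma heat_1_moment_le: "\<bar>z $ i\<bar> * heat 1 z \<le> 6 * heat 2 z"
proof -
  define r where "r = norm z"
  have r: "0 \<le> r" by (simp add: r_def)
  have "2 * r \<le> r\<^sup>2 / 4 + 4" using sum_squares_bound[of "r / 2" 2] by (simp add: power_divide)
  moreover have "0 \<le> r\<^sup>2" by simp
  ultimately have "r \<le> 2 * (1 + r\<^sup>2 / 8)" by argo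
  also have "\<dots> \<le> 2 * exp (r\<^sup>2 / 8)" by (intro mult_left_mono exp_ge_add_one_self) simp
  finally have 1: "r * exp (- (r\<^sup>2 / 4)) \<le> 2 * exp (r\<^sup>2 / 8) * exp (- (r\<^sup>2 / 4))" by simp
  have "exp (r\<^sup>2 / 8) * exp (- (r\<^sup>2 / 4)) = exp (- (r\<^sup>2 / 8))"
    unfolding exp_add[symmetric] by simp
  hence 2: "r * exp (- (r\<^sup>2 / 4)) \<le> 2 * exp (- (r\<^sup>2 / 8))" using 1 by (simp only: mult.assoc)
  have s: "sqrt (4 * pi * 2) ^ 3 = sqrt 2 ^ 3 * sqrt (4 * pi) ^ 3"
    by (simp add: power_mult_distrib[symmetric] real_sqrt_mult[symmetric])
  have s3: "sqrt 2 ^ 3 \<le> (3::real)"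
  proof -
    have "sqrt 2 ^ 3 = sqrt (2::real) * 2" by (simp add: power3_eq_cube)
    moreover have "sqrt 2 \<le> (3/2::real)" by (rule real_le_lsqrt) (simp_all add: power2_eq_square)
    ultimately show ?thesis by linarith
  qed
  have h1: "heat 1 z = exp (- (r\<^sup>2 / 4)) / sqrt (4 * pi) ^ 3" by (simp add: heat_def r_def)
  have h2: "heat 2 z = exp (- (r\<^sup>2 / 8)) / (sqrt 2 ^ 3 * sqrt (4 * pi) ^ 3)"
    by (simp only: heat_def r_def s) simp
  have "\<bar>z $ i\<bar> * heat 1 z \<le> r * heat 1 z"
    unfolding r_def by (intro mult_right_mono component_le_norm_cart) simp
  also have "\<dots> \<le> 2 * exp (- (r\<^sup>2 / 8)) / sqrt (4 * pi) ^ 3"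
    unfolding h1 using 2 by (simp add: divide_right_mono)
  also have "\<dots> = 2 * sqrt 2 ^ 3 * heat 2 z"
    unfolding h2 by simp
  also have "\<dots> \<le> 6 * heat 2 z"
    using s3 by (intro mult_right_mono) auto
  finally show ?thesis .
qed

lemma heat_pdiff:
  "heat 1 differentiable (at z)" "pdiff i (heat 1) z = - (z $ i / 2) * heat 1 z"
proof -
  have e: "heat 1 = (\<lambda>z. exp (- (z \<bullet> z) / 4) * (1 / sqrt (4 * pi) ^ 3))"
    by (simp add: heat_def fun_eq_iff power2_norm_eq_inner)
  have "((\<lambda>z. exp (- (z \<bullet> z) / 4) * (1 / sqrt (4 * pi) ^ 3)) has_derivative
     (\<lambda>h. (exp (- (z \<bullet> z) / 4) * (- (2 * (z \<bullet> h)) / 4)) * (1 / sqrt (4 * pi) ^ 3))) (at z)"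
    by (rule derivative_eq_intros refl | simp add: inner_commute ac_simps)+
  hence d: "(heat 1 has_derivative (\<lambda>h. (- (z \<bullet> h) / 2) * heat 1 z)) (at z)"
    unfolding e by (simp add: algebra_simps)
  thus "heat 1 differentiable (at z)" by (auto simp: differentiable_def)
  show "pdiff i (heat 1) z = - (z $ i / 2) * heat 1 z"
    using pdiff_eq[OF d, of i] by (simp add: inner_axis)
qed

text \<open>Stein's identity: a derivative of \<open>heat 1\<close> is a multiple of
  \<open>z $ i * heat 1 z\<close>, and the derivative of the compactly supported product of
  \<open>heat 1\<close> with the rescaled \<open>f\<close> integrates to \<open>0\<close>. The
  chain-rule factor \<open>sqrt t\<close> accounts for the denominator on the left.\<close>

lemma gauss_integral_by_parts:
  assumes f: "test_function f" and t: "0 < t"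
  shows "(LINT z|lborel. heat 1 z * (z $ i * f (p + sqrt t *\<^sub>R z) / (2 * sqrt t))) =
    (LINT z|lborel. heat 1 z * pdiff i f (p + sqrt t *\<^sub>R z))"
proof -
  let ?s = "sqrt t"
  define g where "g z = f (p + ?s *\<^sub>R z)" for z
  have s: "0 < ?s" using t by simp
  have dg: "(g has_derivative (\<lambda>h. frechet_derivative f (at (p + ?s *\<^sub>R z)) (?s *\<^sub>R h))) (at z)" for z
    unfolding g_def
    by (rule has_derivative_compose[where f="\<lambda>z. p + ?s *\<^sub>R z"])
       (auto intro!: derivative_eq_intros simp: frechet_derivative_works[symmetric] test_function_differentiable[OF f])
  have lin: "linear (frechet_derivative f (at y))" for y
    by (intro linear_frechet_derivative test_function_differentiable f)
  have pg: "pdiff i g z = ?s * pdiff i f (p + ?s *\<^sub>R z)" for z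
    unfolding pdiff_eq[OF dg] by (simp add: linear_cmul[OF lin] pdiff_def)
  have dg': "g differentiable (at z)" for z using dg by (auto simp: differentiable_def)
  let ?F = "\<lambda>z. heat 1 z * g z"
  have pF: "pdiff i ?F = (\<lambda>z. heat 1 z * (?s * pdiff i f (p + ?s *\<^sub>R z)) + - (z $ i / 2) * heat 1 z * f (p + ?s *\<^sub>R z))"
    by (rule ext) (simp only: pdiff_mult[OF heat_pdiff(1) dg'] pg heat_pdiff(2), simp only: g_def)
  have caff: "continuous_on UNIV (\<lambda>z. p + ?s *\<^sub>R z)" by (intro continuous_intros)
  have cf: "continuous_on UNIV (\<lambda>z. f (p + ?s *\<^sub>R z))" "continuous_on UNIV (\<lambda>z. pdiff i f (p + ?s *\<^sub>R z))"
    by (rule continuous_on_compose2[OF test_function_continuous caff]; use f test_function_pdiff in auto)+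
  have ch: "continuous_on UNIV (heat 1)"
    using heat_pdiff(1) by (simp add: continuous_on_eq_continuous_at differentiable_imp_continuous_within)
  have ci: "continuous_on UNIV (\<lambda>z::real^3. z $ i)" by (intro continuous_intros)
  have b: "bounded {z. u (p + ?s *\<^sub>R z) \<noteq> 0}" if "test_function u" for u
  proof -
    have "{z. u (p + ?s *\<^sub>R z) \<noteq> 0} = (\<lambda>y. (1 / ?s) *\<^sub>R y) ` ((\<lambda>y. - p + y) ` {y. u y \<noteq> 0})" (is "?A = ?B")
    proof
      show "?A \<subseteq> ?B"
      proof
        fix z assume "z \<in> ?A"
        moreover have "z = (1 / ?s) *\<^sub>R (- p + (p + ?s *\<^sub>R z))" using s by simp
        ultimately show "z \<in> ?B" by blast
      qed
      show "?B \<subseteq> ?A" using s by auto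
    qed
    thus ?thesis using that by (simp only: bounded_scaling bounded_translation test_function_iff)
  qed
  have b1: "bounded {z. f (p + ?s *\<^sub>R z) \<noteq> 0}" and b2: "bounded {z. pdiff i f (p + ?s *\<^sub>R z) \<noteq> 0}"
    by (rule b[OF f], rule b[OF test_function_pdiff[OF f]])
  have i1: "integrable lborel (\<lambda>z. heat 1 z * pdiff i f (p + ?s *\<^sub>R z))"
    by (rule integrable_continuous_bounded_support[OF continuous_on_mult[OF ch cf(2)] bounded_subset[OF b2]]) auto
  have i2: "integrable lborel (\<lambda>z. heat 1 z * (z $ i * f (p + ?s *\<^sub>R z) / (2 * ?s)))"
  proof (rule integrable_continuous_bounded_support)
    show "continuous_on UNIV (\<lambda>z. heat 1 z * (z $ i * f (p + ?s *\<^sub>R z) / (2 * ?s)))"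
      by (intro continuous_on_mult ch continuous_on_divide ci cf continuous_on_const) (use s in auto)
    show "bounded {z. heat 1 z * (z $ i * f (p + ?s *\<^sub>R z) / (2 * ?s)) \<noteq> 0}"
      by (rule bounded_subset[OF b1]) auto
  qed
  have "0 = (LINT z|lborel. pdiff i ?F z)"
  proof (rule integral_pdiff_eq_0[symmetric])
    show "?F differentiable at z" for z by (intro differentiable_mult heat_pdiff(1) dg')
    show "continuous_on UNIV (pdiff i ?F)"
      unfolding pF by (intro continuous_on_add continuous_on_mult continuous_on_minus continuous_on_divide continuous_on_const ch cf ci) auto
    show "bounded {z. ?F z \<noteq> 0}" by (rule bounded_subset[OF b1]) (auto simp: g_def)
  qed
  also have "\<dots> = (LINT z|lborel. ?s * (heat 1 z * pdiff i f (p + ?s *\<^sub>R z)) - ?s * (heat 1 z * (z $ i * f (p + ?s *\<^sub>R z) / (2 * ?s))))"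
    unfolding pF using s by (intro Bochner_Integration.integral_cong) (simp_all add: field_simps)
  also have "\<dots> = ?s * (LINT z|lborel. heat 1 z * pdiff i f (p + ?s *\<^sub>R z)) - ?s * (LINT z|lborel. heat 1 z * (z $ i * f (p + ?s *\<^sub>R z) / (2 * ?s)))"
    using i1 i2 by (simp only: Bochner_Integration.integral_diff integrable_mult_right integral_mult_right_zero)
  finally have "?s * (LINT z|lborel. heat 1 z * (z $ i * f (p + ?s *\<^sub>R z) / (2 * ?s))) = ?s * (LINT z|lborel. heat 1 z * pdiff i f (p + ?s *\<^sub>R z))"
    by linarith
  thus ?thesis using s by (simp only: mult_cancel_left) auto
qed

lemma has_real_derivative_along_sqrt:
  assumes f: "test_function f" and t: "0 < t"
  shows "((\<lambda>t. f (p + sqrt t *\<^sub>R z)) has_real_derivative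
    (\<Sum>i\<in>UNIV. z $ i * pdiff i f (p + sqrt t *\<^sub>R z) / (2 * sqrt t))) (at t)"
proof -
  have 1: "(sqrt has_real_derivative 1 / (2 * sqrt t)) (at t)"
    using t by (auto intro!: derivative_eq_intros simp: divide_simps)
  have 2: "((\<lambda>t. p + sqrt t *\<^sub>R z) has_derivative (\<lambda>h. (1 / (2 * sqrt t) * h) *\<^sub>R z)) (at t)"
    using has_derivative_add[OF has_derivative_const has_derivative_scaleR_left[OF 1[unfolded has_field_derivative_def]], of p z]
    by simp
  have "((\<lambda>t. f (p + sqrt t *\<^sub>R z)) has_derivative
    (\<lambda>h. \<Sum>i\<in>UNIV. ((1 / (2 * sqrt t) * h) *\<^sub>R z) $ i * pdiff i f (p + sqrt t *\<^sub>R z))) (at t)"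
    by (rule has_derivative_compose[OF 2 has_derivative_pdiff[OF test_function_differentiable[OF f]]])
  moreover have "(\<lambda>h. \<Sum>i\<in>UNIV. ((1 / (2 * sqrt t) * h) *\<^sub>R z) $ i * pdiff i f (p + sqrt t *\<^sub>R z)) =
    (\<lambda>h. (\<Sum>i\<in>UNIV. z $ i * pdiff i f (p + sqrt t *\<^sub>R z) / (2 * sqrt t)) * h)"
  proof (rule ext)
    fix h
    have "(\<Sum>i\<in>UNIV. ((1 / (2 * sqrt t) * h) *\<^sub>R z) $ i * pdiff i f (p + sqrt t *\<^sub>R z)) =
      (\<Sum>i\<in>UNIV. z $ i * pdiff i f (p + sqrt t *\<^sub>R z) / (2 * sqrt t) * h)"
      by (intro sum.cong) simp_all
    thus "(\<Sum>i\<in>UNIV. ((1 / (2 * sqrt t) * h) *\<^sub>R z) $ i * pdiff i f (p + sqrt t *\<^sub>R z)) =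
      (\<Sum>i\<in>UNIV. z $ i * pdiff i f (p + sqrt t *\<^sub>R z) / (2 * sqrt t)) * h"
      by (simp only: sum_distrib_right)
  qed
  ultimately show ?thesis by (simp add: has_field_derivative_def)
qed

lemma vec_nth_measurable [measurable]: "(\<lambda>z::real^3. z $ i) \<in> borel_measurable borel"
  by (intro borel_measurable_continuous_onI continuous_intros)

lemma integrable_along_path:
  assumes u: "test_function u"
  shows "integrable path_measure (\<lambda>w. path_weight w * u (p + sqrt (fst w) *\<^sub>R snd w))"
proof -
  have [measurable]: "u \<in> borel_measurable borel" using u by (rule test_function_measurable)
  obtain C where C: "\<And>y. \<bar>u y\<bar> \<le> C" "0 \<le> C" using test_function_bounded[OF u] by blast
  show ?thesis
  proof (rule Bochner_Integration.integrable_bound)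
    show "integrable path_measure (\<lambda>w. exp_weight (fst w) * (C * heat 1 (snd w)))"
      by (intro integrable_pair_mult integrable_exp_weight integrable_mult_right integrable_heat) simp
    show "AE w in path_measure. norm (path_weight w * u (p + sqrt (fst w) *\<^sub>R snd w)) \<le>
        norm (exp_weight (fst w) * (C * heat 1 (snd w)))"
    proof (intro AE_I2)
      fix w :: "real \<times> (real^3)"
      have "path_weight w * \<bar>u (p + sqrt (fst w) *\<^sub>R snd w)\<bar> \<le> path_weight w * C"
        by (intro mult_left_mono C) auto
      thus "norm (path_weight w * u (p + sqrt (fst w) *\<^sub>R snd w)) \<le>
        norm (exp_weight (fst w) * (C * heat 1 (snd w)))" using C(2) by (simp add: abs_mult mult.commute mult.left_commute)
    qed
  qed measurable
qed

lemma integrable_drift: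
  assumes f: "test_function f"
  shows "integrable path_measure (\<lambda>w. path_weight w * drift i f p (fst w) (snd w))"
proof -
  have [measurable]: "f \<in> borel_measurable borel" "pdiff i f \<in> borel_measurable borel"
    using f by (auto intro: test_function_measurable test_function_pdiff)
  obtain C where C: "\<And>y. \<bar>pdiff i f y\<bar> \<le> C" "0 \<le> C" using test_function_bounded[OF test_function_pdiff[OF f, of i]] by blast
  show ?thesis
  proof (rule Bochner_Integration.integrable_bound)
    show "integrable path_measure (\<lambda>w. exp_weight (fst w) / sqrt (fst w) * (C * (6 * heat 2 (snd w))))"
      by (intro integrable_pair_mult integrable_exp_weight_div_sqrt integrable_mult_right integrable_heat) simp
    show "AE w in path_measure. norm (path_weight w * drift i f p (fst w) (snd w)) \<le>
        norm (exp_weight (fst w) / sqrt (fst w) * (C * (6 * heat 2 (snd w))))"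
    proof (intro AE_I2)
      fix w :: "real \<times> (real^3)"
      define t z where "t = fst w" and "z = snd w"
      show "norm (path_weight w * drift i f p (fst w) (snd w)) \<le>
        norm (exp_weight (fst w) / sqrt (fst w) * (C * (6 * heat 2 (snd w))))"
      proof (cases "0 < t")
        case True
        have "\<bar>pdiff i f (p + sqrt t *\<^sub>R z)\<bar> * (\<bar>z $ i\<bar> * heat 1 z) \<le> C * (6 * heat 2 z)"
          by (intro mult_mono C heat_1_moment_le) auto
        hence "exp_weight t / sqrt t * (\<bar>pdiff i f (p + sqrt t *\<^sub>R z)\<bar> * (\<bar>z $ i\<bar> * heat 1 z)) \<le> exp_weight t / sqrt t * (C * (6 * heat 2 z))"
          using True by (intro mult_left_mono) auto
        moreover have "norm (exp_weight t * heat 1 z * drift i f p t z) =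
          exp_weight t / sqrt t * (\<bar>pdiff i f (p + sqrt t *\<^sub>R z)\<bar> * (\<bar>z $ i\<bar> * heat 1 z)) / 2"
          using True by (simp add: abs_mult ac_simps)
        moreover have "0 \<le> exp_weight t / sqrt t * (\<bar>pdiff i f (p + sqrt t *\<^sub>R z)\<bar> * (\<bar>z $ i\<bar> * heat 1 z))"
          using True by simp
        moreover have "a \<le> c" if "b \<le> c" "a = b / 2" "0 \<le> b" for a b c :: real using that by linarith
        ultimately have "norm (exp_weight t * heat 1 z * drift i f p t z) \<le> exp_weight t / sqrt t * (C * (6 * heat 2 z))"
          by blast
        also have "\<dots> \<le> norm (exp_weight t / sqrt t * (C * (6 * heat 2 z)))"
          unfolding real_norm_def by (rule abs_ge_self)
        finally show ?thesis unfolding t_def z_def .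
      next
        case False
        thus ?thesis unfolding t_def by simp
      qed
    qed
  qed measurable
qed

lemma integral_drift:
  assumes f: "test_function f"
  shows "(LINT w|path_measure. path_weight w * drift i f p (fst w) (snd w)) =
    (LINT w|path_measure. path_weight w * pdiff i (pdiff i f) (p + sqrt (fst w) *\<^sub>R snd w))"
proof -
  have "(LINT w|path_measure. path_weight w * drift i f p (fst w) (snd w)) =
     (LINT t|lborel. (LINT z|lborel. exp_weight t * heat 1 z * drift i f p t z))"
    using lborel_pair.integral_fst'[OF integrable_drift[OF f]] by simp
  also have "\<dots> = (LINT t|lborel. (LINT z|lborel. exp_weight t * heat 1 z * pdiff i (pdiff i f) (p + sqrt t *\<^sub>R z)))"
  proof (rule Bochner_Integration.integral_cong[OF refl])
    fix t :: real
    show "(LINT z|lborel. exp_weight t * heat 1 z * drift i f p t z) = (LINT z|lborel. exp_weight t * heat 1 z * pdiff i (pdiff i f) (p + sqrt t *\<^sub>R z))"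
    proof (cases "0 < t")
      case True
      show ?thesis using gauss_integral_by_parts[OF test_function_pdiff[OF f, of i] True, of i p]
        by (simp only: mult.assoc integral_mult_right_zero)
    qed simp
  qed
  also have "\<dots> = (LINT w|path_measure. path_weight w * pdiff i (pdiff i f) (p + sqrt (fst w) *\<^sub>R snd w))"
    using lborel_pair.integral_fst'[OF integrable_along_path[OF test_function_pdiff[OF test_function_pdiff[OF f]]]] by simp
  finally show ?thesis .
qed

lemma time_integral_along_path:
  assumes f: "test_function f"
  shows "(LINT t|lborel. exp_weight t * heat 1 z * ((\<Sum>i\<in>UNIV. drift i f p t z) - f (p + sqrt t *\<^sub>R z))) = - f p * heat 1 z"
proof -
  have [measurable]: "f \<in> borel_measurable borel" "pdiff i f \<in> borel_measurable borel" for i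
    using f by (auto intro: test_function_measurable test_function_pdiff)
  define h where "h t = exp (- t) * ((\<Sum>i\<in>UNIV. drift i f p t z) - f (p + sqrt t *\<^sub>R z))" for t
  obtain C where C: "\<And>y. \<bar>f y\<bar> \<le> C" "0 \<le> C" using test_function_bounded[OF f] by blast
  have "\<exists>K. 0 \<le> K \<and> (\<forall>y. \<bar>pdiff i f y\<bar> \<le> K)" for i
    using test_function_bounded[OF test_function_pdiff[OF f, of i]] by blast
  then obtain K where K: "\<And>i. 0 \<le> K i" "\<And>i y. \<bar>pdiff i f y\<bar> \<le> K i" by metis
  have e: "einterval 0 \<infinity> = {0<..}"
    by (auto simp: einterval_def zero_ereal_def)
  \<comment> \<open>Majorant of the time derivative: the first term covers the singularity of the
    drift at \<open>0\<close>, the second covers \<open>f\<close> itself.\<close>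
  define B where "B t = (\<Sum>i\<in>UNIV. \<bar>z $ i\<bar> * K i) * (exp_weight t / sqrt t) + C * exp_weight t" for t
  have intB: "integrable lborel B"
    unfolding B_def[abs_def]
    by (intro Bochner_Integration.integrable_add integrable_mult_right integrable_exp_weight integrable_exp_weight_div_sqrt)
  have si: "set_integrable lborel (einterval 0 \<infinity>) h"
    unfolding set_integrable_def e
  proof (rule Bochner_Integration.integrable_bound[OF intB])
    show "(\<lambda>t. indicator {0<..} t *\<^sub>R h t) \<in> borel_measurable lborel"
      unfolding h_def by measurable
    show "AE t in lborel. norm (indicator {0<..} t *\<^sub>R h t) \<le> norm (B t)"
    proof (intro AE_I2)
      fix t :: real
      show "norm (indicator {0<..} t *\<^sub>R h t) \<le> norm (B t)"
      proof (cases "0 < t")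
        case True
        have "\<bar>\<Sum>i\<in>UNIV. drift i f p t z\<bar> \<le> (\<Sum>i\<in>UNIV. \<bar>z $ i\<bar> * K i / sqrt t)"
        proof (rule order_trans[OF sum_abs sum_mono])
          fix i
          have "\<bar>z $ i\<bar> * \<bar>pdiff i f (p + sqrt t *\<^sub>R z)\<bar> / (2 * sqrt t) \<le> \<bar>z $ i\<bar> * K i / (1 * sqrt t)"
            using True K by (intro frac_le mult_left_mono mult_right_mono) auto
          thus "\<bar>drift i f p t z\<bar> \<le> \<bar>z $ i\<bar> * K i / sqrt t" using True by (simp add: abs_mult)
        qed
        also have "\<dots> = (\<Sum>i\<in>UNIV. \<bar>z $ i\<bar> * K i) / sqrt t" by (simp add: sum_divide_distrib)
        finally have "\<bar>(\<Sum>i\<in>UNIV. drift i f p t z) - f (p + sqrt t *\<^sub>R z)\<bar> \<le> (\<Sum>i\<in>UNIV. \<bar>z $ i\<bar> * K i) / sqrt t + C"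
          using C(1)[of "p + sqrt t *\<^sub>R z"] by linarith
        hence "exp (- t) * \<bar>(\<Sum>i\<in>UNIV. drift i f p t z) - f (p + sqrt t *\<^sub>R z)\<bar> \<le> exp (- t) * ((\<Sum>i\<in>UNIV. \<bar>z $ i\<bar> * K i) / sqrt t + C)"
          by (intro mult_left_mono) auto
        also have "\<dots> = B t" using True by (simp add: B_def exp_weight_pos algebra_simps)
        finally show ?thesis using True by (simp add: h_def abs_mult)
      qed simp
    qed
  qed
  have cA: "isCont h t" if "0 < t" for t
  proof -
    have c1: "isCont (\<lambda>t. u (p + sqrt t *\<^sub>R z)) t" if "test_function u" for u
      by (rule isCont_o2[where f="\<lambda>t. p + sqrt t *\<^sub>R z"])
         (intro continuous_intros, use that test_function_continuous continuous_on_eq_continuous_at in blast)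
    show ?thesis
      unfolding h_def using that by (intro continuous_intros c1 f test_function_pdiff) auto
  qed
  have "(LBINT t=0..\<infinity>. h t) = 0 - f p"
  proof (rule interval_integral_FTC_integrable[where F="\<lambda>t. exp (- t) * f (p + sqrt t *\<^sub>R z)"])
    show "((\<lambda>t. exp (- t) * f (p + sqrt t *\<^sub>R z)) has_vector_derivative h t) (at t)" if "0 < ereal t" for t
    proof -
      have t: "0 < t" using that by (simp add: zero_ereal_def)
      have e: "((\<lambda>t. exp (- t)) has_real_derivative - exp (- t)) (at t)"
        by (auto intro!: derivative_eq_intros)
      have "((\<lambda>t. exp (- t) * f (p + sqrt t *\<^sub>R z)) has_real_derivative h t) (at t)"
        by (rule DERIV_cong[OF DERIV_mult[OF e has_real_derivative_along_sqrt[OF f t]]])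
           (simp add: h_def right_diff_distrib mult.commute)
      thus ?thesis by (simp add: has_real_derivative_iff_has_vector_derivative)
    qed
    show "isCont h t" if "0 < ereal t" for t
      using that cA by (simp add: zero_ereal_def)
    have "((\<lambda>t. exp (- t) * f (p + sqrt t *\<^sub>R z)) \<longlongrightarrow> exp (- 0) * f (p + sqrt 0 *\<^sub>R z)) (at_right 0)"
    proof (intro tendsto_mult)
      show "((\<lambda>t::real. exp (- t)) \<longlongrightarrow> exp (- 0)) (at_right 0)" by (intro tendsto_intros)
      have "((\<lambda>t. p + sqrt t *\<^sub>R z) \<longlongrightarrow> p + sqrt 0 *\<^sub>R z) (at_right 0)" by (intro tendsto_intros)
      moreover have "isCont f (p + sqrt 0 *\<^sub>R z)"
        using test_function_continuous[OF f] by (simp add: continuous_on_eq_continuous_at)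
      ultimately show "((\<lambda>t. f (p + sqrt t *\<^sub>R z)) \<longlongrightarrow> f (p + sqrt 0 *\<^sub>R z)) (at_right 0)"
        by (metis isCont_tendsto_compose)
    qed
    thus "(((\<lambda>t. exp (- t) * f (p + sqrt t *\<^sub>R z)) \<circ> real_of_ereal) \<longlongrightarrow> f p) (at_right 0)"
      by (simp add: zero_ereal_def ereal_tendsto_simps)
    have "((\<lambda>t. exp (- t) * f (p + sqrt t *\<^sub>R z)) \<longlongrightarrow> 0) at_top"
    proof (rule Lim_null_comparison)
      show "\<forall>\<^sub>F t in at_top. norm (exp (- t) * f (p + sqrt t *\<^sub>R z)) \<le> C * exp (- t)"
        using C by (intro always_eventually allI) (simp add: abs_mult mult.commute mult_left_mono)
      show "((\<lambda>t. C * exp (- t)) \<longlongrightarrow> 0) at_top"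
        by (intro tendsto_mult_right_zero) real_asymp
    qed
    thus "(((\<lambda>t. exp (- t) * f (p + sqrt t *\<^sub>R z)) \<circ> real_of_ereal) \<longlongrightarrow> 0) (at_left \<infinity>)"
      by (simp add: ereal_tendsto_simps)
  qed (use si in auto)
  hence fp: "(LINT t|lborel. indicator {0<..} t * h t) = - f p"
    by (simp add: interval_lebesgue_integral_def set_lebesgue_integral_def e)
  have "(LINT t|lborel. exp_weight t * heat 1 z * ((\<Sum>i\<in>UNIV. drift i f p t z) - f (p + sqrt t *\<^sub>R z))) =
    (LINT t|lborel. heat 1 z * (indicator {0<..} t * h t))"
    by (intro Bochner_Integration.integral_cong) (simp_all add: exp_weight_def h_def)
  also have "\<dots> = heat 1 z * (LINT t|lborel. indicator {0<..} t * h t)"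
    by (rule integral_mult_right_zero)
  finally show ?thesis unfolding fp by simp
qed

text \<open>For fixed \<open>z\<close>, integrating the \<open>t\<close>-derivative of \<open>exp (- t) * f (p + sqrt t *\<^sub>R z)\<close>
  yields \<open>- f p\<close>; its drift part turns into the Laplacian after a Gaussian integration by parts in \<open>z\<close>.\<close>

lemma yukawa_fundamental_solution:
  assumes f: "test_function f"
  shows "(LINT y|lborel. yukawa (y - p) * (f y - laplacian f y)) = f p"
proof -
  have tp: "test_function (pdiff i (pdiff i f))" for i
    by (intro test_function_pdiff f)
  have [measurable]: "f \<in> borel_measurable borel" "pdiff i (pdiff i f) \<in> borel_measurable borel" for i
    using f tp by (auto intro: test_function_measurable)
  let ?E = "\<lambda>w. path_weight w * f (p + sqrt (fst w) *\<^sub>R snd w)"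
  let ?EA = "\<lambda>i w. path_weight w * drift i f p (fst w) (snd w)"
  let ?ED = "\<lambda>i w. path_weight w * pdiff i (pdiff i f) (p + sqrt (fst w) *\<^sub>R snd w)"
  have tot: "(\<lambda>w. (\<Sum>i\<in>UNIV. ?EA i w) - ?E w) =
    (\<lambda>(t, z). exp_weight t * heat 1 z * ((\<Sum>i\<in>UNIV. drift i f p t z) - f (p + sqrt t *\<^sub>R z)))"
    by (simp add: fun_eq_iff right_diff_distrib sum_distrib_left)
  have inttot: "integrable path_measure (\<lambda>w. (\<Sum>i\<in>UNIV. ?EA i w) - ?E w)"
    by (intro Bochner_Integration.integrable_diff Bochner_Integration.integrable_sum integrable_drift integrable_along_path f)
  \<comment> \<open>The inner integral runs over time, in which the integrand is an exact
    derivative; in \<open>integral_drift\<close> it runs over space. Joint integrability permits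
    both orders.\<close>
  have "(LINT w|path_measure. (\<Sum>i\<in>UNIV. ?EA i w) - ?E w) = (LINT z|lborel. (LINT t|lborel. exp_weight t * heat 1 z * ((\<Sum>i\<in>UNIV. drift i f p t z) - f (p + sqrt t *\<^sub>R z))))"
    using inttot unfolding tot by (rule lborel_pair.integral_snd[symmetric])
  also have "\<dots> = (LINT z|lborel. - f p * heat 1 z)" by (simp only: time_integral_along_path[OF f])
  also have "\<dots> = - f p"
    using integral_heat[of 1] by simp
  finally have 1: "(LINT w|path_measure. (\<Sum>i\<in>UNIV. ?EA i w) - ?E w) = - f p" .
  have "(LINT w|path_measure. (\<Sum>i\<in>UNIV. ?EA i w) - ?E w) = (\<Sum>i\<in>UNIV. LINT w|path_measure. ?EA i w) - (LINT w|path_measure. ?E w)"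
    by (simp only: Bochner_Integration.integral_diff Bochner_Integration.integral_sum Bochner_Integration.integrable_sum integrable_drift integrable_along_path f)
  hence 2: "(LINT w|path_measure. ?E w) - (\<Sum>i\<in>UNIV. LINT w|path_measure. ?ED i w) = f p"
    using 1 by (simp only: integral_drift[OF f])
  have "(LINT y|lborel. yukawa (y - p) * (f y - laplacian f y)) =
    (LINT w|path_measure. path_weight w * (f (p + sqrt (fst w) *\<^sub>R snd w) - laplacian f (p + sqrt (fst w) *\<^sub>R snd w)))"
    by (rule integral_yukawa_subordination) (unfold laplacian_def, measurable)
  also have "\<dots> = (LINT w|path_measure. ?E w - (\<Sum>i\<in>UNIV. ?ED i w))"
    by (simp only: laplacian_def right_diff_distrib sum_distrib_left)
  also have "\<dots> = (LINT w|path_measure. ?E w) - (\<Sum>i\<in>UNIV. LINT w|path_measure. ?ED i w)"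
    by (simp only: Bochner_Integration.integral_diff Bochner_Integration.integral_sum Bochner_Integration.integrable_sum integrable_along_path f tp)
  finally show ?thesis using 2 by simp
qed

lemma test_function_laplacian: "test_function f \<Longrightarrow> test_function (laplacian f)"
proof -
  assume f: "test_function f"
  have "test_function (\<lambda>y. \<Sum>i\<in>I. pdiff i (pdiff i f) y)" if "finite I" for I
    using that
  proof induction
    case (insert i I)
    thus ?case
      using test_function_add[OF test_function_pdiff[OF test_function_pdiff[OF f]], of _ i i] by simp
  qed (simp add: test_function_zero)
  thus ?thesis by (simp add: laplacian_def[abs_def])
qed

lemma resolvent_test_function:
  assumes f: "test_function f"
  shows "resolvent (\<lambda>y. of_real (f y - laplacian f y)) p = of_real (f p)"
proof -
  have "resolvent (\<lambda>y. of_real (f y - laplacian f y)) p =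
    (LINT y|lborel. complex_of_real (yukawa (y - p) * (f y - laplacian f y)))"
    by (simp add: resolvent_def yuk_def)
  thus ?thesis by (simp only: integral_complex_of_real yukawa_fundamental_solution[OF f])
qed

section \<open>The Sobolev space as the range of the resolvent\<close>

abbreviation of_real_fun :: "(real^3 \<Rightarrow> real) \<Rightarrow> fn3" where
  "of_real_fun f \<equiv> \<lambda>y. complex_of_real (f y)"

lemma integral_by_parts_complex:
  assumes "test_function f" "test_function g"
  shows "(LINT y|lborel. of_real_fun (pdiff i f) y * of_real_fun g y) =
    - (LINT y|lborel. of_real_fun f y * of_real_fun (pdiff i g) y)"
  unfolding of_real_mult[symmetric] integral_complex_of_real integral_by_parts_pdiff[OF assms] by simp

lemma resolvent_laplacian:
  assumes f: "test_function f"
  shows "resolvent (of_real_fun (laplacian f)) p = resolvent (of_real_fun f) p - of_real (f p)"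
  using resolvent_test_function[OF f, of p]
    resolvent_diff[OF test_function_L2[OF f] test_function_L2[OF test_function_laplacian[OF f]], of p]
  by (simp add: algebra_simps)

lemma laplacian_shift:
  assumes "test_function f" shows "laplacian (\<lambda>y. f (y + c)) = (\<lambda>y. laplacian f (y + c))"
  using pdiffs_shift[OF assms, of "[i, i]" c for i] by (simp add: laplacian_def fun_eq_iff)

lemma weak_laplacian_integral:
  assumes u: "u \<in> L2" and d: "\<And>i. d i \<in> L2" "\<And>i. weak_deriv [i, i] u (d i)" and f: "test_function f"
  shows "(LINT y|lborel. u y * of_real_fun (laplacian f) y) = (LINT y|lborel. (\<Sum>i\<in>UNIV. d i y) * of_real_fun f y)"
proof -
  have tp: "test_function (pdiff i (pdiff i f))" for i by (intro test_function_pdiff f)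
  have "(LINT y|lborel. u y * of_real_fun (laplacian f) y) =
    (LINT y|lborel. (\<Sum>i\<in>UNIV. u y * of_real_fun (pdiff i (pdiff i f)) y))"
    by (simp only: laplacian_def of_real_sum sum_distrib_left)
  also have "\<dots> = (\<Sum>i\<in>UNIV. LINT y|lborel. u y * of_real_fun (pdiff i (pdiff i f)) y)"
    by (intro Bochner_Integration.integral_sum L2_mult_integrable u test_function_L2 tp)
  also have "\<dots> = (\<Sum>i\<in>UNIV. LINT y|lborel. d i y * of_real_fun f y)"
    using d(2) f by (intro sum.cong) (simp_all add: weak_deriv_def)
  also have "\<dots> = (LINT y|lborel. (\<Sum>i\<in>UNIV. d i y * of_real_fun f y))"
    by (intro Bochner_Integration.integral_sum[symmetric] L2_mult_integrable d test_function_L2 f)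
  finally show ?thesis by (simp only: sum_distrib_right)
qed

lemma ae_eq_if_test_integrals_eq:
  assumes "f \<in> L2" "g \<in> L2"
    and "\<And>\<phi>. test_function \<phi> \<Longrightarrow> (LINT y|lborel. f y * of_real_fun \<phi> y) = (LINT y|lborel. g y * of_real_fun \<phi> y)"
  shows "ae_eq f g"
proof -
  have "ae_eq (\<lambda>y. f y - g y) (\<lambda>_. 0)"
  proof (rule test_functions_separate)
    show "(\<lambda>y. f y - g y) \<in> L2" using assms by auto
    fix \<phi> assume "test_function \<phi>"
    thus "(LINT y|lborel. (f y - g y) * of_real (\<phi> y)) = 0"
      using assms by (simp add: left_diff_distrib L2_mult_integrable test_function_L2)
  qed
  thus ?thesis by (auto simp: ae_eq_def)
qed

text \<open>Every test function has the form \<open>R (\<phi> - laplacian \<phi>)\<close>; symmetry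
  moves this \<open>R\<close> onto \<open>h\<close>, and test functions separate.\<close>

lemma resolvent_eq_zero_imp:
  assumes h: "h \<in> L2" and "ae_eq (resolvent h) (\<lambda>_. 0)" shows "ae_eq h (\<lambda>_. 0)"
proof (rule ae_eq_if_test_integrals_eq[OF h L2_zero])
  fix \<phi> assume f: "test_function \<phi>"
  let ?g = "\<lambda>y. of_real (\<phi> y - laplacian \<phi> y)"
  have g: "?g \<in> L2" by (intro test_function_L2 test_function_diff f test_function_laplacian)
  have "(LINT y|lborel. h y * of_real_fun \<phi> y) = (LINT y|lborel. h y * resolvent ?g y)"
    by (simp only: resolvent_test_function[OF f])
  also have "\<dots> = (LINT y|lborel. resolvent h y * ?g y)"
    by (rule resolvent_symmetric[OF h g, symmetric])
  also have "\<dots> = (LINT y|lborel. 0 * ?g y)"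
    by (rule integral_ae_eq[OF assms(2) resolvent_L2[OF h] L2_zero g])
  finally show "(LINT y|lborel. h y * of_real_fun \<phi> y) = (LINT y|lborel. 0 * of_real_fun \<phi> y)" by simp
qed

text \<open>The resolvent commutes with translations, so the weak equation may be tested against
  all translates of a test function and integrated over the translation.\<close>

lemma weak_laplacian_imp_resolvent:
  assumes u: "u \<in> L2" and g: "g \<in> L2" and lap: "is_laplacian u g"
  shows "ae_eq u (resolvent (\<lambda>y. u y - g y))"
proof (rule ae_eq_if_test_integrals_eq[OF u])
  have w: "(\<lambda>y. u y - g y) \<in> L2" using u g by auto
  thus "resolvent (\<lambda>y. u y - g y) \<in> L2" by auto
  obtain d where d: "\<And>i. d i \<in> L2" "\<And>i. weak_deriv [i, i] u (d i)" "ae_eq g (\<lambda>y. \<Sum>i\<in>UNIV. d i y)"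
    using lap by (auto simp: is_laplacian_def)
  have D: "(\<lambda>y. \<Sum>i\<in>UNIV. d i y) \<in> L2" using d by auto
  fix \<phi> assume f: "test_function \<phi>"
  let ?L = "\<lambda>y. of_real (\<phi> y - laplacian \<phi> y) :: complex"
  have L: "?L \<in> L2" by (intro test_function_L2 test_function_diff f test_function_laplacian)
  have inner: "(LINT p|lborel. ?L (p + z) * u p) = (LINT p|lborel. of_real_fun \<phi> (p + z) * (u p - g p))" for z
  proof -
    have fz: "test_function (\<lambda>y. \<phi> (y + z))" by (rule test_function_shift[OF f])
    have t: "(\<lambda>y. of_real (\<phi> (y + z)) :: complex) \<in> L2" "(\<lambda>y. of_real (laplacian \<phi> (y + z)) :: complex) \<in> L2"
      using test_function_L2[OF fz] test_function_L2[OF test_function_laplacian[OF fz]]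
      by (simp_all add: laplacian_shift[OF f])
    have "(LINT p|lborel. ?L (p + z) * u p) = (LINT p|lborel. u p * of_real (\<phi> (p + z)) - u p * of_real (laplacian \<phi> (p + z)))"
      by (intro Bochner_Integration.integral_cong) (simp_all add: algebra_simps)
    also have "\<dots> = (LINT p|lborel. u p * of_real (\<phi> (p + z))) - (LINT p|lborel. u p * of_real (laplacian \<phi> (p + z)))"
      by (intro Bochner_Integration.integral_diff L2_mult_integrable u t)
    also have "(LINT p|lborel. u p * of_real (laplacian \<phi> (p + z))) = (LINT p|lborel. (\<Sum>i\<in>UNIV. d i p) * of_real (\<phi> (p + z)))"
      using weak_laplacian_integral[OF u d(1,2) fz] by (simp only: laplacian_shift[OF f])
    also have "\<dots> = (LINT p|lborel. g p * of_real (\<phi> (p + z)))"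
      by (rule integral_ae_eq[OF ae_eq_sym[OF d(3)] D g t(1)])
    also have "(LINT p|lborel. u p * of_real (\<phi> (p + z))) - (LINT p|lborel. g p * of_real (\<phi> (p + z))) =
      (LINT p|lborel. u p * of_real (\<phi> (p + z)) - g p * of_real (\<phi> (p + z)))"
      by (intro Bochner_Integration.integral_diff[symmetric] L2_mult_integrable u g t)
    also have "\<dots> = (LINT p|lborel. of_real_fun \<phi> (p + z) * (u p - g p))"
      by (intro Bochner_Integration.integral_cong) (simp_all add: algebra_simps)
    finally show ?thesis .
  qed
  have "(LINT y|lborel. u y * of_real_fun \<phi> y) = (LINT y|lborel. resolvent ?L y * u y)"
    by (simp only: resolvent_test_function[OF f] mult.commute)
  also have "\<dots> = (LINT z|lborel. of_real (yukawa z) * (LINT p|lborel. ?L (p + z) * u p))"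
    by (rule resolvent_pairing(1)[OF L u])
  also have "\<dots> = (LINT z|lborel. of_real (yukawa z) * (LINT p|lborel. of_real_fun \<phi> (p + z) * (u p - g p)))"
    by (simp only: inner)
  also have "\<dots> = (LINT y|lborel. resolvent (of_real_fun \<phi>) y * (u y - g y))"
    by (rule resolvent_pairing(1)[OF test_function_L2[OF f] w, symmetric])
  also have "\<dots> = (LINT y|lborel. of_real_fun \<phi> y * resolvent (\<lambda>y. u y - g y) y)"
    by (rule resolvent_symmetric[OF test_function_L2[OF f] w])
  finally show "(LINT y|lborel. u y * of_real_fun \<phi> y) = (LINT y|lborel. resolvent (\<lambda>y. u y - g y) y * of_real_fun \<phi> y)"
    by (simp only: mult.commute)
qed

text \<open>In the form of \<open>resolvent_pairing\<close>, classical integration by parts applies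
  for each fixed shift of \<open>a\<close>, since \<open>pdiff\<close> commutes with shifts.\<close>

lemma resolvent_move_pdiff:
  assumes a: "test_function a" and b: "test_function b"
  shows "(LINT p|lborel. resolvent (of_real_fun (pdiff i a)) p * of_real_fun b p) =
    - (LINT p|lborel. resolvent (of_real_fun a) p * of_real_fun (pdiff i b) p)"
proof -
  have "(LINT p|lborel. of_real_fun (pdiff i a) (p + z) * of_real_fun b p) =
    - (LINT p|lborel. of_real_fun a (p + z) * of_real_fun (pdiff i b) p)" for z
    using integral_by_parts_complex[OF test_function_shift[OF a, of z] b, of i] pdiffs_shift[OF a, of "[i]" z]
    by simp
  thus ?thesis
    using a b by (simp add: resolvent_pairing(1) test_function_L2 test_function_pdiff)
qed

text \<open>The same argument one level up: \<open>resolvent_move_pdiff\<close> now plays the role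
  of integration by parts in the inner integral.\<close>

lemma resolvent_move_pdiff':
  assumes a: "test_function a" and b: "test_function b"
  shows "(LINT p|lborel. resolvent (of_real_fun (pdiff i a)) p * resolvent (of_real_fun b) p) =
    - (LINT p|lborel. resolvent (of_real_fun a) p * resolvent (of_real_fun (pdiff i b)) p)"
proof -
  have "(LINT p|lborel. of_real_fun (pdiff i a) (p + z) * resolvent (of_real_fun b) p) =
    - (LINT p|lborel. of_real_fun a (p + z) * resolvent (of_real_fun (pdiff i b)) p)" for z
    using resolvent_move_pdiff[OF b test_function_shift[OF a, of z], of i] pdiffs_shift[OF a, of "[i]" z]
    by (simp add: mult.commute)
  thus ?thesis
    using a b by (simp add: resolvent_pairing(1) test_function_L2 test_function_pdiff resolvent_L2)
qed

lemma cnj_resolvent_of_real: "cnj (resolvent (of_real_fun f) p) = resolvent (of_real_fun f) p"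
  using resolvent_cnj[of "of_real_fun f" p] by simp

lemma L2_sq_resolvent_of_real:
  "(LINT p|lborel. resolvent (of_real_fun f) p * resolvent (of_real_fun f) p) = of_real (L2_sq (resolvent (of_real_fun f)))"
proof -
  have "resolvent (of_real_fun f) p * resolvent (of_real_fun f) p = of_real ((norm (resolvent (of_real_fun f) p))\<^sup>2)" for p
    using complex_norm_square[of "resolvent (of_real_fun f) p"] by (simp only: cnj_resolvent_of_real)
  thus ?thesis by (simp only: integral_complex_of_real L2_sq_def)
qed

lemma resolvent_of_real_laplacian:
  assumes f: "test_function f"
  shows "resolvent (of_real_fun (laplacian f)) p = (\<Sum>i\<in>UNIV. resolvent (of_real_fun (pdiff i (pdiff i f))) p)"
proof -
  have "resolvent (of_real_fun (laplacian f)) p = resolvent (\<lambda>y. \<Sum>i\<in>UNIV. of_real_fun (pdiff i (pdiff i f)) y) p"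
    by (simp only: laplacian_def of_real_sum)
  also have "\<dots> = (\<Sum>i\<in>UNIV. resolvent (of_real_fun (pdiff i (pdiff i f))) p)"
    by (intro resolvent_sum test_function_L2 test_function_pdiff f)
  finally show ?thesis .
qed

text \<open>Moving one derivative across the symmetric form \<open>\<integral> R a * R b\<close> shows that the sums of
  \<open>L2_sq (R (\<partial>\<^sub>i f))\<close> and of \<open>L2_sq (R (\<partial>\<^sub>i \<partial>\<^sub>j f))\<close> are expressed by \<open>R (laplacian f) = R f - f\<close>
  alone. This replaces the Fourier transform in the regularity theory.\<close>

lemma sum_resolvent_pdiff_sq:
  assumes f: "test_function f"
  shows "(\<Sum>i\<in>UNIV. L2_sq (resolvent (of_real_fun (pdiff i f)))) \<le> 2 * L2_sq (of_real_fun f)"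
proof -
  note L = test_function_L2 test_function_pdiff test_function_laplacian f resolvent_L2
  have "complex_of_real (\<Sum>i\<in>UNIV. L2_sq (resolvent (of_real_fun (pdiff i f)))) =
    (\<Sum>i\<in>UNIV. - (LINT p|lborel. resolvent (of_real_fun f) p * resolvent (of_real_fun (pdiff i (pdiff i f))) p))"
    unfolding of_real_sum L2_sq_resolvent_of_real[symmetric]
    by (intro sum.cong refl resolvent_move_pdiff' test_function_pdiff f)
  also have "\<dots> = - (LINT p|lborel. (\<Sum>i\<in>UNIV. resolvent (of_real_fun f) p * resolvent (of_real_fun (pdiff i (pdiff i f))) p))"
    unfolding sum_negf
    by (subst Bochner_Integration.integral_sum) (intro L2_mult_integrable L refl)+
  also have "\<dots> = - (LINT p|lborel. resolvent (of_real_fun f) p * (resolvent (of_real_fun f) p - of_real (f p)))"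
    by (simp only: sum_distrib_left[symmetric] resolvent_of_real_laplacian[OF f, symmetric] resolvent_laplacian[OF f])
  also have "\<dots> = (LINT p|lborel. resolvent (of_real_fun f) p * of_real (f p)) - of_real (L2_sq (resolvent (of_real_fun f)))"
    unfolding right_diff_distrib L2_sq_resolvent_of_real[symmetric]
    by (subst Bochner_Integration.integral_diff) (intro L2_mult_integrable L | simp)+
  finally have 1: "complex_of_real (\<Sum>i\<in>UNIV. L2_sq (resolvent (of_real_fun (pdiff i f)))) =
    (LINT p|lborel. resolvent (of_real_fun f) p * of_real (f p)) - of_real (L2_sq (resolvent (of_real_fun f)))" .
  have 2: "norm (LINT p|lborel. resolvent (of_real_fun f) p * of_real (f p)) \<le> L2_sq (of_real_fun f)"
  proof (rule power2_le_imp_le)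
    have "(norm (LINT p|lborel. resolvent (of_real_fun f) p * of_real (f p)))\<^sup>2 \<le> L2_sq (resolvent (of_real_fun f)) * L2_sq (of_real_fun f)"
      by (intro L2_cauchy_schwarz L)
    also have "\<dots> \<le> L2_sq (of_real_fun f) * L2_sq (of_real_fun f)"
      by (intro mult_right_mono resolvent_contraction L L2_sq_nonneg)
    finally show "(norm (LINT p|lborel. resolvent (of_real_fun f) p * of_real (f p)))\<^sup>2 \<le> (L2_sq (of_real_fun f))\<^sup>2"
      by (simp add: power2_eq_square)
  qed simp
  have "(\<Sum>i\<in>UNIV. L2_sq (resolvent (of_real_fun (pdiff i f)))) \<le> norm (complex_of_real (\<Sum>i\<in>UNIV. L2_sq (resolvent (of_real_fun (pdiff i f)))))"
    unfolding norm_of_real by (rule abs_ge_self)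
  also have "\<dots> \<le> norm (LINT p|lborel. resolvent (of_real_fun f) p * of_real (f p)) + norm (complex_of_real (L2_sq (resolvent (of_real_fun f))))"
    unfolding 1 by (rule norm_triangle_ineq4)
  also have "\<dots> \<le> L2_sq (of_real_fun f) + L2_sq (of_real_fun f)"
    using resolvent_contraction(2)[OF test_function_L2[OF f]] by (intro add_mono 2) simp
  finally show ?thesis by simp
qed

lemma sum_resolvent_pdiff_pdiff_sq:
  assumes f: "test_function f"
  shows "(\<Sum>i\<in>UNIV. \<Sum>j\<in>UNIV. L2_sq (resolvent (of_real_fun (pdiff i (pdiff j f))))) \<le> 4 * L2_sq (of_real_fun f)"
proof -
  note L = test_function_L2 test_function_pdiff test_function_laplacian f resolvent_L2
  let ?R = "\<lambda>g. resolvent (of_real_fun g)"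
  \<comment> \<open>One derivative is moved across, the derivatives are commuted, and another is
    moved back. Summed over \<open>i\<close> and \<open>j\<close>, the right-hand sides make up the
    square of \<open>R (laplacian f)\<close>.\<close>
  have sw: "(LINT p|lborel. ?R (pdiff i (pdiff j f)) p * ?R (pdiff i (pdiff j f)) p) =
    (LINT p|lborel. ?R (pdiff j (pdiff j f)) p * ?R (pdiff i (pdiff i f)) p)" for i j
  proof -
    have "(LINT p|lborel. ?R (pdiff i (pdiff j f)) p * ?R (pdiff i (pdiff j f)) p) =
      - (LINT p|lborel. ?R (pdiff j f) p * ?R (pdiff i (pdiff i (pdiff j f))) p)"
      by (intro resolvent_move_pdiff' test_function_pdiff f)
    also have "pdiff i (pdiff i (pdiff j f)) = pdiff j (pdiff i (pdiff i f))"
      by (metis pdiff_commute test_function_pdiff f)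
    also have "- (LINT p|lborel. ?R (pdiff j f) p * ?R (pdiff j (pdiff i (pdiff i f))) p) =
      (LINT p|lborel. ?R (pdiff j (pdiff j f)) p * ?R (pdiff i (pdiff i f)) p)"
      by (intro resolvent_move_pdiff'[symmetric] test_function_pdiff f)
    finally show ?thesis .
  qed
  have "complex_of_real (\<Sum>i\<in>UNIV. \<Sum>j\<in>UNIV. L2_sq (?R (pdiff i (pdiff j f)))) =
    (\<Sum>i\<in>UNIV. \<Sum>j\<in>UNIV. LINT p|lborel. ?R (pdiff j (pdiff j f)) p * ?R (pdiff i (pdiff i f)) p)"
    unfolding of_real_sum L2_sq_resolvent_of_real[symmetric] by (intro sum.cong refl sw)
  also have "\<dots> = (LINT p|lborel. (\<Sum>i\<in>UNIV. \<Sum>j\<in>UNIV. ?R (pdiff j (pdiff j f)) p * ?R (pdiff i (pdiff i f)) p))"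
    by (subst Bochner_Integration.integral_sum, intro Bochner_Integration.integrable_sum L2_mult_integrable L,
        subst Bochner_Integration.integral_sum, intro L2_mult_integrable L) (rule refl)
  also have "\<dots> = (LINT p|lborel. ?R (laplacian f) p * ?R (laplacian f) p)"
    by (simp only: sum_distrib_left[symmetric] sum_distrib_right[symmetric] resolvent_of_real_laplacian[OF f, symmetric])
  also have "\<dots> = of_real (L2_sq (?R (laplacian f)))"
    by (rule L2_sq_resolvent_of_real)
  finally have "(\<Sum>i\<in>UNIV. \<Sum>j\<in>UNIV. L2_sq (?R (pdiff i (pdiff j f)))) = L2_sq (?R (laplacian f))"
    by (simp only: of_real_eq_iff)
  also have "\<dots> = L2_sq (\<lambda>p. ?R f p - of_real (f p))"
    by (rule arg_cong[of _ _ L2_sq], rule ext, rule resolvent_laplacian[OF f])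
  also have "\<dots> \<le> 2 * L2_sq (?R f) + 2 * L2_sq (of_real_fun f)"
    by (intro L2_sq_diff_le L)
  also have "\<dots> \<le> 4 * L2_sq (of_real_fun f)"
    using resolvent_contraction(2)[OF test_function_L2[OF f]] by simp
  finally show ?thesis .
qed

text \<open>The orders zero, one and two come with the constants 1, 2 and 4; the largest serves for
  all.\<close>

lemma resolvent_pdiffs_sq_le:
  assumes f: "test_function f" and "length is \<le> 2"
  shows "L2_sq (resolvent (of_real_fun (pdiffs is f))) \<le> 4 * L2_sq (of_real_fun f)"
proof -
  have nn: "0 \<le> L2_sq (of_real_fun f)" by simp
  consider "is = []" | i where "is = [i]" | i j where "is = [i, j]"
    using assms(2) by (cases "is" rule: list.exhaust) (auto simp: length_Suc_conv le_Suc_eq numeral_2_eq_2)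
  thus ?thesis
  proof cases
    case 1
    have "L2_sq (resolvent (of_real_fun f)) \<le> 4 * L2_sq (of_real_fun f)"
      using resolvent_contraction(2)[OF test_function_L2[OF f]] nn by linarith
    thus ?thesis using 1 by simp
  next
    case (2 i)
    have "L2_sq (resolvent (of_real_fun (pdiff i f))) \<le> (\<Sum>i\<in>UNIV. L2_sq (resolvent (of_real_fun (pdiff i f))))"
      by (rule member_le_sum) auto
    hence "L2_sq (resolvent (of_real_fun (pdiff i f))) \<le> 4 * L2_sq (of_real_fun f)"
      using sum_resolvent_pdiff_sq[OF f] nn by linarith
    thus ?thesis using 2 by simp
  next
    case (3 i j)
    have "L2_sq (resolvent (of_real_fun (pdiff i (pdiff j f)))) \<le> (\<Sum>j\<in>UNIV. L2_sq (resolvent (of_real_fun (pdiff i (pdiff j f)))))"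
      by (rule member_le_sum) auto
    also have "\<dots> \<le> (\<Sum>i\<in>UNIV. \<Sum>j\<in>UNIV. L2_sq (resolvent (of_real_fun (pdiff i (pdiff j f)))))"
      by (rule member_le_sum) (auto intro: sum_nonneg)
    finally show ?thesis using 3 sum_resolvent_pdiff_pdiff_sq[OF f] by simp
  qed
qed

section \<open>Weak derivatives of resolvents\<close>

lemma resolvent_weak_deriv_test:
  assumes a: "test_function a" and b: "test_function b" and "length is \<le> 2"
  shows "(LINT p|lborel. resolvent (of_real_fun a) p * of_real_fun (pdiffs is b) p) =
    (- 1) ^ length is * (LINT p|lborel. resolvent (of_real_fun (pdiffs is a)) p * of_real_fun b p)"
proof -
  consider "is = []" | i where "is = [i]" | i j where "is = [i, j]"
    using assms(3) by (cases "is" rule: list.exhaust) (auto simp: length_Suc_conv le_Suc_eq numeral_2_eq_2)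
  thus ?thesis
  proof cases
    case (2 i)
    thus ?thesis using resolvent_move_pdiff[OF a b, of i] by simp
  next
    case (3 i j)
    \<comment> \<open>The outer derivative is moved first, so the order of the two directions is
      reversed on \<open>a\<close>; \<open>pdiff_commute\<close> restores it.\<close>
    have "(LINT p|lborel. resolvent (of_real_fun a) p * of_real_fun (pdiff i (pdiff j b)) p) =
      (LINT p|lborel. resolvent (of_real_fun (pdiff j (pdiff i a))) p * of_real_fun b p)"
      using resolvent_move_pdiff[OF a test_function_pdiff[OF b], of i j]
        resolvent_move_pdiff[OF test_function_pdiff[OF a] b, of j i] by simp
    thus ?thesis using 3 pdiff_commute[OF a, of i j] by simp
  qed simp
qed

lemma L2_sq_Complex:
  assumes "test_function a" "test_function b"
  shows "L2_sq (\<lambda>y. Complex (a y) (b y)) = L2_sq (of_real_fun a) + L2_sq (of_real_fun b)"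
proof -
  have "integrable lborel (\<lambda>y. (a y)\<^sup>2)" "integrable lborel (\<lambda>y. (b y)\<^sup>2)"
    using L2_integrable[OF test_function_L2[OF assms(1)]] L2_integrable[OF test_function_L2[OF assms(2)]] by simp_all
  thus ?thesis by (simp add: L2_sq_def cmod_power2)
qed

lemma pdiffs_diff:
  assumes "test_function f" "test_function g"
  shows "pdiffs is (\<lambda>y. f y - g y) = (\<lambda>y. pdiffs is f y - pdiffs is g y)"
proof (induction "is")
  case (Cons i "is")
  have "pdiff i (\<lambda>y. pdiffs is f y + (-1) * pdiffs is g y) = (\<lambda>y. pdiff i (pdiffs is f) y + (-1) * pdiff i (pdiffs is g) y)"
    using assms
    by (intro ext, subst pdiff_add)
       (simp_all only: pdiff_cmult test_function_differentiable test_function_pdiffs test_function_cmult)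
  thus ?case using Cons by simp
qed simp

text \<open>By \<open>resolvent_pdiffs_sq_le\<close> the resolvents of the derivatives depend
  boundedly on a test function, so along test functions approximating \<open>h\<close> they form a
  Cauchy sequence. Its limit is the weak derivative, because both sides of the defining identity
  pass to the limit.\<close>

lemma resolvent_weak_deriv_exists:
  assumes h: "h \<in> L2" and len: "length is \<le> 2"
  shows "\<exists>g\<in>L2. weak_deriv is (resolvent h) g"
proof -
  let ?R = "\<lambda>g. resolvent (of_real_fun g)"
  obtain \<alpha> \<beta> where a: "\<And>n::nat. test_function (\<alpha> n)" and b: "\<And>n. test_function (\<beta> n)"
    and lim: "(\<lambda>n. L2_sq (\<lambda>y. Complex (\<alpha> n y) (\<beta> n y) - h y)) \<longlonglongrightarrow> 0"
    using test_functions_dense[OF h] by blast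
  define c where "c n y = Complex (\<alpha> n y) (\<beta> n y)" for n y
  have c: "c n \<in> L2" for n unfolding c_def by (intro Complex_test_L2 a b)
  have lim: "(\<lambda>n. L2_sq (\<lambda>y. c n y - h y)) \<longlonglongrightarrow> 0" using lim by (simp only: c_def)
  define f where "f n p = ?R (pdiffs is (\<alpha> n)) p + \<i> * ?R (pdiffs is (\<beta> n)) p" for n p
  have tL: "of_real_fun (pdiffs is u) \<in> L2" if "test_function u" for u
    by (intro test_function_L2 test_function_pdiffs that)
  have f: "f n \<in> L2" for n
    unfolding f_def[abs_def] by (intro L2_add L2_scale resolvent_L2 tL a b)
  have ff: "L2_sq (\<lambda>y. f m y - f n y) \<le> 16 * L2_sq (\<lambda>y. c m y - h y) + 16 * L2_sq (\<lambda>y. c n y - h y)" for m n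
  proof -
    let ?a = "\<lambda>y. \<alpha> m y - \<alpha> n y" and ?b = "\<lambda>y. \<beta> m y - \<beta> n y"
    have ta: "test_function ?a" and tb: "test_function ?b"
      by (intro test_function_diff a b)+
    have e: "f m y - f n y = ?R (pdiffs is ?a) y + \<i> * ?R (pdiffs is ?b) y" for y
      by (simp add: f_def pdiffs_diff[OF a a] pdiffs_diff[OF b b] resolvent_diff[OF tL tL] a b right_diff_distrib)
    have "L2_sq (\<lambda>y. f m y - f n y) \<le> 2 * L2_sq (?R (pdiffs is ?a)) + 2 * L2_sq (\<lambda>y. \<i> * ?R (pdiffs is ?b) y)"
      unfolding e by (intro L2_sq_add_le L2_scale resolvent_L2 tL ta tb)
    also have "L2_sq (\<lambda>y. \<i> * ?R (pdiffs is ?b) y) = L2_sq (?R (pdiffs is ?b))"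
      by (simp add: L2_sq_scale)
    also have "2 * L2_sq (?R (pdiffs is ?a)) + 2 * L2_sq (?R (pdiffs is ?b)) \<le> 8 * (L2_sq (of_real_fun ?a) + L2_sq (of_real_fun ?b))"
      using resolvent_pdiffs_sq_le[OF ta len] resolvent_pdiffs_sq_le[OF tb len] by argo
    also have "L2_sq (of_real_fun ?a) + L2_sq (of_real_fun ?b) = L2_sq (\<lambda>y. c m y - c n y)"
      unfolding L2_sq_Complex[OF ta tb, symmetric] c_def by (intro arg_cong[of _ _ L2_sq]) (simp add: fun_eq_iff complex_eq_iff)
    also have "\<dots> \<le> 2 * L2_sq (\<lambda>y. c m y - h y) + 2 * L2_sq (\<lambda>y. h y - c n y)"
      by (intro L2_sq_limit_le c h)
    also have "L2_sq (\<lambda>y. h y - c n y) = L2_sq (\<lambda>y. c n y - h y)"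
      by (rule L2_sq_minus_commute)
    finally show ?thesis by simp
  qed
  have "\<exists>g\<in>L2. (\<lambda>n. L2_sq (\<lambda>y. f n y - g y)) \<longlonglongrightarrow> 0"
  proof (rule L2_complete[OF f])
    fix e :: real assume "0 < e"
    then obtain N where N: "\<And>n. N \<le> n \<Longrightarrow> norm (L2_sq (\<lambda>y. c n y - h y) - 0) < e / 32"
      using LIMSEQ_D[OF lim, of "e / 32"] by auto
    show "\<exists>N. \<forall>m\<ge>N. \<forall>n\<ge>N. L2_sq (\<lambda>y. f m y - f n y) \<le> e"
    proof (intro exI[of _ N] allI impI)
      fix m n assume "N \<le> m" "N \<le> n"
      hence "L2_sq (\<lambda>y. c m y - h y) < e / 32" "L2_sq (\<lambda>y. c n y - h y) < e / 32"
        using N[of m] N[of n] by auto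
      thus "L2_sq (\<lambda>y. f m y - f n y) \<le> e" using ff[of m n] by linarith
    qed
  qed
  then obtain g where g: "g \<in> L2" "(\<lambda>n. L2_sq (\<lambda>y. f n y - g y)) \<longlonglongrightarrow> 0" by blast
  have Rlim: "(\<lambda>n. L2_sq (\<lambda>y. resolvent (c n) y - resolvent h y)) \<longlonglongrightarrow> 0"
  proof (rule tendsto_sandwich[OF _ _ tendsto_const lim])
    have "L2_sq (\<lambda>y. resolvent (c n) y - resolvent h y) \<le> L2_sq (\<lambda>y. c n y - h y)" for n
    proof -
      have "resolvent (\<lambda>y. c n y - h y) = (\<lambda>y. resolvent (c n) y - resolvent h y)"
        by (rule ext) (rule resolvent_diff[OF c h])
      thus ?thesis using resolvent_contraction(2)[OF L2_diff[OF c h], of n] by simp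
    qed
    thus "\<forall>\<^sub>F n in sequentially. L2_sq (\<lambda>y. resolvent (c n) y - resolvent h y) \<le> L2_sq (\<lambda>y. c n y - h y)"
      by (intro always_eventually allI)
  qed simp
  have "weak_deriv is (resolvent h) g"
    unfolding weak_deriv_def
  proof (intro allI impI)
    fix \<phi> assume t: "test_function \<phi>"
    have tL2: "of_real_fun \<phi> \<in> L2" by (rule test_function_L2[OF t])
    have 1: "(\<lambda>n. LINT y|lborel. resolvent (c n) y * of_real_fun (pdiffs is \<phi>) y) \<longlonglongrightarrow>
       (LINT y|lborel. resolvent h y * of_real_fun (pdiffs is \<phi>) y)"
      by (intro L2_tendsto_integral Rlim resolvent_L2 c h tL t)
    have 2: "(\<lambda>n. (- 1) ^ length is * (LINT y|lborel. f n y * of_real_fun \<phi> y)) \<longlonglongrightarrow>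
       (- 1) ^ length is * (LINT y|lborel. g y * of_real_fun \<phi> y)"
      by (intro tendsto_mult tendsto_const L2_tendsto_integral f g tL2)
    have "(LINT y|lborel. resolvent (c n) y * of_real_fun (pdiffs is \<phi>) y) =
      (- 1) ^ length is * (LINT y|lborel. f n y * of_real_fun \<phi> y)" for n
    proof -
      have rc: "resolvent (c n) y = ?R (\<alpha> n) y + \<i> * ?R (\<beta> n) y" for y
        using resolvent_add[OF test_function_L2[OF a[of n]] L2_scale[OF test_function_L2[OF b[of n]], of \<i>], of y]
        by (simp add: c_def[abs_def] Complex_eq resolvent_scale)
      have i: "integrable lborel (\<lambda>y. resolvent (of_real_fun u) y * of_real_fun v y)" if "test_function u" "test_function v" for u v
        by (intro L2_mult_integrable resolvent_L2 test_function_L2 that)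
      have "(LINT y|lborel. resolvent (c n) y * of_real_fun (pdiffs is \<phi>) y) =
        (LINT y|lborel. ?R (\<alpha> n) y * of_real_fun (pdiffs is \<phi>) y + \<i> * (?R (\<beta> n) y * of_real_fun (pdiffs is \<phi>) y))"
        by (simp only: rc distrib_right mult.assoc)
      also have "\<dots> = (LINT y|lborel. ?R (\<alpha> n) y * of_real_fun (pdiffs is \<phi>) y) + \<i> * (LINT y|lborel. ?R (\<beta> n) y * of_real_fun (pdiffs is \<phi>) y)"
        by (simp only: Bochner_Integration.integral_add integrable_mult_right integral_mult_right_zero i a b t test_function_pdiffs)
      also have "\<dots> = (- 1) ^ length is * ((LINT y|lborel. ?R (pdiffs is (\<alpha> n)) y * of_real_fun \<phi> y) + \<i> * (LINT y|lborel. ?R (pdiffs is (\<beta> n)) y * of_real_fun \<phi> y))"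
        unfolding resolvent_weak_deriv_test[OF a t len] resolvent_weak_deriv_test[OF b t len]
        by (simp add: algebra_simps)
      also have "\<dots> = (- 1) ^ length is * (LINT y|lborel. ?R (pdiffs is (\<alpha> n)) y * of_real_fun \<phi> y + \<i> * (?R (pdiffs is (\<beta> n)) y * of_real_fun \<phi> y))"
        by (simp only: Bochner_Integration.integral_add integrable_mult_right integral_mult_right_zero i a b t test_function_pdiffs)
      also have "\<dots> = (- 1) ^ length is * (LINT y|lborel. f n y * of_real_fun \<phi> y)"
        by (simp only: f_def distrib_right mult.assoc)
      finally show ?thesis .
    qed
    with 1 have "(\<lambda>n. (- 1) ^ length is * (LINT y|lborel. f n y * of_real_fun \<phi> y)) \<longlonglongrightarrow>
       (LINT y|lborel. resolvent h y * of_real_fun (pdiffs is \<phi>) y)" by (simp only:)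
    thus "(LINT y|lborel. resolvent h y * of_real (pdiffs is \<phi> y)) = (- 1) ^ length is * (LINT y|lborel. g y * of_real (\<phi> y))"
      by (rule LIMSEQ_unique[OF _ 2])
  qed
  thus ?thesis using g by blast
qed

lemma is_laplacian_resolvent:
  assumes h: "h \<in> L2" shows "is_laplacian (resolvent h) (\<lambda>y. resolvent h y - h y)"
proof -
  have "\<exists>g\<in>L2. weak_deriv [i, i] (resolvent h) g" for i
    using resolvent_weak_deriv_exists[OF h, of "[i, i]"] by simp
  then obtain d where d: "\<And>i. d i \<in> L2" "\<And>i. weak_deriv [i, i] (resolvent h) (d i)" by metis
  have "ae_eq (\<lambda>y. resolvent h y - h y) (\<lambda>y. \<Sum>i\<in>UNIV. d i y)"
  proof (rule ae_eq_if_test_integrals_eq)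
    show "(\<lambda>y. resolvent h y - h y) \<in> L2" "(\<lambda>y. \<Sum>i\<in>UNIV. d i y) \<in> L2"
      using h d by auto
    fix \<phi> assume f: "test_function \<phi>"
    note L = test_function_L2[OF f] test_function_L2[OF test_function_laplacian[OF f]]
    have "(LINT y|lborel. (\<Sum>i\<in>UNIV. d i y) * of_real_fun \<phi> y) = (LINT y|lborel. resolvent h y * of_real_fun (laplacian \<phi>) y)"
      by (rule weak_laplacian_integral[OF resolvent_L2[OF h] d f, symmetric])
    also have "\<dots> = (LINT y|lborel. h y * (resolvent (of_real_fun \<phi>) y - of_real_fun \<phi> y))"
      by (simp only: resolvent_symmetric[OF h L(2)] resolvent_laplacian[OF f])
    also have "\<dots> = (LINT y|lborel. h y * resolvent (of_real_fun \<phi>) y) - (LINT y|lborel. h y * of_real_fun \<phi> y)"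
      unfolding right_diff_distrib by (intro Bochner_Integration.integral_diff L2_mult_integrable h L resolvent_L2)
    also have "\<dots> = (LINT y|lborel. resolvent h y * of_real_fun \<phi> y) - (LINT y|lborel. h y * of_real_fun \<phi> y)"
      by (simp only: resolvent_symmetric[OF h L(1)])
    also have "\<dots> = (LINT y|lborel. (resolvent h y - h y) * of_real_fun \<phi> y)"
      unfolding left_diff_distrib by (intro Bochner_Integration.integral_diff[symmetric] L2_mult_integrable h L resolvent_L2)
    finally show "(LINT y|lborel. (resolvent h y - h y) * of_real_fun \<phi> y) = (LINT y|lborel. (\<Sum>i\<in>UNIV. d i y) * of_real_fun \<phi> y)"
      by simp
  qed
  thus ?thesis using d by (auto simp: is_laplacian_def)
qed

section \<open>The minimal and the maximal operator\<close>

lemma continuous_ae_eq_imp_eq: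
  assumes "open S" "continuous_on S f" "continuous_on S g" "ae_eq f g" "y \<in> S"
  shows "f y = g y"
proof (rule ccontr)
  assume ne: "f y \<noteq> g y"
  let ?U = "S \<inter> (\<lambda>y. f y - g y) -` (- {0})"
  have o: "open ?U"
    using assms by (intro continuous_open_preimage continuous_intros) auto
  obtain N where N: "N \<in> null_sets lborel" "{y. f y \<noteq> g y} \<subseteq> N"
    using assms(4) unfolding ae_eq_def by (auto elim: AE_E simp: null_sets_def)
  have "?U \<in> null_sets lborel"
    by (rule null_sets_subset[OF N(1)]) (use o N(2) in auto)
  hence "negligible ?U"
    by (simp add: negligible_iff_null_sets null_sets_completionI)
  hence "?U = {}" using o open_not_negligible by blast
  thus False using ne assms(5) by auto
qed

lemma weak_deriv_ae_eq:
  assumes "ae_eq f f'" "f \<in> L2" "f' \<in> L2" "weak_deriv is f g" shows "weak_deriv is f' g"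
  unfolding weak_deriv_def
proof (intro allI impI)
  fix \<phi> assume t: "test_function \<phi>"
  have "(LINT y|lborel. f y * of_real (pdiffs is \<phi> y)) = (LINT y|lborel. f' y * of_real (pdiffs is \<phi> y))"
    by (intro integral_ae_eq assms test_function_L2 test_function_pdiffs t)
  thus "(LINT y|lborel. f' y * of_real (pdiffs is \<phi> y)) = (- 1) ^ length is * (LINT y|lborel. g y * of_real (\<phi> y))"
    using assms(4) t by (simp add: weak_deriv_def)
qed

lemma H_min_iff:
  "(f, g) \<in> H_min x \<longleftrightarrow> f \<in> L2 \<and> g \<in> L2 \<and> ae_eq f (resolvent (\<lambda>y. f y + g y)) \<and>
    (\<forall>j. resolvent (\<lambda>y. f y + g y) (x j) = 0)"
proof
  assume "(f, g) \<in> H_min x"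
  hence f: "f \<in> dom_H x" and g: "g \<in> L2" and lap: "is_laplacian f (\<lambda>y. - g y)"
    by (auto simp: H_min_def)
  from f have fL: "f \<in> L2" by (auto simp: dom_H_def sobolev_W2_def)
  have ae: "ae_eq f (resolvent (\<lambda>y. f y + g y))"
    using weak_laplacian_imp_resolvent[OF fL L2_uminus[OF g] lap] by simp
  obtain c where c: "continuous_on UNIV c" "ae_eq f c" "\<And>j. c (x j) = 0"
    using f by (auto simp: dom_H_def)
  \<comment> \<open>Both sides are continuous representatives of \<open>f\<close>; so they agree at
    the points \<open>x j\<close> too, where equality almost everywhere says nothing.\<close>
  have "c y = resolvent (\<lambda>y. f y + g y) y" for y
    by (rule continuous_ae_eq_imp_eq[OF open_UNIV c(1) resolvent_continuous[OF L2_add[OF fL g]] ae_eq_trans[OF ae_eq_sym[OF c(2)] ae] UNIV_I])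
  thus "f \<in> L2 \<and> g \<in> L2 \<and> ae_eq f (resolvent (\<lambda>y. f y + g y)) \<and> (\<forall>j. resolvent (\<lambda>y. f y + g y) (x j) = 0)"
    using fL g ae c(3) by metis
next
  let ?h = "\<lambda>y. f y + g y"
  assume *: "f \<in> L2 \<and> g \<in> L2 \<and> ae_eq f (resolvent ?h) \<and> (\<forall>j. resolvent ?h (x j) = 0)"
  hence h: "?h \<in> L2" and ae: "ae_eq (resolvent ?h) f" by (auto intro: ae_eq_sym)
  have "\<exists>d\<in>L2. weak_deriv is f d" if "length is \<le> 2" for "is"
    using resolvent_weak_deriv_exists[OF h that] weak_deriv_ae_eq[OF ae resolvent_L2[OF h]] * by blast
  hence "f \<in> sobolev_W2 2" using * by (auto simp: sobolev_W2_def)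
  hence fd: "f \<in> dom_H x"
    using * resolvent_continuous[OF h] by (auto simp: dom_H_def)
  obtain d where d: "\<And>i. d i \<in> L2" "\<And>i. weak_deriv [i, i] (resolvent ?h) (d i)"
    "ae_eq (\<lambda>y. resolvent ?h y - ?h y) (\<lambda>y. \<Sum>i\<in>UNIV. d i y)"
    using is_laplacian_resolvent[OF h] by (auto simp: is_laplacian_def)
  have "ae_eq (\<lambda>y. - g y) (\<lambda>y. resolvent ?h y - ?h y)"
    using * by (auto simp: ae_eq_def elim: eventually_mono)
  from ae_eq_trans[OF this d(3)] have "is_laplacian f (\<lambda>y. - g y)"
    using d(1,2) weak_deriv_ae_eq[OF ae resolvent_L2[OF h]] * unfolding is_laplacian_def by blast
  thus "(f, g) \<in> H_min x" using fd * by (auto simp: H_min_def)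
qed

lemma resolvent_in_H_min:
  assumes "h \<in> L2" "\<And>j. resolvent h (x j) = 0"
  shows "(resolvent h, \<lambda>y. h y - resolvent h y) \<in> H_min x"
  unfolding H_min_iff using assms by auto

text \<open>The \<open>1 / (4 * pi)\<close> inside \<open>yukawa\<close> cancels the
  \<open>4 * pi\<close> of \<open>Gamma0\<close>, so the coefficient vector is itself the first
  boundary value.\<close>

definition point_sum :: "('m::finite \<Rightarrow> real^3) \<Rightarrow> complex^'m \<Rightarrow> fn3" where
  "point_sum x c y = (\<Sum>j\<in>UNIV. c $ j * yuk (x j) y)"

lemma point_sum_L2 [intro]: "point_sum x c \<in> L2"
  unfolding point_sum_def[abs_def] by (intro L2_sum L2_scale yuk_L2)

lemma point_sum_add: "point_sum x (c + d) y = point_sum x c y + point_sum x d y"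
  by (simp add: point_sum_def distrib_right sum.distrib)

lemma point_sum_scale: "point_sum x (a *s c) y = a * point_sum x c y"
  by (simp add: point_sum_def sum_distrib_left mult.assoc)

lemma resolvent_point_sum:
  "resolvent (point_sum x c) y = (\<Sum>j\<in>UNIV. c $ j * of_real (exp (- norm (y - x j)) / (8 * pi)))"
  unfolding point_sum_def[abs_def]
  by (subst resolvent_sum) (auto simp: resolvent_scale resolvent_yuk simp del: of_real_divide)

lemma resolvent_point_sum_at:
  "resolvent (point_sum x c) (x k) = (E1 x *v c) $ k / (8 * of_real pi)"
  by (simp add: resolvent_point_sum E1_def matrix_vector_mult_def sum_divide_distrib mult.commute)

lemma integral_mult_point_sum:
  assumes h: "h \<in> L2"
  shows "(LINT y|lborel. h y * point_sum x c y) = (\<Sum>j\<in>UNIV. c $ j * resolvent h (x j))"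
    and "(LINT y|lborel. h y * cnj (point_sum x c y)) = (\<Sum>j\<in>UNIV. cnj (c $ j) * resolvent h (x j))"
proof -
  have gen: "(LINT y|lborel. h y * (\<Sum>j\<in>UNIV. b j * yuk (x j) y)) = (\<Sum>j\<in>UNIV. b j * resolvent h (x j))" for b
  proof -
    have "(LINT y|lborel. h y * (\<Sum>j\<in>UNIV. b j * yuk (x j) y)) = (LINT y|lborel. (\<Sum>j\<in>UNIV. b j * (yuk (x j) y * h y)))"
      by (intro Bochner_Integration.integral_cong) (auto simp: sum_distrib_left mult.commute mult.left_commute intro!: sum.cong)
    also have "\<dots> = (\<Sum>j\<in>UNIV. LINT y|lborel. b j * (yuk (x j) y * h y))"
      by (intro Bochner_Integration.integral_sum integrable_mult_right L2_mult_integrable yuk_L2 h)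
    also have "\<dots> = (\<Sum>j\<in>UNIV. b j * resolvent h (x j))"
      by (simp only: integral_mult_right_zero resolvent_def)
    finally show ?thesis .
  qed
  show "(LINT y|lborel. h y * point_sum x c y) = (\<Sum>j\<in>UNIV. c $ j * resolvent h (x j))"
    unfolding point_sum_def by (rule gen)
  show "(LINT y|lborel. h y * cnj (point_sum x c y)) = (\<Sum>j\<in>UNIV. cnj (c $ j) * resolvent h (x j))"
    using gen[of "\<lambda>j. cnj (c $ j)"] by (simp add: point_sum_def)
qed

section \<open>Singular and regular parts at the points\<close>

lemma open_compl_range: "open (- range (x :: 'm::finite \<Rightarrow> real^3))"
  by (intro open_Compl finite_imp_closed) simp

lemma continuous_on_point_sum: "continuous_on (- range x) (point_sum x c)"
  unfolding point_sum_def yuk_def yukawa_def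
  by (intro continuous_intros) auto

lemma eventually_at_compl_range: "\<forall>\<^sub>F y in at (x k). y \<notin> range (x :: 'm::finite \<Rightarrow> real^3)"
proof -
  have "open (- (range x - {x k}))" by (intro open_Compl finite_imp_closed) simp
  hence "\<forall>\<^sub>F y in nhds (x k). y \<in> - (range x - {x k})"
    by (rule eventually_nhds_in_open) auto
  thus ?thesis by (auto simp: eventually_at_filter elim: eventually_mono)
qed

lemma tendsto_norm_at: "((\<lambda>y. norm (y - p)) \<longlongrightarrow> 0) (at (p :: real^3))"
  by (auto intro!: tendsto_eq_intros)

lemma point_sum_singularity:
  assumes x: "inj x"
  shows "((\<lambda>y. point_sum x c y * of_real (norm (y - x k))) \<longlongrightarrow> c $ k / (4 * of_real pi)) (at (x k))"
proof -
  have "((\<lambda>y. c $ j * yuk (x j) y * of_real (norm (y - x k))) \<longlongrightarrow> (if j = k then c $ k / (4 * of_real pi) else 0)) (at (x k))" for j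
  proof (cases "j = k")
    case True
    have "((\<lambda>y. c $ k * complex_of_real (exp (- norm (y - x k)) / (4 * pi))) \<longlongrightarrow> c $ k * complex_of_real (exp (- 0) / (4 * pi))) (at (x k))"
      by (intro tendsto_intros tendsto_norm_at) auto
    moreover have "\<forall>\<^sub>F y in at (x k). c $ k * complex_of_real (exp (- norm (y - x k)) / (4 * pi)) = c $ j * yuk (x j) y * of_real (norm (y - x k))"
      using True by (auto simp: eventually_at_filter yuk_def yukawa_def)
    ultimately show ?thesis using True by (auto intro: Lim_transform_eventually)
  next
    case False
    hence ne: "x k \<noteq> x j" using x by (auto dest: injD)
    have "((\<lambda>y. c $ j * yuk (x j) y * of_real (norm (y - x k))) \<longlongrightarrow> c $ j * yuk (x j) (x k) * of_real 0) (at (x k))"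
      unfolding yuk_def yukawa_def using ne by (intro tendsto_intros tendsto_norm_at) auto
    thus ?thesis using False by simp
  qed
  hence "((\<lambda>y. \<Sum>j\<in>UNIV. c $ j * yuk (x j) y * of_real (norm (y - x k))) \<longlongrightarrow> (\<Sum>j\<in>UNIV. if j = k then c $ k / (4 * of_real pi) else 0)) (at (x k))"
    by (rule tendsto_sum)
  thus ?thesis by (simp add: point_sum_def sum_distrib_right)
qed

text \<open>The value at \<open>x k\<close> of the potential centred at \<open>x j\<close>, after
  removal of its singularity if \<open>j = k\<close>: the diagonal entry is the limit of
  \<open>(exp (- r) - 1) / (4 * pi * r)\<close>. Entrywise this is \<open>E0 x\<close> divided by
  \<open>4 * pi\<close>.\<close>

definition Green_matrix :: "('m::finite \<Rightarrow> real^3) \<Rightarrow> 'm \<Rightarrow> 'm \<Rightarrow> real" where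
  "Green_matrix x k j = (if j = k then - 1 / (4 * pi) else yukawa (x k - x j))"

lemma Green_matrix_sym: "Green_matrix x k j = Green_matrix x j k"
  by (simp add: Green_matrix_def yukawa_commute)

lemma exp_minus_one_tendsto: "((\<lambda>r::real. (exp (- r) - 1) / r) \<longlongrightarrow> - 1) (at_right 0)"
  by real_asymp

lemma point_sum_regular_part:
  assumes x: "inj x"
  shows "((\<lambda>y. point_sum x c y - c $ k / (4 * of_real pi) / of_real (norm (y - x k))) \<longlongrightarrow>
    (\<Sum>j\<in>UNIV. of_real (Green_matrix x k j) * c $ j)) (at (x k))"
proof -
  \<comment> \<open>Only the term centred at \<open>x k\<close> is singular there, so the whole
    subtracted singularity is assigned to it; the other terms are continuous at
    \<open>x k\<close>.\<close>
  have 1: "((\<lambda>y. c $ j * (yuk (x j) y - (if j = k then 1 / of_real (4 * pi * norm (y - x k)) else 0))) \<longlongrightarrow>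
      c $ j * of_real (Green_matrix x k j)) (at (x k))" for j
  proof (cases "j = k")
    case True
    have "filterlim (\<lambda>y. norm (y - x k)) (at_right 0) (at (x k))"
      unfolding filterlim_at by (auto simp: tendsto_norm_at eventually_at_filter)
    from filterlim_compose[OF exp_minus_one_tendsto this]
    have "((\<lambda>y. c $ k * complex_of_real ((exp (- norm (y - x k)) - 1) / norm (y - x k) * (1 / (4 * pi)))) \<longlongrightarrow> c $ k * of_real (- 1 * (1 / (4 * pi)))) (at (x k))"
      by (intro tendsto_intros)
    moreover have "c $ k * complex_of_real ((exp (- norm (y - x k)) - 1) / norm (y - x k) * (1 / (4 * pi))) =
        c $ j * (yuk (x j) y - (if j = k then 1 / of_real (4 * pi * norm (y - x k)) else 0))" for y
    proof -
      have "(exp (- r) - 1) / r * (1 / (4 * pi)) = exp (- r) / (4 * pi * r) - 1 / (4 * pi * r)" for r :: real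
        by (cases "r = 0") (simp_all add: field_simps)
      thus ?thesis
        using True by (simp only: yuk_def yukawa_def of_real_diff of_real_divide of_real_1 if_True refl)
    qed
    ultimately show ?thesis
      using True by (simp add: Green_matrix_def)
  next
    case False
    hence ne: "x k \<noteq> x j" using x by (auto dest: injD)
    have "((\<lambda>y. c $ j * (yuk (x j) y - 0)) \<longlongrightarrow> c $ j * (yuk (x j) (x k) - 0)) (at (x k))"
      unfolding yuk_def yukawa_def using ne by (intro tendsto_intros) auto
    thus ?thesis using False by (simp add: Green_matrix_def yuk_def)
  qed
  have "((\<lambda>y. \<Sum>j\<in>UNIV. c $ j * (yuk (x j) y - (if j = k then 1 / of_real (4 * pi * norm (y - x k)) else 0))) \<longlongrightarrow>
      (\<Sum>j\<in>UNIV. c $ j * of_real (Green_matrix x k j))) (at (x k))"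
    by (intro tendsto_sum 1)
  moreover have "(\<Sum>j\<in>UNIV. c $ j * (yuk (x j) y - (if j = k then 1 / of_real (4 * pi * norm (y - x k)) else 0))) =
    point_sum x c y - c $ k / (4 * of_real pi) / of_real (norm (y - x k))" for y
  proof -
    have "(\<Sum>j\<in>UNIV. c $ j * (yuk (x j) y - (if j = k then 1 / of_real (4 * pi * norm (y - x k)) else 0))) =
      (\<Sum>j\<in>UNIV. c $ j * yuk (x j) y - (if j = k then c $ k / of_real (4 * pi * norm (y - x k)) else 0))"
      by (intro sum.cong) (auto simp: algebra_simps)
    thus ?thesis by (simp add: sum_subtractf point_sum_def)
  qed
  ultimately show ?thesis by (simp add: mult.commute)
qed

text \<open>The choice in \<open>cont_rep\<close> is harmless: two functions continuous off the
  points that agree almost everywhere agree there everywhere.\<close>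

lemma cont_rep_eq:
  assumes v: "continuous_on UNIV v" and ae: "ae_eq f (\<lambda>y. v y + point_sum x c y)" and y: "y \<notin> range x"
  shows "cont_rep x f y = v y + point_sum x c y"
proof -
  have c: "continuous_on (- range x) (\<lambda>y. v y + point_sum x c y)"
    using continuous_on_subset[OF v] by (intro continuous_on_add continuous_on_point_sum) auto
  have "continuous_on (- range x) (cont_rep x f) \<and> ae_eq f (cont_rep x f)"
    using someI[of "\<lambda>g. continuous_on (- range x) g \<and> ae_eq f g", OF conjI[OF c ae]]
    unfolding cont_rep_def .
  thus ?thesis
    using continuous_ae_eq_imp_eq[OF open_compl_range _ c ae_eq_trans[OF ae_eq_sym ae]] y by blast
qed

lemma sing_coeff_eq:
  assumes x: "inj x" and v: "continuous_on UNIV v" and ae: "ae_eq f (\<lambda>y. v y + point_sum x c y)"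
  shows "sing_coeff x f k = c $ k / (4 * of_real pi)"
proof -
  have "isCont v (x k)" using v by (simp add: continuous_on_eq_continuous_at)
  hence "(v \<longlongrightarrow> v (x k)) (at (x k))" by (simp add: isCont_def)
  hence "((\<lambda>y. v y * of_real (norm (y - x k)) + point_sum x c y * of_real (norm (y - x k))) \<longlongrightarrow> v (x k) * of_real 0 + c $ k / (4 * of_real pi)) (at (x k))"
    by (intro tendsto_add tendsto_mult tendsto_of_real tendsto_norm_at point_sum_singularity x)
  hence "((\<lambda>y. cont_rep x f y * of_real (norm (y - x k))) \<longlongrightarrow> v (x k) * of_real 0 + c $ k / (4 * of_real pi)) (at (x k))"
    by (rule Lim_transform_eventually)
       (use eventually_at_compl_range[of x k] in \<open>auto elim!: eventually_mono simp: cont_rep_eq[OF v ae] distrib_right\<close>)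
  hence "((\<lambda>y. cont_rep x f y * of_real (norm (y - x k))) \<longlongrightarrow> c $ k / (4 * of_real pi)) (at (x k))" by simp
  thus ?thesis unfolding sing_coeff_def by (intro tendsto_Lim) auto
qed

lemma Gamma0_eq:
  assumes "inj x" "continuous_on UNIV v" "ae_eq f (\<lambda>y. v y + point_sum x c y)"
  shows "Gamma0 x f = c"
  using sing_coeff_eq[OF assms] by (simp add: Gamma0_def vec_eq_iff)

lemma Gamma1_eq:
  assumes x: "inj x" and v: "continuous_on UNIV v" and ae: "ae_eq f (\<lambda>y. v y + point_sum x c y)"
  shows "Gamma1 x f = (\<chi> k. v (x k) + (\<Sum>j\<in>UNIV. of_real (Green_matrix x k j) * c $ j))"
proof -
  have "Lim (at (x k)) (\<lambda>y. cont_rep x f y - sing_coeff x f k / of_real (norm (y - x k))) =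
    v (x k) + (\<Sum>j\<in>UNIV. of_real (Green_matrix x k j) * c $ j)" for k
  proof (rule tendsto_Lim)
    have "isCont v (x k)" using v by (simp add: continuous_on_eq_continuous_at)
    hence "(v \<longlongrightarrow> v (x k)) (at (x k))" by (simp add: isCont_def)
    hence "((\<lambda>y. v y + (point_sum x c y - c $ k / (4 * of_real pi) / of_real (norm (y - x k)))) \<longlongrightarrow>
      v (x k) + (\<Sum>j\<in>UNIV. of_real (Green_matrix x k j) * c $ j)) (at (x k))"
      by (intro tendsto_add point_sum_regular_part x)
    thus "((\<lambda>y. cont_rep x f y - sing_coeff x f k / of_real (norm (y - x k))) \<longlongrightarrow>
      v (x k) + (\<Sum>j\<in>UNIV. of_real (Green_matrix x k j) * c $ j)) (at (x k))"
      by (rule Lim_transform_eventually)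
         (use eventually_at_compl_range[of x k] in \<open>auto elim!: eventually_mono simp: cont_rep_eq[OF v ae] sing_coeff_eq[OF x v ae]\<close>)
  qed simp
  thus ?thesis by (simp add: Gamma1_def)
qed

text \<open>Independence of the potentials is read off from the boundary map: \<open>Gamma0\<close>
  of the zero function is computed from two representations.\<close>

lemma point_sum_ae_zero:
  assumes "inj x" "ae_eq (point_sum x c) (\<lambda>_. 0)" shows "c = 0"
proof -
  have "Gamma0 x (\<lambda>_. 0) = c"
    using ae_eq_sym[OF assms(2)] by (intro Gamma0_eq[of x "\<lambda>_. 0"] assms(1)) auto
  moreover have "Gamma0 x (\<lambda>_. 0) = 0"
    by (intro Gamma0_eq[of x "\<lambda>_. 0"] assms(1)) (auto simp: point_sum_def)
  ultimately show ?thesis by simp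
qed

text \<open>Up to a factor, \<open>E1\<close> is the Gram matrix of the translated Yukawa potentials.\<close>

lemma invertible_E1: assumes x: "inj x" shows "invertible (E1 x)"
proof -
  have "c = 0" if c: "E1 x *v c = 0" for c
  proof -
    have r: "resolvent (point_sum x c) (x k) = 0" for k
      using c by (simp add: resolvent_point_sum_at)
    have "of_real (L2_sq (point_sum x c)) = (LINT y|lborel. point_sum x c y * cnj (point_sum x c y))"
      unfolding L2_sq_def integral_complex_of_real[symmetric]
      by (intro Bochner_Integration.integral_cong refl) (simp only: complex_norm_square)
    also have "\<dots> = 0"
      by (simp add: integral_mult_point_sum(2)[OF point_sum_L2] r)
    finally have "L2_sq (point_sum x c) = 0" by simp
    thus ?thesis
      using point_sum_ae_zero[OF x] L2_sq_eq_0D[OF point_sum_L2] by blast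
  qed
  thus ?thesis
    by (simp add: invertible_left_inverse matrix_left_invertible_ker)
qed

lemma matrix_inv_right:
  fixes A :: "'a::semiring_1^'n^'m"
  assumes "invertible A" shows "A ** matrix_inv A = mat 1"
  using assms unfolding invertible_def matrix_inv_def by (rule someI2_ex) blast

lemma point_sum_interpolation:
  assumes "inj x" obtains c where "\<And>k. resolvent (point_sum x c) (x k) = b $ k"
proof
  fix k
  \<comment> \<open>The factor \<open>8 * pi\<close> undoes the denominator in
    \<open>resolvent_point_sum_at\<close>.\<close>
  let ?c = "matrix_inv (E1 x) *v ((8 * of_real pi) *s b)"
  have "E1 x *v ?c = (8 * of_real pi) *s b"
    using invertible_E1[OF assms] by (simp add: matrix_vector_mul_assoc matrix_inv_right)
  thus "resolvent (point_sum x ?c) (x k) = b $ k"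
    by (simp add: resolvent_point_sum_at)
qed

section \<open>The maximal operator and its boundary values\<close>

definition max_rep :: "('m::finite \<Rightarrow> real^3) \<Rightarrow> fn3 \<Rightarrow> fn3 \<Rightarrow> complex^'m \<Rightarrow> bool" where
  "max_rep x f g c \<longleftrightarrow> f \<in> L2 \<and> g \<in> L2 \<and> ae_eq f (\<lambda>y. resolvent (\<lambda>y. f y + g y) y + point_sum x c y)"

lemma L2_inner_diff:
  assumes "f \<in> L2" "g \<in> L2" "h \<in> L2"
  shows "L2_inner (\<lambda>y. f y - g y) h = L2_inner f h - L2_inner g h"
    and "L2_inner h (\<lambda>y. f y - g y) = L2_inner h f - L2_inner h g"
  using assms by (simp_all add: L2_inner_def left_diff_distrib right_diff_distrib L2_mult_integrable L2_cnj)

lemma L2_inner_add: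
  assumes "f \<in> L2" "g \<in> L2" "h \<in> L2"
  shows "L2_inner (\<lambda>y. f y + g y) h = L2_inner f h + L2_inner g h"
    and "L2_inner h (\<lambda>y. f y + g y) = L2_inner h f + L2_inner h g"
  using assms by (simp_all add: L2_inner_def distrib_left distrib_right L2_mult_integrable L2_cnj)

lemma L2_inner_ae_eq:
  assumes "ae_eq f f'" "f \<in> L2" "f' \<in> L2" "g \<in> L2"
  shows "L2_inner f g = L2_inner f' g" "L2_inner g f = L2_inner g f'"
proof -
  show "L2_inner f g = L2_inner f' g"
    unfolding L2_inner_def using assms by (intro integral_ae_eq) auto
  have "ae_eq (\<lambda>y. cnj (f y)) (\<lambda>y. cnj (f' y))" using assms(1) by (auto simp: ae_eq_def elim: eventually_mono)
  hence "(LINT y|lborel. cnj (f y) * g y) = (LINT y|lborel. cnj (f' y) * g y)"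
    using assms by (intro integral_ae_eq) auto
  thus "L2_inner g f = L2_inner g f'" by (simp add: L2_inner_def mult.commute)
qed

lemma L2_inner_resolvent:
  assumes "f \<in> L2" "g \<in> L2"
  shows "L2_inner (resolvent f) g = L2_inner f (resolvent g)"
  using resolvent_symmetric[OF assms(1) L2_cnj[OF assms(2)]] by (simp add: L2_inner_def resolvent_cnj)

lemma L2_inner_point_sum:
  assumes "h \<in> L2"
  shows "L2_inner h (point_sum x c) = (\<Sum>j\<in>UNIV. cnj (c $ j) * resolvent h (x j))"
    and "L2_inner (point_sum x c) h = (\<Sum>j\<in>UNIV. c $ j * cnj (resolvent h (x j)))"
  using integral_mult_point_sum(2)[OF assms, of x c] integral_mult_point_sum(1)[OF L2_cnj[OF assms], of x c]
  by (simp_all add: L2_inner_def mult.commute resolvent_cnj)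

lemma L2_inner_self: "L2_inner f f = of_real (L2_sq f)"
  unfolding L2_sq_def integral_complex_of_real[symmetric] L2_inner_def
  by (intro Bochner_Integration.integral_cong refl) (simp only: complex_norm_square)

lemma max_rep_inner:
  assumes r: "max_rep x f g c" and h: "h \<in> L2"
  shows "L2_inner h f = L2_inner (resolvent h) (\<lambda>y. f y + g y) + (\<Sum>j\<in>UNIV. cnj (c $ j) * resolvent h (x j))"
    and "L2_inner f h = L2_inner (\<lambda>y. f y + g y) (resolvent h) + (\<Sum>j\<in>UNIV. c $ j * cnj (resolvent h (x j)))"
proof -
  let ?k = "\<lambda>y. f y + g y"
  have fg: "f \<in> L2" "g \<in> L2" and ae: "ae_eq f (\<lambda>y. resolvent ?k y + point_sum x c y)"
    using r by (auto simp: max_rep_def)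
  have k: "?k \<in> L2" using fg by auto
  have L: "(\<lambda>y. resolvent ?k y + point_sum x c y) \<in> L2" using k by auto
  show "L2_inner h f = L2_inner (resolvent h) ?k + (\<Sum>j\<in>UNIV. cnj (c $ j) * resolvent h (x j))"
    unfolding L2_inner_ae_eq(2)[OF ae fg(1) L h]
    by (simp only: L2_inner_add resolvent_L2 k point_sum_L2 h L2_inner_point_sum L2_inner_resolvent)
  show "L2_inner f h = L2_inner ?k (resolvent h) + (\<Sum>j\<in>UNIV. c $ j * cnj (resolvent h (x j)))"
    unfolding L2_inner_ae_eq(1)[OF ae fg(1) L h]
    by (simp only: L2_inner_add resolvent_L2 k point_sum_L2 h L2_inner_point_sum L2_inner_resolvent)
qed

text \<open>For a pair in the adjoint, \<open>w = f - R (f + g)\<close> is orthogonal to every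
  \<open>h\<close> whose resolvent vanishes at the points. Subtracting from \<open>w\<close> a
  combination of potentials whose resolvent has the same point values leaves a \<open>v\<close> that
  is itself such an \<open>h\<close>. It is orthogonal to \<open>w\<close> and to the combination,
  hence to itself. Interpolation thus replaces a projection onto the span of the potentials.\<close>

lemma H_max_iff:
  assumes x: "inj x"
  shows "(f, g) \<in> H_max x \<longleftrightarrow> (\<exists>c. max_rep x f g c)"
proof
  assume "\<exists>c. max_rep x f g c"
  then obtain c where r: "max_rep x f g c" by blast
  hence fg: "f \<in> L2" "g \<in> L2" by (auto simp: max_rep_def)
  have "L2_inner u' f = L2_inner u g" if "(u, u') \<in> H_min x" for u u'
  proof -
    let ?h = "\<lambda>y. u y + u' y"
    from that have u: "u \<in> L2" "u' \<in> L2" "ae_eq u (resolvent ?h)" "\<And>j. resolvent ?h (x j) = 0"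
      by (auto simp: H_min_iff)
    have h: "?h \<in> L2" using u by auto
    have "L2_inner u' f = L2_inner ?h f - L2_inner u f"
      using L2_inner_add(1)[OF u(1,2) fg(1)] by simp
    also have "L2_inner ?h f = L2_inner (resolvent ?h) (\<lambda>y. f y + g y)"
      using max_rep_inner(1)[OF r h] u(4) by simp
    also have "\<dots> = L2_inner u (\<lambda>y. f y + g y)"
      using L2_inner_ae_eq(1)[OF u(3,1) resolvent_L2[OF h] L2_add[OF fg]] by simp
    also have "\<dots> = L2_inner u f + L2_inner u g"
      by (rule L2_inner_add(2)[OF fg u(1)])
    finally show ?thesis by simp
  qed
  thus "(f, g) \<in> H_max x" using fg by (auto simp: H_max_def L2_adjoint_def)
next
  assume "(f, g) \<in> H_max x"
  hence fg: "f \<in> L2" "g \<in> L2" and adj: "\<And>u u'. (u, u') \<in> H_min x \<Longrightarrow> L2_inner u' f = L2_inner u g"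
    by (auto simp: H_max_def L2_adjoint_def)
  let ?k = "\<lambda>y. f y + g y"
  define w where "w y = f y - resolvent ?k y" for y
  have k: "?k \<in> L2" using fg by auto
  have w: "w \<in> L2" unfolding w_def[abs_def] using fg k by auto
  have ort: "L2_inner h w = 0" if h: "h \<in> L2" and z: "\<And>j. resolvent h (x j) = 0" for h
  proof -
    have "L2_inner (\<lambda>y. h y - resolvent h y) f = L2_inner (resolvent h) g"
      by (rule adj[OF resolvent_in_H_min[OF h z]])
    hence "L2_inner h f = L2_inner (resolvent h) ?k"
      using h fg by (simp add: L2_inner_diff L2_inner_add resolvent_L2 algebra_simps)
    thus ?thesis
      unfolding w_def[abs_def] using h fg k by (simp add: L2_inner_diff L2_inner_resolvent resolvent_L2)
  qed
  obtain c where c: "\<And>j. resolvent (point_sum x c) (x j) = (\<chi> j. resolvent w (x j)) $ j"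
    using point_sum_interpolation[OF x] by blast
  define v where "v y = w y - point_sum x c y" for y
  have v: "v \<in> L2" unfolding v_def[abs_def] using w by auto
  have vz: "resolvent v (x j) = 0" for j
    unfolding v_def[abs_def] using c[of j] by (simp add: resolvent_diff w point_sum_L2)
  have "L2_inner v v = L2_inner v w - L2_inner v (point_sum x c)"
    unfolding v_def[abs_def] by (rule L2_inner_diff(2)) (use w v in \<open>auto simp: v_def[abs_def]\<close>)
  also have "\<dots> = 0"
    using ort[OF v vz] vz by (simp add: L2_inner_point_sum(1)[OF v])
  finally have "ae_eq v (\<lambda>_. 0)" by (intro L2_sq_eq_0D[OF v]) (simp add: L2_inner_self)
  hence "ae_eq f (\<lambda>y. resolvent ?k y + point_sum x c y)"
    by (auto simp: ae_eq_def v_def w_def algebra_simps elim: eventually_mono)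
  thus "\<exists>c. max_rep x f g c" using fg by (auto simp: max_rep_def)
qed

lemma H_maxE:
  assumes "inj x" "(f, g) \<in> H_max x"
  obtains c where "max_rep x f g c"
  using assms H_max_iff by blast

lemma max_rep_Gamma:
  assumes "inj x" "max_rep x f g c"
  shows "Gamma0 x f = c"
    and "Gamma1 x f $ k = resolvent (\<lambda>y. f y + g y) (x k) + (\<Sum>j\<in>UNIV. of_real (Green_matrix x k j) * c $ j)"
proof -
  have ae: "ae_eq f (\<lambda>y. resolvent (\<lambda>y. f y + g y) y + point_sum x c y)"
    and v: "continuous_on UNIV (resolvent (\<lambda>y. f y + g y))"
    using assms(2) by (auto simp: max_rep_def intro: resolvent_continuous)
  show "Gamma0 x f = c" by (rule Gamma0_eq[OF assms(1) v ae])
  show "Gamma1 x f $ k = resolvent (\<lambda>y. f y + g y) (x k) + (\<Sum>j\<in>UNIV. of_real (Green_matrix x k j) * c $ j)"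
    using Gamma1_eq[OF assms(1) v ae] by simp
qed

lemma max_rep_resolvent:
  assumes k: "k \<in> L2"
  shows "max_rep x (\<lambda>y. resolvent k y + point_sum x c y) (\<lambda>y. k y - (resolvent k y + point_sum x c y)) c"
proof -
  have f: "(\<lambda>y. resolvent k y + point_sum x c y) \<in> L2" by (intro L2_add resolvent_L2 k point_sum_L2)
  thus ?thesis using L2_diff[OF k f] by (simp add: max_rep_def)
qed

lemma max_rep_add:
  assumes "max_rep x f g c" "max_rep x f' g' c'"
  shows "max_rep x (\<lambda>y. f y + f' y) (\<lambda>y. g y + g' y) (c + c')"
proof -
  have L: "f \<in> L2" "g \<in> L2" "f' \<in> L2" "g' \<in> L2" using assms by (auto simp: max_rep_def)
  have "resolvent (\<lambda>y. f y + f' y + (g y + g' y)) y = resolvent (\<lambda>y. f y + g y) y + resolvent (\<lambda>y. f' y + g' y) y" for y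
    using resolvent_add[OF L2_add[OF L(1,2)] L2_add[OF L(3,4)], of y] by (simp add: ac_simps)
  hence "(\<lambda>y. resolvent (\<lambda>y. f y + f' y + (g y + g' y)) y + point_sum x (c + c') y) =
    (\<lambda>y. (resolvent (\<lambda>y. f y + g y) y + point_sum x c y) + (resolvent (\<lambda>y. f' y + g' y) y + point_sum x c' y))"
    by (simp add: point_sum_add ac_simps)
  thus ?thesis using L assms ae_eq_add unfolding max_rep_def by auto
qed

lemma max_rep_scale:
  assumes "max_rep x f g c"
  shows "max_rep x (\<lambda>y. a * f y) (\<lambda>y. a * g y) (a *s c)"
proof -
  have "(\<lambda>y. resolvent (\<lambda>y. a * f y + a * g y) y + point_sum x (a *s c) y) =
    (\<lambda>y. a * (resolvent (\<lambda>y. f y + g y) y + point_sum x c y))"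
    by (simp add: point_sum_scale resolvent_scale distrib_left[symmetric])
  thus ?thesis using assms ae_eq_scale unfolding max_rep_def by auto
qed

lemma max_rep_ae_eq:
  assumes r: "max_rep x f g c" and L: "f' \<in> L2" "g' \<in> L2" and ae: "ae_eq f f'" "ae_eq g g'"
  shows "max_rep x f' g' c"
proof -
  have fg: "f \<in> L2" "g \<in> L2" using r by (auto simp: max_rep_def)
  have "resolvent (\<lambda>y. f y + g y) = resolvent (\<lambda>y. f' y + g' y)"
    by (intro ext resolvent_cong ae_eq_add ae L2_add L fg)
  thus ?thesis using r L ae_eq_trans[OF ae_eq_sym[OF ae(1)]] unfolding max_rep_def by auto
qed

lemma Gamma_ae_eq:
  assumes "ae_eq f f'" shows "Gamma0 x f = Gamma0 x f'" "Gamma1 x f = Gamma1 x f'"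
proof -
  have "ae_eq f g \<longleftrightarrow> ae_eq f' g" for g
    using assms ae_eq_trans ae_eq_sym by blast
  hence "cont_rep x f = cont_rep x f'" by (simp add: cont_rep_def)
  thus "Gamma0 x f = Gamma0 x f'" "Gamma1 x f = Gamma1 x f'"
    by (simp_all add: Gamma0_def Gamma1_def sing_coeff_def)
qed

text \<open>\<open>f\<close> determines the coefficients through \<open>Gamma0\<close>, hence
  \<open>R (f + g)\<close>, hence \<open>f + g\<close> by injectivity of \<open>R\<close>.\<close>

lemma max_rep_unique:
  assumes x: "inj x" and r: "max_rep x f g c" and r': "max_rep x f' g' c'" and ae: "ae_eq f f'"
  shows "ae_eq g g'"
proof -
  let ?k = "\<lambda>y. f y + g y" and ?k' = "\<lambda>y. f' y + g' y"
  have L: "f \<in> L2" "g \<in> L2" "f' \<in> L2" "g' \<in> L2" using r r' by (auto simp: max_rep_def)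
  have k: "?k \<in> L2" "?k' \<in> L2" using L by auto
  have "c = c'" using max_rep_Gamma(1)[OF x r] max_rep_Gamma(1)[OF x r'] Gamma_ae_eq(1)[OF ae, of x] by simp
  hence "ae_eq (\<lambda>y. resolvent ?k y + point_sum x c y) (\<lambda>y. resolvent ?k' y + point_sum x c y)"
    using r r' ae unfolding max_rep_def by (meson ae_eq_trans ae_eq_sym)
  hence "ae_eq (resolvent (\<lambda>y. ?k y - ?k' y)) (\<lambda>_. 0)"
    unfolding ae_eq_def by eventually_elim (simp add: resolvent_diff[OF k])
  hence "ae_eq (\<lambda>y. ?k y - ?k' y) (\<lambda>_. 0)"
    by (rule resolvent_eq_zero_imp[OF L2_diff[OF k]])
  hence "AE y in lborel. ?k y - ?k' y = 0" by (simp only: ae_eq_def)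
  thus ?thesis using ae unfolding ae_eq_def by eventually_elim simp
qed

lemma H_min_max_rep: "(f, g) \<in> H_min x \<longleftrightarrow> max_rep x f g 0 \<and> (\<forall>j. resolvent (\<lambda>y. f y + g y) (x j) = 0)"
  by (auto simp: H_min_iff max_rep_def point_sum_def)

lemma H_min_iff_Gamma:
  assumes x: "inj x"
  shows "(f, g) \<in> H_min x \<longleftrightarrow> (f, g) \<in> H_max x \<and> Gamma0 x f = 0 \<and> Gamma1 x f = 0"
proof
  assume *: "(f, g) \<in> H_min x"
  hence r: "max_rep x f g 0" and z: "\<And>j. resolvent (\<lambda>y. f y + g y) (x j) = 0" by (auto simp: H_min_max_rep)
  show "(f, g) \<in> H_max x \<and> Gamma0 x f = 0 \<and> Gamma1 x f = 0"
    using H_max_iff[OF x] r max_rep_Gamma[OF x r] z by (auto simp: vec_eq_iff)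
next
  assume *: "(f, g) \<in> H_max x \<and> Gamma0 x f = 0 \<and> Gamma1 x f = 0"
  then obtain c where r: "max_rep x f g c" using H_maxE[OF x] by blast
  have "c = 0" using max_rep_Gamma(1)[OF x r] * by simp
  moreover have "resolvent (\<lambda>y. f y + g y) (x k) = 0" for k
    using max_rep_Gamma(2)[OF x r, of k] * \<open>c = 0\<close> by simp
  ultimately show "(f, g) \<in> H_min x" using r by (simp add: H_min_max_rep)
qed

section \<open>Linearity, surjectivity and Green's identity\<close>

lemma Gamma_add:
  assumes x: "inj x" and "(f, g) \<in> H_max x" "(f', g') \<in> H_max x"
  shows "(\<lambda>y. f y + f' y, \<lambda>y. g y + g' y) \<in> H_max x"
    and "Gamma0 x (\<lambda>y. f y + f' y) = Gamma0 x f + Gamma0 x f'"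
    and "Gamma1 x (\<lambda>y. f y + f' y) = Gamma1 x f + Gamma1 x f'"
proof -
  obtain c c' where r: "max_rep x f g c" "max_rep x f' g' c'"
    using assms H_maxE[OF x] by metis
  note s = max_rep_add[OF r]
  have L: "f \<in> L2" "g \<in> L2" "f' \<in> L2" "g' \<in> L2" using r by (auto simp: max_rep_def)
  show "(\<lambda>y. f y + f' y, \<lambda>y. g y + g' y) \<in> H_max x" using s H_max_iff[OF x] by blast
  show "Gamma0 x (\<lambda>y. f y + f' y) = Gamma0 x f + Gamma0 x f'"
    using max_rep_Gamma(1)[OF x] s r by metis
  have "resolvent (\<lambda>y. f y + f' y + (g y + g' y)) y = resolvent (\<lambda>y. f y + g y) y + resolvent (\<lambda>y. f' y + g' y) y" for y
    using resolvent_add[OF L2_add[OF L(1,2)] L2_add[OF L(3,4)], of y] by (simp add: ac_simps)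
  thus "Gamma1 x (\<lambda>y. f y + f' y) = Gamma1 x f + Gamma1 x f'"
    using max_rep_Gamma(2)[OF x s] max_rep_Gamma(2)[OF x r(1)] max_rep_Gamma(2)[OF x r(2)]
    by (simp add: vec_eq_iff distrib_left sum.distrib)
qed

lemma Gamma_scale:
  assumes x: "inj x" and "(f, g) \<in> H_max x"
  shows "(\<lambda>y. a * f y, \<lambda>y. a * g y) \<in> H_max x"
    and "Gamma0 x (\<lambda>y. a * f y) = a *s Gamma0 x f"
    and "Gamma1 x (\<lambda>y. a * f y) = a *s Gamma1 x f"
proof -
  obtain c where r: "max_rep x f g c"
    using assms H_maxE[OF x] by metis
  note s = max_rep_scale[OF r, of a]
  show "(\<lambda>y. a * f y, \<lambda>y. a * g y) \<in> H_max x" using s H_max_iff[OF x] by blast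
  show "Gamma0 x (\<lambda>y. a * f y) = a *s Gamma0 x f"
    using max_rep_Gamma(1)[OF x] s r by metis
  have "resolvent (\<lambda>y. a * f y + a * g y) y = a * resolvent (\<lambda>y. f y + g y) y" for y
    by (simp add: resolvent_scale distrib_left[symmetric])
  thus "Gamma1 x (\<lambda>y. a * f y) = a *s Gamma1 x f"
    using max_rep_Gamma(2)[OF x s] max_rep_Gamma(2)[OF x r]
    by (simp add: vec_eq_iff distrib_left sum_distrib_left mult.left_commute)
qed

lemma H_max_ae_eq:
  assumes "inj x" "(f, g) \<in> H_max x" "f' \<in> L2" "g' \<in> L2" "ae_eq f f'" "ae_eq g g'"
  shows "(f', g') \<in> H_max x"
  using assms max_rep_ae_eq H_max_iff[OF assms(1)] by metis

lemma H_max_L2: "(f, g) \<in> H_max x \<Longrightarrow> f \<in> L2 \<and> g \<in> L2"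
  by (auto simp: H_max_def L2_adjoint_def)

lemma H_max_single_valued:
  assumes "inj x" "(f, g) \<in> H_max x" "(f', g') \<in> H_max x" "ae_eq f f'"
  shows "ae_eq g g'"
  using assms max_rep_unique[OF assms(1)] H_max_iff[OF assms(1)] by metis

lemma Gamma_surj:
  assumes x: "inj x"
  obtains f g where "(f, g) \<in> H_max x" "Gamma0 x f = a" "Gamma1 x f = b"
proof -
  \<comment> \<open>With \<open>a\<close> as coefficient vector, the Green matrix already
    contributes to \<open>Gamma1\<close>; the point values of the resolvent have to supply the
    difference to \<open>b\<close>.\<close>
  obtain d where d: "\<And>k. resolvent (point_sum x d) (x k) =
      (\<chi> k. b $ k - (\<Sum>j\<in>UNIV. of_real (Green_matrix x k j) * a $ j)) $ k"
    using point_sum_interpolation[OF x] by blast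
  let ?k = "point_sum x d"
  let ?f = "\<lambda>y. resolvent ?k y + point_sum x a y"
  let ?g = "\<lambda>y. ?k y - ?f y"
  have r: "max_rep x ?f ?g a" by (rule max_rep_resolvent[OF point_sum_L2])
  have "(\<lambda>y. ?f y + ?g y) = ?k" by auto
  hence "Gamma1 x ?f = b"
    using max_rep_Gamma(2)[OF x r] d by (simp add: vec_eq_iff)
  thus ?thesis using that[of ?f ?g] H_max_iff[OF x] r max_rep_Gamma(1)[OF x r] by blast
qed

text \<open>Adding the inner product of \<open>f\<close> and \<open>f'\<close> to both terms
  replaces \<open>g\<close> and \<open>g'\<close> by \<open>f + g\<close> and
  \<open>f' + g'\<close>. The resolvent terms then cancel by symmetry of \<open>R\<close>, and the
  contributions of the Green matrix cancel because it is real and symmetric.\<close>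

lemma Green_identity:
  assumes x: "inj x" and "(f, g) \<in> H_max x" "(f', g') \<in> H_max x"
  shows "L2_inner g f' - L2_inner f g' = cinner (Gamma1 x f) (Gamma0 x f') - cinner (Gamma0 x f) (Gamma1 x f')"
proof -
  obtain c c' where r: "max_rep x f g c" "max_rep x f' g' c'"
    using assms H_maxE[OF x] by metis
  have L: "f \<in> L2" "g \<in> L2" "f' \<in> L2" "g' \<in> L2" using r by (auto simp: max_rep_def)
  let ?k = "\<lambda>y. f y + g y" and ?k' = "\<lambda>y. f' y + g' y"
  have k: "?k \<in> L2" "?k' \<in> L2" using L by auto
  have "L2_inner g f' - L2_inner f g' = L2_inner ?k f' - L2_inner f ?k'"
    using L by (simp add: L2_inner_add)
  also have "\<dots> = (\<Sum>j\<in>UNIV. cnj (c' $ j) * resolvent ?k (x j)) - (\<Sum>j\<in>UNIV. c $ j * cnj (resolvent ?k' (x j)))"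
    using max_rep_inner(1)[OF r(2) k(1)] max_rep_inner(2)[OF r(1) k(2)] L2_inner_resolvent[OF k] by simp
  finally have 1: "L2_inner g f' - L2_inner f g' =
    (\<Sum>j\<in>UNIV. cnj (c' $ j) * resolvent ?k (x j)) - (\<Sum>j\<in>UNIV. c $ j * cnj (resolvent ?k' (x j)))" .
  let ?Q = "\<lambda>k j. complex_of_real (Green_matrix x k j)"
  have "cinner (Gamma1 x f) (Gamma0 x f') =
    (\<Sum>k\<in>UNIV. cnj (c' $ k) * resolvent ?k (x k)) + (\<Sum>k\<in>UNIV. \<Sum>j\<in>UNIV. ?Q k j * c $ j * cnj (c' $ k))"
    by (simp add: cinner_def max_rep_Gamma(1)[OF x r(2)] max_rep_Gamma(2)[OF x r(1)] distrib_right sum.distrib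
        sum_distrib_right mult.commute[of "cnj _" "resolvent _ _"])
  moreover have "cinner (Gamma0 x f) (Gamma1 x f') =
    (\<Sum>k\<in>UNIV. c $ k * cnj (resolvent ?k' (x k))) + (\<Sum>k\<in>UNIV. \<Sum>j\<in>UNIV. c $ k * (?Q k j * cnj (c' $ j)))"
    by (simp add: cinner_def max_rep_Gamma(1)[OF x r(1)] max_rep_Gamma(2)[OF x r(2)] distrib_left sum.distrib
        sum_distrib_left)
  moreover have "(\<Sum>k\<in>UNIV. \<Sum>j\<in>UNIV. ?Q k j * c $ j * cnj (c' $ k)) = (\<Sum>k\<in>UNIV. \<Sum>j\<in>UNIV. c $ k * (?Q k j * cnj (c' $ j)))"
    by (subst sum.swap) (intro sum.cong refl, simp add: Green_matrix_sym mult.commute mult.left_commute)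
  ultimately show ?thesis unfolding 1 by simp
qed

text \<open>The explicit form demanded in \<open>H_ext\<close> is automatic. A combination of
  potentials is split off from \<open>f + g\<close> so that the resolvent of the remainder vanishes
  at the points; that resolvent is the component in \<open>dom_H\<close>.\<close>

lemma H_ext_iff:
  assumes x: "inj x"
  shows "(f, g) \<in> H_ext x \<Theta> \<longleftrightarrow> (f, g) \<in> H_max x \<and> (Gamma0 x f, Gamma1 x f) \<in> \<Theta>"
proof
  assume *: "(f, g) \<in> H_max x \<and> (Gamma0 x f, Gamma1 x f) \<in> \<Theta>"
  then obtain c where r: "max_rep x f g c" using H_maxE[OF x] by blast
  let ?k = "\<lambda>y. f y + g y"
  have k: "?k \<in> L2" using r by (auto simp: max_rep_def)
  obtain d where d: "\<And>j. resolvent (point_sum x d) (x j) = (\<chi> j. resolvent ?k (x j)) $ j"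
    using point_sum_interpolation[OF x] by blast
  let ?h = "\<lambda>y. ?k y - point_sum x d y"
  have h: "?h \<in> L2" using k by auto
  have "resolvent ?h (x j) = 0" for j
    using d[of j] by (simp add: resolvent_diff k point_sum_L2)
  from resolvent_in_H_min[where x=x, OF h this] have fH: "resolvent ?h \<in> dom_H x" by (auto simp: H_min_def)
  \<comment> \<open>The denominators are those of \<open>yukawa\<close> and of
    \<open>resolvent_point_sum\<close>.\<close>
  let ?\<xi>0 = "\<chi> j. c $ j / (4 * of_real pi)" and ?\<xi>1 = "\<chi> j. d $ j / (8 * of_real pi)"
  have "resolvent ?k y + point_sum x c y = (\<Sum>j\<in>UNIV. ?\<xi>0 $ j * of_real (exp (- norm (y - x j)) / norm (y - x j))
      + ?\<xi>1 $ j * of_real (exp (- norm (y - x j)))) + resolvent ?h y" for y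
  proof -
    have 1: "resolvent ?k y = resolvent ?h y + resolvent (point_sum x d) y"
      by (simp add: resolvent_diff k point_sum_L2)
    show ?thesis
      unfolding 1 resolvent_point_sum by (simp add: point_sum_def[of x c] sum.distrib yuk_def yukawa_def)
  qed
  hence "ae_eq f (\<lambda>y. (\<Sum>j\<in>UNIV. ?\<xi>0 $ j * of_real (exp (- norm (y - x j)) / norm (y - x j))
      + ?\<xi>1 $ j * of_real (exp (- norm (y - x j)))) + resolvent ?h y)"
    using r by (simp only: max_rep_def)
  thus "(f, g) \<in> H_ext x \<Theta>"
    using * fH unfolding H_ext_def by blast
qed (auto simp: H_ext_def)

section \<open>Self-adjoint extensions\<close>

text \<open>Bumps on boxes shrinking to \<open>p\<close> keep the value \<open>1\<close> at
  \<open>p\<close>, while their norms tend to \<open>0\<close> because a point is a null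
  set.\<close>

lemma small_test_function:
  assumes F: "finite F" "p \<notin> F" and \<delta>: "0 < \<delta>"
  obtains \<eta> where "test_function \<eta>" "\<eta> p = 1" "\<And>q. q \<in> F \<Longrightarrow> \<eta> q = 0" "L2_sq (of_real_fun \<eta>) < \<delta>"
proof -
  define a b where "a n = p - (\<chi> i. inverse (real (Suc n)))" and "b n = p + (\<chi> i. inverse (real (Suc n)))" for n
  \<comment> \<open>The scale \<open>Suc n\<close> matches the half-width of the box, so at
    \<open>p\<close> each of the six factors of the bump is \<open>flat 1 1 = exp (- 1)\<close>;
    \<open>exp 6\<close> normalizes their product.\<close>
  define \<eta> where "\<eta> n y = exp 6 * box_bump (real (Suc n)) (a n) (b n) y" for n y
  have pos: "0 < real (Suc n)" for n by simp
  have t: "test_function (\<eta> n)" for n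
    unfolding \<eta>_def by (intro test_function_cmult test_function_box_bump pos)
  have one: "\<eta> n p = 1" for n
  proof -
    have "flat 1 (real (Suc n) * inverse (real (Suc n))) = exp (- 1)"
      by (simp add: flat_def del: of_nat_Suc)
    hence "box_bump (real (Suc n)) (a n) (b n) p = (exp (- 1) * exp (- 1)) ^ 3"
      unfolding box_bump_def a_def b_def by (simp del: of_nat_Suc)
    also have "\<dots> = exp (- 6)"
      by (simp add: exp_add[symmetric] exp_of_nat_mult[symmetric])
    finally show ?thesis by (simp add: \<eta>_def exp_add[symmetric])
  qed
  have ev: "\<forall>\<^sub>F n in sequentially. \<eta> n y = 0" if "y \<noteq> p" for y
  proof -
    from that obtain i where i: "y $ i \<noteq> p $ i" by (auto simp: vec_eq_iff)
    have "\<forall>\<^sub>F n in sequentially. inverse (real (Suc n)) < \<bar>y $ i - p $ i\<bar>"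
      using order_tendstoD(2)[OF LIMSEQ_inverse_real_of_nat, of "\<bar>y $ i - p $ i\<bar>"] i by simp
    thus ?thesis
    proof eventually_elim
      fix n assume "inverse (real (Suc n)) < \<bar>y $ i - p $ i\<bar>"
      hence "y \<notin> box (a n) (b n)"
        by (auto simp: mem_box_cart a_def b_def abs_if intro!: exI[of _ i] split: if_splits simp del: of_nat_Suc)
      thus "\<eta> n y = 0" unfolding \<eta>_def using box_bump_outside[OF pos] by simp
    qed
  qed
  \<comment> \<open>The pointwise limit is the indicator of \<open>{p}\<close>, not
    \<open>0\<close>; the difference disappears almost everywhere.\<close>
  have "(\<lambda>n. L2_sq (\<lambda>y. of_real_fun (\<eta> n) y - indicator {p} y)) \<longlonglongrightarrow> 0"
  proof (rule L2_dominated_convergence)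
    show "of_real_fun (\<eta> n) \<in> borel_measurable borel" for n
      by (intro L2_measurable test_function_L2 t)
    show "(\<lambda>y. exp 6 * indicator (box (a 0) (b 0)) y :: complex) \<in> L2"
      by (intro L2_scale indicator_L2) auto
    show "norm (of_real_fun (\<eta> n) y) \<le> norm (exp 6 * indicator (box (a 0) (b 0)) y :: complex)" for n y
    proof (cases "y \<in> box (a 0) (b 0)")
      case True
      have "\<bar>\<eta> n y\<bar> \<le> exp 6 * 1"
        unfolding \<eta>_def abs_mult using box_bump_bounds[of "real (Suc n)" "a n" "b n" y]
        by (intro mult_mono) auto
      thus ?thesis using True by (simp add: norm_exp_eq_Re)
    next
      case False
      have "y \<notin> box (a n) (b n)"
      proof
        assume "y \<in> box (a n) (b n)"
        hence y: "p $ i - inverse (real (Suc n)) < y $ i" "y $ i < p $ i + inverse (real (Suc n))" for i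
          by (simp_all add: mem_box_cart a_def b_def del: of_nat_Suc)
        have "inverse (real (Suc n)) \<le> 1" by (simp add: inverse_le_1_iff)
        hence "p $ i - 1 < y $ i \<and> y $ i < p $ i + 1" for i using y[of i] by linarith
        thus False using False by (simp add: mem_box_cart a_def b_def)
      qed
      thus ?thesis unfolding \<eta>_def using box_bump_outside[OF pos] by simp
    qed
    show "(\<lambda>n. of_real_fun (\<eta> n) y) \<longlonglongrightarrow> indicator {p} y" for y
    proof (cases "y = p")
      case True thus ?thesis using one by simp
    next
      case False
      have "\<forall>\<^sub>F n in sequentially. 0 = of_real_fun (\<eta> n) y"
        using ev[OF False] by eventually_elim simp
      thus ?thesis using False by (auto intro: Lim_transform_eventually[OF tendsto_const])
    qed
  qed auto
  moreover have "L2_sq (\<lambda>y. of_real_fun (\<eta> n) y - indicator {p} y) = L2_sq (of_real_fun (\<eta> n))" for n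
    unfolding L2_sq_def
  proof (rule integral_cong_AE)
    have [measurable]: "\<eta> n \<in> borel_measurable borel" using t by (rule test_function_measurable)
    show "(\<lambda>y. (norm (of_real_fun (\<eta> n) y - indicator {p} y))\<^sup>2) \<in> borel_measurable lborel"
      "(\<lambda>y. (norm (of_real_fun (\<eta> n) y))\<^sup>2) \<in> borel_measurable lborel" by measurable
    show "AE y in lborel. (norm (of_real_fun (\<eta> n) y - indicator {p} y))\<^sup>2 = (norm (of_real_fun (\<eta> n) y))\<^sup>2"
      using AE_lborel_singleton[of p] by eventually_elim simp
  qed
  ultimately have "(\<lambda>n. L2_sq (of_real_fun (\<eta> n))) \<longlonglongrightarrow> 0" by simp
  hence "\<forall>\<^sub>F n in sequentially. L2_sq (of_real_fun (\<eta> n)) < \<delta>"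
    using order_tendstoD(2) \<delta> by blast
  moreover have "\<forall>\<^sub>F n in sequentially. \<forall>q\<in>F. \<eta> n q = 0"
    using F by (intro eventually_ball_finite ballI ev) auto
  ultimately have "\<forall>\<^sub>F n in sequentially. L2_sq (of_real_fun (\<eta> n)) < \<delta> \<and> (\<forall>q\<in>F. \<eta> n q = 0)"
    by eventually_elim simp
  then obtain n where "L2_sq (of_real_fun (\<eta> n)) < \<delta>" "\<forall>q\<in>F. \<eta> n q = 0"
    using eventually_happens'[OF sequentially_bot] by blast
  thus ?thesis using that[of "\<eta> n"] t one by blast
qed

text \<open>The approximant is corrected at one point at a time by a multiple of a bump of small
  norm. The bump vanishes at the points treated before, so their zeros survive.\<close>

lemma vanishing_test_functions_dense:
  assumes "finite F" "f \<in> L2" "0 < e"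
  shows "\<exists>\<alpha> \<beta>. test_function \<alpha> \<and> test_function \<beta> \<and> (\<forall>p\<in>F. \<alpha> p = 0 \<and> \<beta> p = 0) \<and>
    L2_sq (\<lambda>y. f y - Complex (\<alpha> y) (\<beta> y)) < e"
  using assms(1,3)
proof (induction F arbitrary: e)
  case empty
  thus ?case using test_approximable_L2[OF assms(2)] by (auto simp: test_approximable_def)
next
  case (insert p F)
  obtain \<alpha> \<beta> where ab: "test_function \<alpha>" "test_function \<beta>" "\<forall>p\<in>F. \<alpha> p = 0 \<and> \<beta> p = 0"
    "L2_sq (\<lambda>y. f y - Complex (\<alpha> y) (\<beta> y)) < e / 4"
    using insert.IH[of "e / 4"] insert.prems by auto
  define z where "z = Complex (\<alpha> p) (\<beta> p)"
  define K where "K = (norm z)\<^sup>2 + 1"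
  have K: "0 < K" by (simp add: K_def add_nonneg_pos)
  obtain \<eta> where \<eta>: "test_function \<eta>" "\<eta> p = 1" "\<And>q. q \<in> F \<Longrightarrow> \<eta> q = 0" "L2_sq (of_real_fun \<eta>) < e / (4 * K)"
    using small_test_function[OF insert.hyps, of "e / (4 * K)"] insert.prems K by auto
  let ?a = "\<lambda>y. \<alpha> y - \<alpha> p * \<eta> y" and ?b = "\<lambda>y. \<beta> y - \<beta> p * \<eta> y"
  have t: "test_function ?a" "test_function ?b"
    by (intro test_function_diff test_function_cmult ab \<eta>)+
  have e: "f y - Complex (?a y) (?b y) = (f y - Complex (\<alpha> y) (\<beta> y)) + z * of_real_fun \<eta> y" for y
    by (simp add: complex_eq_iff z_def)
  have "L2_sq (\<lambda>y. f y - Complex (?a y) (?b y)) \<le> 2 * L2_sq (\<lambda>y. f y - Complex (\<alpha> y) (\<beta> y)) + 2 * L2_sq (\<lambda>y. z * of_real_fun \<eta> y)"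
    unfolding e by (intro L2_sq_add_le L2_diff L2_scale Complex_test_L2 test_function_L2 ab \<eta> assms(2))
  also have "L2_sq (\<lambda>y. z * of_real_fun \<eta> y) \<le> K * (e / (4 * K))"
    unfolding L2_sq_scale by (intro mult_mono less_imp_le[OF \<eta>(4)]) (auto simp: K_def)
  also have "K * (e / (4 * K)) = e / 4" using K by simp
  finally have "L2_sq (\<lambda>y. f y - Complex (?a y) (?b y)) < e" using ab(4) by simp
  moreover have "\<forall>q\<in>insert p F. ?a q = 0 \<and> ?b q = 0" using ab(3) \<eta>(2,3) by auto
  ultimately show ?case using t by blast
qed

lemma Complex_test_in_Domain_H_min:
  assumes a: "test_function \<alpha>" and b: "test_function \<beta>" and z: "\<And>j. \<alpha> (x j) = 0 \<and> \<beta> (x j) = 0"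
  shows "(\<lambda>y. Complex (\<alpha> y) (\<beta> y)) \<in> Domain (H_min x)"
proof -
  let ?A = "\<lambda>y. complex_of_real (\<alpha> y - laplacian \<alpha> y)" and ?B = "\<lambda>y. complex_of_real (\<beta> y - laplacian \<beta> y)"
  have L: "?A \<in> L2" "(\<lambda>y. \<i> * ?B y) \<in> L2"
    by (intro L2_scale test_function_L2 test_function_diff test_function_laplacian a b)+
  have r: "resolvent (\<lambda>y. ?A y + \<i> * ?B y) = (\<lambda>y. Complex (\<alpha> y) (\<beta> y))"
  proof (rule ext)
    fix y
    have "resolvent (\<lambda>y. ?A y + \<i> * ?B y) y = resolvent ?A y + \<i> * resolvent ?B y"
      by (subst resolvent_add[OF L]) (simp only: resolvent_scale)
    thus "resolvent (\<lambda>y. ?A y + \<i> * ?B y) y = Complex (\<alpha> y) (\<beta> y)"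
      by (simp only: resolvent_test_function[OF a] resolvent_test_function[OF b] Complex_eq)
  qed
  have "resolvent (\<lambda>y. ?A y + \<i> * ?B y) (x j) = 0" for j
    using z[of j] unfolding r by (simp add: Complex_eq)
  from resolvent_in_H_min[where x=x, OF L2_add[OF L] this] show ?thesis
    unfolding r by blast
qed

text \<open>Density of the domain is part of \<open>L2_self_adjoint\<close>; every extension
  inherits it from here.\<close>

lemma L2_dense_Domain_H_min: "L2_dense (Domain (H_min (x :: 'm::finite \<Rightarrow> real^3)))"
  unfolding L2_dense_def
proof (intro ballI allI impI)
  fix f :: fn3 and e :: real assume "f \<in> L2" "0 < e"
  then obtain \<alpha> \<beta> where "test_function \<alpha>" "test_function \<beta>" "\<forall>p\<in>range x. \<alpha> p = 0 \<and> \<beta> p = 0"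
    "L2_sq (\<lambda>y. f y - Complex (\<alpha> y) (\<beta> y)) < e"
    using vanishing_test_functions_dense[of "range x" f e] by auto
  thus "\<exists>g\<in>Domain (H_min x). (LINT y|lborel. (norm (f y - g y))\<^sup>2) < e"
    using Complex_test_in_Domain_H_min[of \<alpha> \<beta> x] unfolding L2_sq_def
    by (intro bexI[of _ "\<lambda>y. Complex (\<alpha> y) (\<beta> y)"]) auto
qed

lemma zero_in_H_min: "((\<lambda>_. 0), (\<lambda>_. 0)) \<in> H_min x"
proof -
  have "resolvent (\<lambda>y. 0) = (\<lambda>_. 0)" by (rule ext) simp
  thus ?thesis by (simp add: H_min_iff)
qed

section \<open>Extensions defined by relations\<close>

lemma H_min_subset_H_ext:
  assumes "inj x" "(0, 0) \<in> \<Theta>" shows "H_min x \<subseteq> H_ext x \<Theta>"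
  using assms by (auto simp: H_ext_iff[OF assms(1)] H_min_iff_Gamma[OF assms(1)])

text \<open>Surjectivity of the boundary maps makes an arbitrary relation recoverable from its
  extension, hence \<open>inj_H_ext\<close>.\<close>

lemma H_ext_image:
  assumes x: "inj x" shows "(\<lambda>(f, g). (Gamma0 x f, Gamma1 x f)) ` H_ext x \<Theta> = \<Theta>"
proof (intro equalityI subsetI)
  fix p assume "p \<in> \<Theta>"
  then obtain a b where p: "p = (a, b)" "(a, b) \<in> \<Theta>" by (cases p) auto
  obtain f g where "(f, g) \<in> H_max x" "Gamma0 x f = a" "Gamma1 x f = b"
    using Gamma_surj[OF x] by blast
  thus "p \<in> (\<lambda>(f, g). (Gamma0 x f, Gamma1 x f)) ` H_ext x \<Theta>"
    using p by (intro image_eqI[of _ _ "(f, g)"]) (auto simp: H_ext_iff[OF x])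
qed (auto simp: H_ext_iff[OF x])

lemma inj_H_ext: assumes "inj x" shows "inj (H_ext x)"
proof (rule injI)
  fix \<Theta> \<Theta>' assume "H_ext x \<Theta> = H_ext x \<Theta>'"
  from arg_cong[OF this, of "image (\<lambda>(f, g). (Gamma0 x f, Gamma1 x f))"]
  show "\<Theta> = \<Theta>'" by (simp only: H_ext_image[OF assms])
qed

lemma cinner_minus_commute: "cinner h k = cnj (cinner k h)"
  by (simp add: cinner_def mult.commute)

lemma cinner_diff: "cinner (h - h') k = cinner h k - cinner h' k" "cinner k (h - h') = cinner k h - cinner k h'"
  by (simp_all add: cinner_def left_diff_distrib right_diff_distrib sum_subtractf)

lemma cinner_scale: "cinner (a *s h) k = a * cinner h k" "cinner k (a *s h) = cnj a * cinner k h"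
  by (simp_all add: cinner_def sum_distrib_left mult_ac)

lemma cinner_zero [simp]: "cinner 0 k = 0" "cinner k 0 = 0"
  by (simp_all add: cinner_def)

lemma Re_cinner: "Re (cinner h k) = h \<bullet> k"
  by (simp add: cinner_def inner_vec_def inner_complex_def)

lemma cinner_eq_0_iff: "cinner h h = 0 \<longleftrightarrow> h = 0"
  by (metis Re_cinner cinner_zero(1) inner_eq_zero_iff zero_complex.simps(1))

text \<open>The extension contains \<open>H_min\<close>, so its adjoint lies in
  \<open>H_max\<close>. There Green's identity translates the adjoint condition into that of the
  relation, and by surjectivity every pair of the relation is tested.\<close>

lemma L2_adjoint_H_ext:
  assumes x: "inj x" and 0: "(0, 0) \<in> \<Theta>"
  shows "L2_adjoint (H_ext x \<Theta>) = H_ext x (rel_adjoint_in UNIV \<Theta>)"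
proof (intro equalityI subrelI)
  fix g g' assume *: "(g, g') \<in> L2_adjoint (H_ext x \<Theta>)"
  hence m: "(g, g') \<in> H_max x"
    using H_min_subset_H_ext[OF x 0] by (force simp: H_max_def L2_adjoint_def)
  have "cinner h' (Gamma0 x g) = cinner h (Gamma1 x g)" if h: "(h, h') \<in> \<Theta>" for h h'
  proof -
    obtain f f' where f: "(f, f') \<in> H_max x" "Gamma0 x f = h" "Gamma1 x f = h'"
      using Gamma_surj[OF x] by blast
    hence "(f, f') \<in> H_ext x \<Theta>" using h by (simp add: H_ext_iff[OF x])
    hence "L2_inner f' g = L2_inner f g'" using * by (auto simp: L2_adjoint_def)
    thus ?thesis using Green_identity[OF x f(1) m] f by simp
  qed
  thus "(g, g') \<in> H_ext x (rel_adjoint_in UNIV \<Theta>)"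
    using m by (auto simp: H_ext_iff[OF x] rel_adjoint_in_def)
next
  fix g g' assume "(g, g') \<in> H_ext x (rel_adjoint_in UNIV \<Theta>)"
  hence m: "(g, g') \<in> H_max x" and a: "\<And>h h'. (h, h') \<in> \<Theta> \<Longrightarrow> cinner h' (Gamma0 x g) = cinner h (Gamma1 x g)"
    by (auto simp: H_ext_iff[OF x] rel_adjoint_in_def)
  have "L2_inner f' g = L2_inner f g'" if "(f, f') \<in> H_ext x \<Theta>" for f f'
    using Green_identity[OF x _ m, of f f'] a[of "Gamma0 x f" "Gamma1 x f"] that by (simp add: H_ext_iff[OF x])
  thus "(g, g') \<in> L2_adjoint (H_ext x \<Theta>)"
    using H_max_L2[OF m] by (auto simp: L2_adjoint_def)
qed

lemma L2_operator_H_ext: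
  assumes x: "inj x" and l: "linear_relation \<Theta>" shows "L2_operator (H_ext x \<Theta>)"
  unfolding L2_operator_def
proof (intro conjI allI impI)
  show "H_ext x \<Theta> \<subseteq> L2 \<times> L2" using H_max_L2 by (fastforce simp: H_ext_iff[OF x])
  show "(f', g') \<in> H_ext x \<Theta>" if "(f, g) \<in> H_ext x \<Theta> \<and> f' \<in> L2 \<and> g' \<in> L2 \<and> ae_eq f f' \<and> ae_eq g g'" for f g f' g'
    using that H_max_ae_eq[OF x, of f g f' g'] Gamma_ae_eq[of f f' x] by (auto simp: H_ext_iff[OF x])
  show "((\<lambda>_. 0), (\<lambda>_. 0)) \<in> H_ext x \<Theta>"
    using H_min_subset_H_ext[OF x] l zero_in_H_min by (fastforce simp: linear_relation_def)
  show "(\<lambda>y. f y + f' y, \<lambda>y. g y + g' y) \<in> H_ext x \<Theta>" if "(f, g) \<in> H_ext x \<Theta> \<and> (f', g') \<in> H_ext x \<Theta>" for f g f' g'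
    using that l Gamma_add[OF x, of f g f' g'] by (auto simp: H_ext_iff[OF x] linear_relation_def)
  show "(\<lambda>y. c * f y, \<lambda>y. c * g y) \<in> H_ext x \<Theta>" if "(f, g) \<in> H_ext x \<Theta>" for c f g
    using that l Gamma_scale[OF x, of f g c] by (auto simp: H_ext_iff[OF x] linear_relation_def)
  show "ae_eq g g'" if "(f, g) \<in> H_ext x \<Theta> \<and> (f', g') \<in> H_ext x \<Theta> \<and> ae_eq f f'" for f g f' g'
    using that H_max_single_valued[OF x, of f g f' g'] by (auto simp: H_ext_iff[OF x])
qed

lemma L2_self_adjoint_H_ext:
  assumes x: "inj x" and s: "self_adjoint_relation \<Theta>"
  shows "L2_self_adjoint (H_ext x \<Theta>)" "H_min x \<subseteq> H_ext x \<Theta>"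
proof -
  have l: "linear_relation \<Theta>" and a: "rel_adjoint_in UNIV \<Theta> = \<Theta>" using s by (auto simp: self_adjoint_relation_def)
  hence 0: "(0, 0) \<in> \<Theta>" by (simp add: linear_relation_def)
  show m: "H_min x \<subseteq> H_ext x \<Theta>" by (rule H_min_subset_H_ext[OF x 0])
  have "L2_dense (Domain (H_ext x \<Theta>))"
    using L2_dense_Domain_H_min[of x] Domain_mono[OF m] unfolding L2_dense_def by blast
  thus "L2_self_adjoint (H_ext x \<Theta>)"
    using L2_operator_H_ext[OF x l] L2_adjoint_H_ext[OF x 0] a by (simp add: L2_self_adjoint_def)
qed

text \<open>The relation is the set of boundary values of \<open>A\<close>. Once \<open>A\<close> is
  recognized as its extension, self-adjointness passes to the relation by
  \<open>L2_adjoint_H_ext\<close> and injectivity of \<open>H_ext x\<close>.\<close>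

lemma self_adjoint_extension_is_H_ext:
  assumes x: "inj x" and s: "L2_self_adjoint A" and m: "H_min x \<subseteq> A"
  obtains \<Theta> where "self_adjoint_relation \<Theta>" "A = H_ext x \<Theta>"
proof -
  have op: "L2_operator A" and adj: "L2_adjoint A = A" using s by (auto simp: L2_self_adjoint_def)
  \<comment> \<open>Adjoints reverse the inclusion of \<open>H_min x\<close> in \<open>A\<close>,
    and \<open>A\<close> is its own adjoint.\<close>
  have AM: "A \<subseteq> H_max x"
    using m by (subst adj[symmetric]) (force simp: H_max_def L2_adjoint_def)
  define \<Theta> where "\<Theta> = (\<lambda>(f, g). (Gamma0 x f, Gamma1 x f)) ` A"
  have addA: "(\<lambda>y. f y + f' y, \<lambda>y. g y + g' y) \<in> A" if "(f, g) \<in> A" "(f', g') \<in> A" for f g f' g'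
    using op that unfolding L2_operator_def by blast
  have scA: "(\<lambda>y. c * f y, \<lambda>y. c * g y) \<in> A" if "(f, g) \<in> A" for c f g
    using op that unfolding L2_operator_def by blast
  have eq: "A = H_ext x \<Theta>"
  proof (intro equalityI subrelI)
    fix f g assume "(f, g) \<in> A"
    thus "(f, g) \<in> H_ext x \<Theta>" using AM by (force simp: H_ext_iff[OF x] \<Theta>_def)
  next
    \<comment> \<open>Elements with equal boundary values differ by an element of
      \<open>H_min x\<close>, which \<open>A\<close> contains.\<close>
    fix f g assume "(f, g) \<in> H_ext x \<Theta>"
    then obtain f' g' where f: "(f, g) \<in> H_max x" and f': "(f', g') \<in> A"
      and G: "Gamma0 x f = Gamma0 x f'" "Gamma1 x f = Gamma1 x f'"
      by (auto simp: H_ext_iff[OF x] \<Theta>_def)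
    have fm: "(f', g') \<in> H_max x" using f' AM by blast
    have sc: "(\<lambda>y. (-1) * f' y, \<lambda>y. (-1) * g' y) \<in> H_max x"
      "Gamma0 x (\<lambda>y. (-1) * f' y) = (-1) *s Gamma0 x f'" "Gamma1 x (\<lambda>y. (-1) * f' y) = (-1) *s Gamma1 x f'"
      by (rule Gamma_scale[OF x fm])+
    have "(\<lambda>y. f y + (-1) * f' y, \<lambda>y. g y + (-1) * g' y) \<in> H_min x"
      unfolding H_min_iff_Gamma[OF x]
      using Gamma_add[OF x f sc(1)] sc(2,3) G by (simp add: vec_eq_iff)
    hence "(\<lambda>y. f y + (-1) * f' y, \<lambda>y. g y + (-1) * g' y) \<in> A" using m by blast
    from addA[OF this f'] show "(f, g) \<in> A" by simp
  qed
  have z: "((\<lambda>_. 0), (\<lambda>_. 0)) \<in> A" using op by (simp add: L2_operator_def)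
  have lin: "linear_relation \<Theta>"
    unfolding linear_relation_def
  proof (intro conjI allI impI)
    have "Gamma0 x (\<lambda>_. 0) = 0" "Gamma1 x (\<lambda>_. 0) = 0"
      using zero_in_H_min[of x] by (auto simp: H_min_iff_Gamma[OF x])
    thus "(0, 0) \<in> \<Theta>" unfolding \<Theta>_def using z by (intro image_eqI[of _ _ "((\<lambda>_. 0), (\<lambda>_. 0))"]) auto
    fix h h' k k' assume "(h, h') \<in> \<Theta> \<and> (k, k') \<in> \<Theta>"
    then obtain f g u v where 1: "(f, g) \<in> A" "h = Gamma0 x f" "h' = Gamma1 x f"
      "(u, v) \<in> A" "k = Gamma0 x u" "k' = Gamma1 x u" by (auto simp: \<Theta>_def)
    have 2: "(f, g) \<in> H_max x" "(u, v) \<in> H_max x" using 1 AM by auto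
    show "(h + k, h' + k') \<in> \<Theta>"
      unfolding \<Theta>_def using addA[OF 1(1,4)] Gamma_add(2,3)[OF x 2] 1
      by (intro image_eqI[of _ _ "(\<lambda>y. f y + u y, \<lambda>y. g y + v y)"]) auto
  next
    fix c h h' assume "(h, h') \<in> \<Theta>"
    then obtain f g where 1: "(f, g) \<in> A" "h = Gamma0 x f" "h' = Gamma1 x f" by (auto simp: \<Theta>_def)
    have 2: "(f, g) \<in> H_max x" using 1 AM by auto
    show "(c *s h, c *s h') \<in> \<Theta>"
      unfolding \<Theta>_def using scA[OF 1(1)] Gamma_scale(2,3)[OF x 2] 1
      by (intro image_eqI[of _ _ "(\<lambda>y. c * f y, \<lambda>y. c * g y)"]) auto
  qed
  have "H_ext x (rel_adjoint_in UNIV \<Theta>) = H_ext x \<Theta>"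
    using L2_adjoint_H_ext[OF x, of \<Theta>] lin adj eq by (simp add: linear_relation_def)
  hence "rel_adjoint_in UNIV \<Theta> = \<Theta>" using inj_H_ext[OF x] by (simp add: inj_eq)
  thus ?thesis using that[OF _ eq] lin by (simp add: self_adjoint_relation_def)
qed

lemma bij_betw_H_ext:
  assumes x: "inj x"
  shows "bij_betw (H_ext x) {\<Theta>. self_adjoint_relation \<Theta>} {A. L2_self_adjoint A \<and> H_min x \<subseteq> A}"
  unfolding bij_betw_def
proof
  show "inj_on (H_ext x) {\<Theta>. self_adjoint_relation \<Theta>}"
    using inj_H_ext[OF x] by (rule inj_on_subset) simp
  show "H_ext x ` {\<Theta>. self_adjoint_relation \<Theta>} = {A. L2_self_adjoint A \<and> H_min x \<subseteq> A}"
  proof (intro equalityI subsetI)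
    fix A assume "A \<in> {A. L2_self_adjoint A \<and> H_min x \<subseteq> A}"
    thus "A \<in> H_ext x ` {\<Theta>. self_adjoint_relation \<Theta>}"
      using self_adjoint_extension_is_H_ext[OF x, of A] by blast
  qed (use L2_self_adjoint_H_ext[OF x] in auto)
qed

section \<open>Self-adjoint relations in a finite-dimensional space\<close>

definition complex_subspace :: "(complex^'m) set \<Rightarrow> bool" where
  "complex_subspace K \<longleftrightarrow> 0 \<in> K \<and> (\<forall>h\<in>K. \<forall>k\<in>K. h + k \<in> K) \<and> (\<forall>c. \<forall>h\<in>K. c *s h \<in> K)"

lemma scaleR_eq_scalar: "a *\<^sub>R (h :: complex^'m) = of_real a *s h"
  unfolding vec_eq_iff vector_scaleR_component vector_smult_component by (simp add: scaleR_conv_of_real)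

lemma complex_subspace_subspace: "complex_subspace K \<Longrightarrow> subspace K"
  by (simp add: complex_subspace_def subspace_def scaleR_eq_scalar)

text \<open>The real orthogonal decomposition suffices: the subspace is stable under multiplication
  by \<open>\<i>\<close>, so orthogonality to \<open>\<i> *s h\<close> also removes the imaginary
  part of \<open>cinner h b\<close>.\<close>

lemma complex_subspace_decomposition:
  assumes K: "complex_subspace (K :: (complex^'m::finite) set)"
  obtains a b where "v = a + b" "a \<in> K" "\<And>h. h \<in> K \<Longrightarrow> cinner h b = 0"
proof -
  have sp: "span K = K" using complex_subspace_subspace[OF K] by (simp add: span_eq_iff)
  obtain a b where ab: "a \<in> span K" "\<And>w. w \<in> span K \<Longrightarrow> orthogonal b w" "v = a + b"
    using orthogonal_subspace_decomp_exists[of K v] by metis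
  have o: "h \<bullet> b = 0" if "h \<in> K" for h
    using ab(2)[of h] that sp by (simp add: orthogonal_def inner_commute)
  have "cinner h b = 0" if h: "h \<in> K" for h
  proof (rule complex_eqI)
    show "Re (cinner h b) = Re 0" using o[OF h] by (simp add: Re_cinner)
    have "\<i> *s h \<in> K" using K h by (simp add: complex_subspace_def)
    hence "Re (cinner (\<i> *s h) b) = 0" using o by (simp add: Re_cinner)
    thus "Im (cinner h b) = Im 0" by (simp add: cinner_scale)
  qed
  thus ?thesis using that ab sp by blast
qed

lemma complex_subspace_Domain:
  assumes "linear_relation \<Theta>" shows "complex_subspace (Domain \<Theta>)"
  using assms unfolding complex_subspace_def linear_relation_def by (meson Domain.cases DomainI)

lemma H_op_eq_Domain:
  assumes "linear_relation \<Theta>" shows "H_op \<Theta> = Domain \<Theta>"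
  unfolding H_op_def
  by (intro closure_closed closed_subspace complex_subspace_subspace complex_subspace_Domain assms)

locale sa_relation =
  fixes \<Theta> :: "((complex^'m::finite) \<times> (complex^'m)) set"
  assumes self_adjoint: "self_adjoint_relation \<Theta>"
begin

lemma linear: "linear_relation \<Theta>" and adjoint: "rel_adjoint_in UNIV \<Theta> = \<Theta>"
  using self_adjoint by (auto simp: self_adjoint_relation_def)

lemma add: "(h, h') \<in> \<Theta> \<Longrightarrow> (k, k') \<in> \<Theta> \<Longrightarrow> (h + k, h' + k') \<in> \<Theta>"
  and scale: "(h, h') \<in> \<Theta> \<Longrightarrow> (c *s h, c *s h') \<in> \<Theta>"
  using linear by (auto simp: linear_relation_def)

lemma diff: assumes "(h, h') \<in> \<Theta>" "(k, k') \<in> \<Theta>" shows "(h - k, h' - k') \<in> \<Theta>"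
proof -
  have "(-1) *s u = - u" for u :: "complex^'m" by (simp add: vec_eq_iff)
  thus ?thesis using add[OF assms(1) scale[OF assms(2), of "-1"]] by simp
qed

lemma mem_iff: "(k, k') \<in> \<Theta> \<longleftrightarrow> (\<forall>(h, h')\<in>\<Theta>. cinner h' k = cinner h k')"
  by (subst adjoint[symmetric]) (auto simp: rel_adjoint_in_def)

lemma symmetric: "(h, h') \<in> \<Theta> \<Longrightarrow> (k, k') \<in> \<Theta> \<Longrightarrow> cinner h' k = cinner h k'"
  using mem_iff[of k k'] by auto

text \<open>\<open>mem_iff\<close> with first component \<open>0\<close>: the multivalued part is
  the orthogonal complement of the domain.\<close>

lemma mul_iff: "(0, h') \<in> \<Theta> \<longleftrightarrow> (\<forall>h\<in>Domain \<Theta>. cinner h h' = 0)"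
  unfolding mem_iff by auto

lemma subspace_Domain: "complex_subspace (Domain \<Theta>)"
  by (rule complex_subspace_Domain[OF linear])

text \<open>Any value of the relation at \<open>h\<close> splits into a part in the domain and a
  part orthogonal to it. By \<open>mul_iff\<close> the latter lies in the multivalued part and can
  be subtracted; the difference of two remaining values is orthogonal to itself.\<close>

lemma op_exists:
  assumes "h \<in> Domain \<Theta>" shows "\<exists>!h'. h' \<in> Domain \<Theta> \<and> (h, h') \<in> \<Theta>"
proof -
  obtain v where v: "(h, v) \<in> \<Theta>" using assms by auto
  obtain a b where ab: "v = a + b" "a \<in> Domain \<Theta>" "\<And>h. h \<in> Domain \<Theta> \<Longrightarrow> cinner h b = 0"
    using complex_subspace_decomposition[OF subspace_Domain, of v] by blast
  have "(0, b) \<in> \<Theta>" using ab(3) by (simp add: mul_iff)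
  from diff[OF v this] have a: "(h, a) \<in> \<Theta>" using ab(1) by simp
  show ?thesis
  proof (rule ex1I[of _ a])
    show "a \<in> Domain \<Theta> \<and> (h, a) \<in> \<Theta>" using a ab by simp
    fix c assume c: "c \<in> Domain \<Theta> \<and> (h, c) \<in> \<Theta>"
    have "(0, c - a) \<in> \<Theta>" using diff[of h c h a] a c by simp
    hence "cinner c (c - a) = 0" "cinner a (c - a) = 0" using c ab(2) by (auto simp: mul_iff)
    hence "cinner (c - a) (c - a) = 0" by (simp add: cinner_diff(1)[of c a])
    thus "c = a" by (simp add: cinner_eq_0_iff)
  qed
qed

definition op :: "complex^'m \<Rightarrow> complex^'m" where
  "op h = (THE h'. h' \<in> Domain \<Theta> \<and> (h, h') \<in> \<Theta>)"

lemma op: "h \<in> Domain \<Theta> \<Longrightarrow> op h \<in> Domain \<Theta> \<and> (h, op h) \<in> \<Theta>"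
  unfolding op_def by (rule theI'[OF op_exists])

lemma op_unique: "(h, h') \<in> \<Theta> \<Longrightarrow> h' \<in> Domain \<Theta> \<Longrightarrow> h' = op h"
  by (metis DomainI op op_exists)

lemma op_part: "rel_op_part \<Theta> = graph_in (Domain \<Theta>) op"
  unfolding rel_op_part_def H_op_eq_Domain[OF linear] graph_in_def
  using op op_unique by (blast intro: DomainI)

lemma linear_operator: "linear_operator_in (Domain \<Theta>) op"
  unfolding linear_operator_in_def
proof (intro conjI ballI allI)
  fix h k c assume h: "h \<in> Domain \<Theta>" and k: "k \<in> Domain \<Theta>"
  show "op h \<in> Domain \<Theta>" using op[OF h] by simp
  show "op (h + k) = op h + op k"
    using subspace_Domain op[OF h] op[OF k]
    by (intro op_unique[symmetric] add) (auto simp: complex_subspace_def)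
next
  fix c h assume h: "h \<in> Domain \<Theta>"
  show "op (c *s h) = c *s op h"
    using subspace_Domain op[OF h]
    by (intro op_unique[symmetric] scale) (auto simp: complex_subspace_def)
qed

text \<open>Values of the relation differ from those of \<open>op\<close> by elements orthogonal to
  the domain. A pair adjoint to \<open>op\<close> within the domain is therefore adjoint to the
  whole relation, so it belongs to it.\<close>

lemma self_adjoint_operator: "self_adjoint_operator_in (Domain \<Theta>) op"
  unfolding self_adjoint_operator_in_def
proof (intro conjI linear_operator equalityI subrelI)
  fix k k' assume *: "(k, k') \<in> rel_adjoint_in (Domain \<Theta>) (graph_in (Domain \<Theta>) op)"
  hence k: "k \<in> Domain \<Theta>" "k' \<in> Domain \<Theta>" and a: "\<And>h. h \<in> Domain \<Theta> \<Longrightarrow> cinner (op h) k = cinner h k'"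
    by (auto simp: rel_adjoint_in_def graph_in_def)
  have "cinner h' k = cinner h k'" if h: "(h, h') \<in> \<Theta>" for h h'
  proof -
    have hD: "h \<in> Domain \<Theta>" using h by blast
    have "(0, h' - op h) \<in> \<Theta>" using diff[OF h conjunct2[OF op[OF hD]]] by simp
    hence "cinner k (h' - op h) = 0" using k by (simp add: mul_iff)
    hence "cinner (h' - op h) k = 0" using cinner_minus_commute[of "h' - op h" k] by simp
    thus ?thesis using a[OF hD] by (simp add: cinner_diff)
  qed
  hence "(k, k') \<in> \<Theta>" by (auto simp: mem_iff)
  hence "k' = op k" using k by (intro op_unique)
  thus "(k, k') \<in> graph_in (Domain \<Theta>) op" using k by (auto simp: graph_in_def)
next
  fix k k' assume "(k, k') \<in> graph_in (Domain \<Theta>) op"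
  thus "(k, k') \<in> rel_adjoint_in (Domain \<Theta>) (graph_in (Domain \<Theta>) op)"
    using op symmetric by (auto simp: graph_in_def rel_adjoint_in_def)
qed

lemma Domain_UNIV_iff: "Domain \<Theta> = UNIV \<longleftrightarrow> rel_mul \<Theta> = {0}"
proof
  assume "Domain \<Theta> = UNIV"
  thus "rel_mul \<Theta> = {0}"
    using cinner_eq_0_iff by (auto simp: rel_mul_def mul_iff)
next
  assume m: "rel_mul \<Theta> = {0}"
  show "Domain \<Theta> = UNIV"
  proof (intro equalityI subsetI UNIV_I)
    fix v :: "complex^'m"
    obtain a b where ab: "v = a + b" "a \<in> Domain \<Theta>" "\<And>h. h \<in> Domain \<Theta> \<Longrightarrow> cinner h b = 0"
      using complex_subspace_decomposition[OF subspace_Domain, of v] by blast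
    have "b \<in> rel_mul \<Theta>" using ab(3) by (simp add: rel_mul_def mul_iff)
    thus "v \<in> Domain \<Theta>" using ab m by simp
  qed
qed

end

section \<open>The parametrization in terms of the matrices\<close>

lemma cinner_E1: "cinner (E1 x *v u) v = cinner u (E1 x *v v)"
proof -
  have "cinner (E1 x *v u) v = (\<Sum>k\<in>UNIV. \<Sum>j\<in>UNIV. E1 x $ k $ j * u $ j * cnj (v $ k))"
    by (simp add: cinner_def matrix_vector_mult_def sum_distrib_right)
  also have "\<dots> = (\<Sum>j\<in>UNIV. \<Sum>k\<in>UNIV. E1 x $ k $ j * u $ j * cnj (v $ k))"
    by (rule sum.swap)
  also have "\<dots> = (\<Sum>j\<in>UNIV. \<Sum>k\<in>UNIV. u $ j * cnj (E1 x $ j $ k * v $ k))"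
    by (intro sum.cong refl) (simp add: E1_def norm_minus_commute)
  also have "\<dots> = cinner u (E1 x *v v)"
    by (simp add: cinner_def matrix_vector_mult_def sum_distrib_left)
  finally show ?thesis .
qed

text \<open>A common element of the two domains has \<open>Gamma0 f = 0\<close> and
  \<open>Gamma1 f\<close> in the multivalued part; by surjectivity every element of the multivalued
  part arises so, and it is \<open>0\<close> exactly for elements of \<open>H_min x\<close>.\<close>

lemma disjoint_ext_iff:
  assumes x: "inj x" and s: "self_adjoint_relation \<Theta>"
  shows "disjoint_ext x (H_ext x \<Theta>) (H_zero x) \<longleftrightarrow> rel_mul \<Theta> = {0}"
proof -
  have 0: "(0, 0) \<in> \<Theta>" using s by (simp add: self_adjoint_relation_def linear_relation_def)
  have sub: "Domain (H_min x) \<subseteq> Domain (H_ext x \<Theta>) \<inter> Domain (H_zero x)"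
    using H_min_subset_H_ext[OF x 0] by (force simp: H_zero_def H_min_iff_Gamma[OF x])
  show ?thesis
  proof
    assume d: "disjoint_ext x (H_ext x \<Theta>) (H_zero x)"
    have "b = 0" if b: "(0, b) \<in> \<Theta>" for b
    proof -
      obtain f g where f: "(f, g) \<in> H_max x" "Gamma0 x f = 0" "Gamma1 x f = b"
        using Gamma_surj[OF x] by blast
      have "f \<in> Domain (H_ext x \<Theta>) \<inter> Domain (H_zero x)"
        using f b by (auto simp: H_ext_iff[OF x] H_zero_def intro!: DomainI)
      hence "f \<in> Domain (H_min x)" using d unfolding disjoint_ext_def by (simp only:)
      thus "b = 0" using f(3) by (auto simp: H_min_iff_Gamma[OF x])
    qed
    thus "rel_mul \<Theta> = {0}" using 0 by (auto simp: rel_mul_def)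
  next
    assume m: "rel_mul \<Theta> = {0}"
    have "f \<in> Domain (H_min x)" if f: "f \<in> Domain (H_ext x \<Theta>)" "f \<in> Domain (H_zero x)" for f
    proof -
      obtain g where g: "(f, g) \<in> H_max x" "(Gamma0 x f, Gamma1 x f) \<in> \<Theta>"
        using f(1) by (auto simp: H_ext_iff[OF x])
      have "Gamma0 x f = 0" using f(2) by (auto simp: H_zero_def)
      moreover from this have "Gamma1 x f = 0" using g(2) m by (auto simp: rel_mul_def)
      ultimately show ?thesis using g(1) by (intro DomainI[of f g]) (simp add: H_min_iff_Gamma[OF x])
    qed
    thus "disjoint_ext x (H_ext x \<Theta>) (H_zero x)" using sub by (auto simp: disjoint_ext_def)
  qed
qed

theorem proposition4p2:
  fixes x :: "'m::finite \<Rightarrow> real^3"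
  assumes "inj x"
  shows "bij_betw (H_ext x) {\<Theta>. self_adjoint_relation \<Theta>} {A. L2_self_adjoint A \<and> H_min x \<subseteq> A} \<and>
    invertible (E1 x) \<and>
    (\<forall>\<Theta>. self_adjoint_relation \<Theta> \<longrightarrow>
      (\<exists>B. self_adjoint_operator_in (H_op \<Theta>) B \<and>
        rel_inf_part \<Theta> =
          {(0, E1 x *v \<xi>1'') | \<xi>1''. \<forall>\<xi>0\<in>H_op \<Theta>. cinner \<xi>1'' (E1 x *v \<xi>0) = 0} \<and>
        rel_op_part \<Theta> =
          {((4 * pi) *\<^sub>R \<xi>0, E0 x *v \<xi>0 + E1 x *v \<xi>1') | \<xi>0 \<xi>1'.
             \<xi>0 \<in> H_op \<Theta> \<and>
             \<xi>1' = matrix_inv (E1 x) *v ((4 * pi) *\<^sub>R B \<xi>0 - E0 x *v \<xi>0)} \<and>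
        (disjoint_ext x (H_ext x \<Theta>) (H_zero x) \<longleftrightarrow> Domain \<Theta> = UNIV) \<and>
        (Domain \<Theta> = UNIV \<longrightarrow> \<Theta> = rel_op_part \<Theta> \<and> \<Theta> = graph_in UNIV B)))"
proof (intro conjI allI impI)
  show "bij_betw (H_ext x) {\<Theta>. self_adjoint_relation \<Theta>} {A. L2_self_adjoint A \<and> H_min x \<subseteq> A}"
    by (rule bij_betw_H_ext[OF assms])
  show inv: "invertible (E1 x)" by (rule invertible_E1[OF assms])
  have E1_inv: "E1 x *v (matrix_inv (E1 x) *v v) = v" for v
    using matrix_inv_right[OF inv] by (simp add: matrix_vector_mul_assoc)
  fix \<Theta> :: "((complex^'m) \<times> (complex^'m)) set" assume s: "self_adjoint_relation \<Theta>"
  interpret sa_relation \<Theta> by unfold_locales (rule s)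
  note Hop = H_op_eq_Domain[OF linear]
  have "rel_inf_part \<Theta> = {(0, E1 x *v \<xi>1'') | \<xi>1''. \<forall>\<xi>0\<in>Domain \<Theta>. cinner \<xi>1'' (E1 x *v \<xi>0) = 0}"
    (is "_ = ?I")
  proof (intro equalityI subrelI)
    fix h h' assume "(h, h') \<in> rel_inf_part \<Theta>"
    hence h: "h = 0" "(0, h') \<in> \<Theta>" by (auto simp: rel_inf_part_def rel_mul_def)
    \<comment> \<open>Invertibility writes each element of the multivalued part as
      \<open>E1 x *v u\<close>; symmetry of \<open>E1\<close> turns its orthogonality to the domain
      into the condition on \<open>u\<close>.\<close>
    define u where "u = matrix_inv (E1 x) *v h'"
    have u: "E1 x *v u = h'" by (simp add: u_def E1_inv)
    have "cinner u (E1 x *v \<xi>) = 0" if "\<xi> \<in> Domain \<Theta>" for \<xi>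
      using h(2) that cinner_minus_commute[of h' \<xi>] by (simp add: cinner_E1[symmetric] u mul_iff)
    thus "(h, h') \<in> ?I" using u h(1) by blast
  next
    fix h h' assume "(h, h') \<in> ?I"
    then obtain u where u: "h = 0" "h' = E1 x *v u" "\<forall>\<xi>\<in>Domain \<Theta>. cinner u (E1 x *v \<xi>) = 0" by blast
    have "cinner \<xi> h' = 0" if "\<xi> \<in> Domain \<Theta>" for \<xi>
      using u(3) that cinner_minus_commute[of \<xi> h'] by (simp add: u(2) cinner_E1)
    thus "(h, h') \<in> rel_inf_part \<Theta>" using u(1) by (simp add: rel_inf_part_def rel_mul_def mul_iff)
  qed
  moreover have "rel_op_part \<Theta> = {((4 * pi) *\<^sub>R \<xi>0, E0 x *v \<xi>0 + E1 x *v \<xi>1') | \<xi>0 \<xi>1'.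
             \<xi>0 \<in> Domain \<Theta> \<and> \<xi>1' = matrix_inv (E1 x) *v ((4 * pi) *\<^sub>R op \<xi>0 - E0 x *v \<xi>0)}"
    (is "_ = ?O")
  proof -
    \<comment> \<open>\<open>E0\<close> cancels: by the choice of \<open>\<xi>1'\<close> the second
      component collapses to \<open>(4 * pi) *\<^sub>R op \<xi>0\<close>.\<close>
    have "?O = {((4 * pi) *\<^sub>R \<xi>0, (4 * pi) *\<^sub>R op \<xi>0) | \<xi>0. \<xi>0 \<in> Domain \<Theta>}"
      by (auto simp: E1_inv)
    also have "\<dots> = graph_in (Domain \<Theta>) op"
    proof (intro equalityI subrelI)
      fix h h' assume "(h, h') \<in> {((4 * pi) *\<^sub>R \<xi>0, (4 * pi) *\<^sub>R op \<xi>0) | \<xi>0. \<xi>0 \<in> Domain \<Theta>}"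
      then obtain \<xi> where \<xi>: "\<xi> \<in> Domain \<Theta>" "h = of_real (4 * pi) *s \<xi>" "h' = of_real (4 * pi) *s op \<xi>"
        unfolding scaleR_eq_scalar by blast
      have "op (of_real (4 * pi) *s \<xi>) = of_real (4 * pi) *s op \<xi>"
        using linear_operator \<xi>(1) unfolding linear_operator_in_def by blast
      moreover have "of_real (4 * pi) *s \<xi> \<in> Domain \<Theta>"
        using subspace_Domain \<xi>(1) unfolding complex_subspace_def by blast
      ultimately show "(h, h') \<in> graph_in (Domain \<Theta>) op"
        unfolding graph_in_def \<xi>(2,3) by (metis (mono_tags, lifting) mem_Collect_eq)
    next
      fix h h' assume "(h, h') \<in> graph_in (Domain \<Theta>) op"
      hence h: "h \<in> Domain \<Theta>" "h' = op h" by (auto simp: graph_in_def)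
      \<comment> \<open>The parameter \<open>\<xi>0\<close> belonging to a point \<open>h\<close> of
        the graph; the domain is a subspace, so it contains this multiple.\<close>
      define k where "k = of_real (1 / (4 * pi)) *s h"
      have k: "k \<in> Domain \<Theta>" "op k = of_real (1 / (4 * pi)) *s op h"
        using h(1) linear_operator subspace_Domain
        by (auto simp: k_def linear_operator_in_def complex_subspace_def)
      have "(4 * pi) *\<^sub>R k = h" by (simp add: k_def scaleR_eq_scalar vec_eq_iff)
      moreover have "(4 * pi) *\<^sub>R op k = h'" by (simp add: k(2) h(2) scaleR_eq_scalar vec_eq_iff)
      ultimately show "(h, h') \<in> {((4 * pi) *\<^sub>R \<xi>0, (4 * pi) *\<^sub>R op \<xi>0) | \<xi>0. \<xi>0 \<in> Domain \<Theta>}"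
        using k(1) by blast
    qed
    finally show ?thesis by (simp add: op_part)
  qed
  moreover have "disjoint_ext x (H_ext x \<Theta>) (H_zero x) \<longleftrightarrow> Domain \<Theta> = UNIV"
    by (simp add: disjoint_ext_iff[OF assms s] Domain_UNIV_iff)
  moreover have "\<Theta> = rel_op_part \<Theta> \<and> \<Theta> = graph_in UNIV op" if "Domain \<Theta> = UNIV"
  proof -
    have "\<Theta> = rel_op_part \<Theta>" by (simp add: rel_op_part_def Hop that)
    thus ?thesis using op_part that by simp
  qed
  ultimately show "\<exists>B. self_adjoint_operator_in (H_op \<Theta>) B \<and>
        rel_inf_part \<Theta> =
          {(0, E1 x *v \<xi>1'') | \<xi>1''. \<forall>\<xi>0\<in>H_op \<Theta>. cinner \<xi>1'' (E1 x *v \<xi>0) = 0} \<and>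
        rel_op_part \<Theta> =
          {((4 * pi) *\<^sub>R \<xi>0, E0 x *v \<xi>0 + E1 x *v \<xi>1') | \<xi>0 \<xi>1'.
             \<xi>0 \<in> H_op \<Theta> \<and>
             \<xi>1' = matrix_inv (E1 x) *v ((4 * pi) *\<^sub>R B \<xi>0 - E0 x *v \<xi>0)} \<and>
        (disjoint_ext x (H_ext x \<Theta>) (H_zero x) \<longleftrightarrow> Domain \<Theta> = UNIV) \<and>
        (Domain \<Theta> = UNIV \<longrightarrow> \<Theta> = rel_op_part \<Theta> \<and> \<Theta> = graph_in UNIV B)"
    unfolding Hop using self_adjoint_operator by (intro exI[of _ op]) blast
qed

end
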